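(* Let $(\mathcal{E},\mathcal{S})$ be a (possibly large) realized limit sketch such that every $\mathcal{S}$-model is small. Then for any cocomplete category $\mathcal{C}$ there is a natural equivalence of categories $$\mathrm{Hom}_{\mathrm{c}}(\mathrm{Mod}(\mathcal{S}),\mathcal{C}) \simeq \mathrm{Mod}_{\mathcal{C}}(\mathcal{S}^{\mathrm{op}}).$$ Thus, if $\mathrm{Mod}(\mathcal{S})$ is also cocomplete, $\mathrm{Mod}(\mathcal{S})$ is the universal example of a cocomplete category with a model of the colimit sketch $\mathcal{S}^{\mathrm{op}}$, namely the Yoneda model $Y : \mathcal{E}^{\mathrm{op}} \to \mathrm{Mod}(\mathcal{S})$ with $Y(A) := \mathrm{Hom}(A,-)$.
   Context: Conventions: categories are locally small unless otherwise stated; limits, colimits, cones and cocones are indexed by small categories; (co)complete means having all small (co)limits and (co)continuous means preserving all small (co)limits. $\mathrm{Hom}_{\mathrm{c}}(\mathcal{A},\mathcal{C})$ is the (not necessarily locally small) category of cocontinuous functors $\mathcal{A}\to\mathcal{C}$ and natural transformations. A limit sketch $(\mathcal{E},\mathcal{S})$ (often abbreviated $\mathcal{S}$) consists of a category $\mathcal{E}$ and a class $\mathcal{S}$ of cones in $\mathcal{E}$, called distinguished cones. A $\mathcal{C}$-valued model of it is a functor $\mathcal{E}\to\mathcal{C}$ mapping every distinguished cone to a limit cone; $\mathrm{Mod}_{\mathcal{C}}(\mathcal{S})\subseteq \mathrm{Hom}(\mathcal{E},\mathcal{C})$ is the full subcategory of $\mathcal{C}$-valued models, and $\mathrm{Mod}(\mathcal{S}):=\mathrm{Mod}_{\mathsf{Set}}(\mathcal{S})$;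 "$\mathcal{S}$-model" means $\mathsf{Set}$-valued model. The sketch is realized if for every $A\in\mathcal{E}$ the functor $\mathrm{Hom}(A,-):\mathcal{E}\to\mathsf{Set}$ is a model (a "representable model"), i.e. all distinguished cones are limit cones in $\mathcal{E}$. A model of a realized limit sketch is small if it is a (small) colimit, taken inside $\mathrm{Mod}(\mathcal{S})$, of representable models. Dually, a colimit sketch is a category with a class of cocones, and its models are the functors mapping the distinguished cocones to colimit cocones; $(\mathcal{E}^{\mathrm{op}},\mathcal{S}^{\mathrm{op}})$ is the colimit sketch dual to $(\mathcal{E},\mathcal{S})$, so $\mathrm{Mod}_{\mathcal{C}}(\mathcal{S}^{\mathrm{op}})$ is the category of functors $\mathcal{E}^{\mathrm{op}}\to\mathcal{C}$ mapping the (opposites of the) distinguished cones to colimit cocones. "Universal example" means that $Y$ is an $\mathcal{S}^{\mathrm{op}}$-model in $\mathrm{Mod}(\mathcal{S})$ and that the equivalence is given by $F\mapsto F\circ Y$ for every cocomplete $\mathcal{C}$. *)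

theory Defs
  imports "HOL-Library.FuncSet" "HOL-Library.Equipollence"
begin

section \<open>Sizes\<close>

text \<open>
  The type \<open>'u\<close> plays the role of a universe: its elements are all available names for elements of
  small sets, and a set (over any type) is small when it has strictly smaller cardinality than
  \<open>'u\<close>. For this to be the usual notion of smallness, the cardinality of \<open>'u\<close> has to be a regular
  strong limit. Up to isomorphism every small set is a small subset of \<open>'u\<close>, every small category
  is of type \<open>('u, 'u) cat\<close>, and a locally small category can be presented with hom-sets that
  are small subsets of \<open>'u\<close>. Collections of objects range over arbitrary types and are never
  required to be small.

  Uncountability is not required, so hereditarily finite sets count as a universe,
  as witnessed by the type \<open>nat\<close>.
\<close>

definition small :: "'u itself \<Rightarrow> 'x set \<Rightarrow> bool" where
  "small _ X \<longleftrightarrow> X \<prec> (UNIV :: 'u set)"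

definition small_universe :: "'u itself \<Rightarrow> bool" where
  "small_universe U \<longleftrightarrow>
     infinite (UNIV :: 'u set) \<and>
     (\<forall>X :: 'u set. small U X \<longrightarrow> small U (Pow X)) \<and>
     (\<forall>(I :: 'u set) (X :: 'u \<Rightarrow> 'u set).
        small U I \<and> (\<forall>i\<in>I. small U (X i)) \<longrightarrow> small U (\<Union>i\<in>I. X i))"

lemma small_universe_nat: "small_universe TYPE(nat)"
proof -
  have small_iff: "small TYPE(nat) X \<longleftrightarrow> finite X" for X :: "'x set"
  proof (cases "finite X")
    case True
    then have "X \<prec> (UNIV :: nat set)"
      by (rule finite_lesspoll_infinite[OF infinite_UNIV_nat])
    with True show ?thesis by (simp add: small_def)
  next
    case False
    then have "(UNIV :: nat set) \<lesssim> X" by (rule iffD1[OF infinite_le_lepoll])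
    then have "\<not> X \<prec> (UNIV :: nat set)" by (metis lesspoll_def lepoll_antisym)
    with False show ?thesis by (simp add: small_def)
  qed
  show ?thesis
    unfolding small_universe_def small_iff by simp
qed

section \<open>Categories, functors, natural transformations\<close>

text \<open>
  Hom-sets are indexed by their source and target and need not be disjoint; hence the
  operations on arrows take the objects involved as arguments. \<open>Comp C X Y Z g f\<close> is the composite of
  \<open>f : X \<rightarrow> Y\<close> and \<open>g : Y \<rightarrow> Z\<close>.
\<close>

record ('o, 'm) cat =
  Obj :: "'o set"
  Hom :: "'o \<Rightarrow> 'o \<Rightarrow> 'm set"
  Id :: "'o \<Rightarrow> 'm"
  Comp :: "'o \<Rightarrow> 'o \<Rightarrow> 'o \<Rightarrow> 'm \<Rightarrow> 'm \<Rightarrow> 'm"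

definition category :: "('o, 'm) cat \<Rightarrow> bool" where
  "category C \<longleftrightarrow>
     (\<forall>X\<in>Obj C. Id C X \<in> Hom C X X) \<and>
     (\<forall>X\<in>Obj C. \<forall>Y\<in>Obj C. \<forall>Z\<in>Obj C. \<forall>f\<in>Hom C X Y. \<forall>g\<in>Hom C Y Z.
        Comp C X Y Z g f \<in> Hom C X Z) \<and>
     (\<forall>X\<in>Obj C. \<forall>Y\<in>Obj C. \<forall>f\<in>Hom C X Y.
        Comp C X X Y f (Id C X) = f \<and> Comp C X Y Y (Id C Y) f = f) \<and>
     (\<forall>W\<in>Obj C. \<forall>X\<in>Obj C. \<forall>Y\<in>Obj C. \<forall>Z\<in>Obj C.
        \<forall>f\<in>Hom C W X. \<forall>g\<in>Hom C X Y. \<forall>h\<in>Hom C Y Z.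
        Comp C W Y Z h (Comp C W X Y g f) = Comp C W X Z (Comp C X Y Z h g) f)"

definition locally_small :: "'u itself \<Rightarrow> ('o, 'm) cat \<Rightarrow> bool" where
  "locally_small U C \<longleftrightarrow> category C \<and> (\<forall>X\<in>Obj C. \<forall>Y\<in>Obj C. small U (Hom C X Y))"

definition small_category :: "'u itself \<Rightarrow> ('o, 'm) cat \<Rightarrow> bool" where
  "small_category U C \<longleftrightarrow> locally_small U C \<and> small U (Obj C)"

definition op_cat :: "('o, 'm) cat \<Rightarrow> ('o, 'm) cat" where
  "op_cat C = \<lparr> Obj = Obj C, Hom = (\<lambda>X Y. Hom C Y X), Id = Id C,
                Comp = (\<lambda>X Y Z g f. Comp C Z Y X f g) \<rparr>"

definition full_subcat :: "('o, 'm) cat \<Rightarrow> ('o \<Rightarrow> bool) \<Rightarrow> ('o, 'm) cat" where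
  "full_subcat C P = C\<lparr> Obj := {X \<in> Obj C. P X} \<rparr>"

definition isomorphic :: "('o, 'm) cat \<Rightarrow> 'o \<Rightarrow> 'o \<Rightarrow> bool" where
  "isomorphic C X Y \<longleftrightarrow> X \<in> Obj C \<and> Y \<in> Obj C \<and>
     (\<exists>f\<in>Hom C X Y. \<exists>g\<in>Hom C Y X. Comp C X Y X g f = Id C X \<and> Comp C Y X Y f g = Id C Y)"

record ('a, 'm, 'b, 'n) fctr =
  FO :: "'a \<Rightarrow> 'b"
  FM :: "'a \<Rightarrow> 'a \<Rightarrow> 'm \<Rightarrow> 'n"

text \<open>
  Functors and natural transformations are required to be \<open>undefined\<close> off their domain, so that
  HOL equality is equality of functors and of natural transformations.
\<close>

definition restrict_fctr ::
  "('a, 'm) cat \<Rightarrow> ('a, 'm, 'b, 'n) fctr \<Rightarrow> ('a, 'm, 'b, 'n) fctr" where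
  "restrict_fctr C F =
     \<lparr> FO = (\<lambda>X\<in>Obj C. FO F X),
       FM = (\<lambda>X Y f. if X \<in> Obj C \<and> Y \<in> Obj C \<and> f \<in> Hom C X Y then FM F X Y f else undefined) \<rparr>"

definition is_functor ::
  "('a, 'm) cat \<Rightarrow> ('b, 'n) cat \<Rightarrow> ('a, 'm, 'b, 'n) fctr \<Rightarrow> bool" where
  "is_functor C D F \<longleftrightarrow> category C \<and> category D \<and> restrict_fctr C F = F \<and>
     (\<forall>X\<in>Obj C. FO F X \<in> Obj D) \<and>
     (\<forall>X\<in>Obj C. \<forall>Y\<in>Obj C. \<forall>f\<in>Hom C X Y. FM F X Y f \<in> Hom D (FO F X) (FO F Y)) \<and>
     (\<forall>X\<in>Obj C. FM F X X (Id C X) = Id D (FO F X)) \<and>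
     (\<forall>X\<in>Obj C. \<forall>Y\<in>Obj C. \<forall>Z\<in>Obj C. \<forall>f\<in>Hom C X Y. \<forall>g\<in>Hom C Y Z.
        FM F X Z (Comp C X Y Z g f) =
        Comp D (FO F X) (FO F Y) (FO F Z) (FM F Y Z g) (FM F X Y f))"

definition id_fctr :: "('a, 'm) cat \<Rightarrow> ('a, 'm, 'a, 'm) fctr" where
  "id_fctr C = restrict_fctr C \<lparr> FO = (\<lambda>X. X), FM = (\<lambda>X Y f. f) \<rparr>"

text \<open>\<open>comp_fctr C G F\<close> is the composite of \<open>F\<close>, with source category \<open>C\<close>, followed by \<open>G\<close>.\<close>

definition comp_fctr ::
  "('a, 'm) cat \<Rightarrow> ('b, 'n, 'c, 'p) fctr \<Rightarrow> ('a, 'm, 'b, 'n) fctr \<Rightarrow> ('a, 'm, 'c, 'p) fctr" where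
  "comp_fctr C G F = restrict_fctr C
     \<lparr> FO = (\<lambda>X. FO G (FO F X)), FM = (\<lambda>X Y f. FM G (FO F X) (FO F Y) (FM F X Y f)) \<rparr>"

definition op_fctr :: "('a, 'm, 'b, 'n) fctr \<Rightarrow> ('a, 'm, 'b, 'n) fctr" where
  "op_fctr F = \<lparr> FO = FO F, FM = (\<lambda>X Y. FM F Y X) \<rparr>"

definition is_nat_trans ::
  "('a, 'm) cat \<Rightarrow> ('b, 'n) cat \<Rightarrow> ('a, 'm, 'b, 'n) fctr \<Rightarrow> ('a, 'm, 'b, 'n) fctr \<Rightarrow>
   ('a \<Rightarrow> 'n) \<Rightarrow> bool" where
  "is_nat_trans C D F G \<eta> \<longleftrightarrow>
     \<eta> \<in> (\<Pi>\<^sub>E X\<in>Obj C. Hom D (FO F X) (FO G X)) \<and>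
     (\<forall>X\<in>Obj C. \<forall>Y\<in>Obj C. \<forall>f\<in>Hom C X Y.
        Comp D (FO F X) (FO F Y) (FO G Y) (\<eta> Y) (FM F X Y f) =
        Comp D (FO F X) (FO G X) (FO G Y) (FM G X Y f) (\<eta> X))"

definition fctr_cat ::
  "('a, 'm) cat \<Rightarrow> ('b, 'n) cat \<Rightarrow> (('a, 'm, 'b, 'n) fctr, 'a \<Rightarrow> 'n) cat" where
  "fctr_cat C D =
     \<lparr> Obj = {F. is_functor C D F},
       Hom = (\<lambda>F G. {\<eta>. is_nat_trans C D F G \<eta>}),
       Id = (\<lambda>F. \<lambda>X\<in>Obj C. Id D (FO F X)),
       Comp = (\<lambda>F G H \<beta> \<alpha>. \<lambda>X\<in>Obj C. Comp D (FO F X) (FO G X) (FO H X) (\<beta> X) (\<alpha> X)) \<rparr>"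

definition is_equivalence ::
  "('a, 'm) cat \<Rightarrow> ('b, 'n) cat \<Rightarrow> ('a, 'm, 'b, 'n) fctr \<Rightarrow> bool" where
  "is_equivalence A B F \<longleftrightarrow> is_functor A B F \<and>
     (\<exists>G. is_functor B A G \<and>
        isomorphic (fctr_cat A A) (comp_fctr A G F) (id_fctr A) \<and>
        isomorphic (fctr_cat B B) (comp_fctr B F G) (id_fctr B))"

definition Set_cat :: "('u set, 'u \<Rightarrow> 'u) cat" where
  "Set_cat =
     \<lparr> Obj = {X. small TYPE('u) X},
       Hom = (\<lambda>X Y. X \<rightarrow>\<^sub>E Y),
       Id = (\<lambda>X. \<lambda>x\<in>X. x),
       Comp = (\<lambda>X Y Z g f. compose X g f) \<rparr>"

section \<open>Limits and colimits\<close>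

text \<open>
  The same record serves for cones, where \<open>leg c i : apex c \<rightarrow> D i\<close>, and for cocones, where
  \<open>leg c i : D i \<rightarrow> apex c\<close>, with \<open>D\<close> the diagram.
\<close>

record ('i, 'o, 'm) cone =
  index :: "('i, 'i) cat"
  diagram :: "('i, 'i, 'o, 'm) fctr"
  apex :: 'o
  leg :: "'i \<Rightarrow> 'm"

definition is_cone :: "('o, 'm) cat \<Rightarrow> ('i, 'o, 'm) cone \<Rightarrow> bool" where
  "is_cone C c \<longleftrightarrow> (let I = index c; D = diagram c; L = apex c; \<pi> = leg c in
     is_functor I C D \<and> L \<in> Obj C \<and>
     (\<forall>i\<in>Obj I. \<pi> i \<in> Hom C L (FO D i)) \<and>
     (\<forall>i\<in>Obj I. \<forall>j\<in>Obj I. \<forall>f\<in>Hom I i j.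
        Comp C L (FO D i) (FO D j) (FM D i j f) (\<pi> i) = \<pi> j))"

definition is_cocone :: "('o, 'm) cat \<Rightarrow> ('i, 'o, 'm) cone \<Rightarrow> bool" where
  "is_cocone C c \<longleftrightarrow> (let I = index c; D = diagram c; L = apex c; \<iota> = leg c in
     is_functor I C D \<and> L \<in> Obj C \<and>
     (\<forall>i\<in>Obj I. \<iota> i \<in> Hom C (FO D i) L) \<and>
     (\<forall>i\<in>Obj I. \<forall>j\<in>Obj I. \<forall>f\<in>Hom I i j.
        Comp C (FO D i) (FO D j) L (\<iota> j) (FM D i j f) = \<iota> i))"

definition is_limit :: "('o, 'm) cat \<Rightarrow> ('i, 'o, 'm) cone \<Rightarrow> bool" where
  "is_limit C c \<longleftrightarrow> is_cone C c \<and>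
     (\<forall>X \<mu>. is_cone C (c\<lparr> apex := X, leg := \<mu> \<rparr>) \<longrightarrow>
        (\<exists>!u. u \<in> Hom C X (apex c) \<and>
          (\<forall>i\<in>Obj (index c). Comp C X (apex c) (FO (diagram c) i) (leg c i) u = \<mu> i)))"

definition is_colimit :: "('o, 'm) cat \<Rightarrow> ('i, 'o, 'm) cone \<Rightarrow> bool" where
  "is_colimit C c \<longleftrightarrow> is_cocone C c \<and>
     (\<forall>X \<mu>. is_cocone C (c\<lparr> apex := X, leg := \<mu> \<rparr>) \<longrightarrow>
        (\<exists>!u. u \<in> Hom C (apex c) X \<and>
          (\<forall>i\<in>Obj (index c). Comp C (FO (diagram c) i) (apex c) X u (leg c i) = \<mu> i)))"

definition map_cone ::
  "('a, 'm, 'b, 'n) fctr \<Rightarrow> ('i, 'a, 'm) cone \<Rightarrow> ('i, 'b, 'n) cone" where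
  "map_cone F c =
     \<lparr> index = index c, diagram = comp_fctr (index c) F (diagram c), apex = FO F (apex c),
       leg = (\<lambda>i. FM F (apex c) (FO (diagram c) i) (leg c i)) \<rparr>"

definition map_cocone ::
  "('a, 'm, 'b, 'n) fctr \<Rightarrow> ('i, 'a, 'm) cone \<Rightarrow> ('i, 'b, 'n) cone" where
  "map_cocone F c =
     \<lparr> index = index c, diagram = comp_fctr (index c) F (diagram c), apex = FO F (apex c),
       leg = (\<lambda>i. FM F (FO (diagram c) i) (apex c) (leg c i)) \<rparr>"

definition op_cone :: "('i, 'o, 'm) cone \<Rightarrow> ('i, 'o, 'm) cone" where
  "op_cone c = c\<lparr> index := op_cat (index c), diagram := op_fctr (diagram c) \<rparr>"

definition cocomplete :: "'u itself \<Rightarrow> ('o, 'm) cat \<Rightarrow> bool" where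
  "cocomplete U C \<longleftrightarrow>
     (\<forall>(I :: ('u, 'u) cat) D. small_category U I \<and> is_functor I C D \<longrightarrow>
        (\<exists>c. is_colimit C c \<and> index c = I \<and> diagram c = D))"

definition cocontinuous ::
  "'u itself \<Rightarrow> ('a, 'm) cat \<Rightarrow> ('b, 'n) cat \<Rightarrow> ('a, 'm, 'b, 'n) fctr \<Rightarrow> bool" where
  "cocontinuous U C D F \<longleftrightarrow> is_functor C D F \<and>
     (\<forall>c :: ('u, 'a, 'm) cone. small_category U (index c) \<and> is_colimit C c \<longrightarrow>
        is_colimit D (map_cocone F c))"

definition Hom_c ::
  "'u itself \<Rightarrow> ('a, 'm) cat \<Rightarrow> ('b, 'n) cat \<Rightarrow> (('a, 'm, 'b, 'n) fctr, 'a \<Rightarrow> 'n) cat" where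
  "Hom_c U A C = full_subcat (fctr_cat A C) (cocontinuous U A C)"

section \<open>Sketches and their models\<close>

text \<open>
  The hom-sets of the underlying category of a limit sketch are small subsets of the universe \<open>'u\<close>,
  and hence objects of \<open>Set_cat\<close>.
\<close>

definition limit_sketch :: "('e, 'u) cat \<Rightarrow> ('u, 'e, 'u) cone set \<Rightarrow> bool" where
  "limit_sketch E S \<longleftrightarrow> locally_small TYPE('u) E \<and>
     (\<forall>c\<in>S. small_category TYPE('u) (index c) \<and> is_cone E c)"

definition limit_models ::
  "('a, 'm) cat \<Rightarrow> ('i, 'a, 'm) cone set \<Rightarrow> ('b, 'n) cat \<Rightarrow>
   (('a, 'm, 'b, 'n) fctr, 'a \<Rightarrow> 'n) cat" where
  "limit_models E S C = full_subcat (fctr_cat E C) (\<lambda>F. \<forall>c\<in>S. is_limit C (map_cone F c))"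

definition colimit_models ::
  "('a, 'm) cat \<Rightarrow> ('i, 'a, 'm) cone set \<Rightarrow> ('b, 'n) cat \<Rightarrow>
   (('a, 'm, 'b, 'n) fctr, 'a \<Rightarrow> 'n) cat" where
  "colimit_models E T C = full_subcat (fctr_cat E C) (\<lambda>F. \<forall>c\<in>T. is_colimit C (map_cocone F c))"

definition Mod ::
  "('e, 'u) cat \<Rightarrow> ('u, 'e, 'u) cone set \<Rightarrow>
   (('e, 'u, 'u set, 'u \<Rightarrow> 'u) fctr, 'e \<Rightarrow> 'u \<Rightarrow> 'u) cat" where
  "Mod E S = limit_models E S Set_cat"

definition hom_fctr :: "('e, 'u) cat \<Rightarrow> 'e \<Rightarrow> ('e, 'u, 'u set, 'u \<Rightarrow> 'u) fctr" where
  "hom_fctr E A = restrict_fctr E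
     \<lparr> FO = Hom E A, FM = (\<lambda>X Y h. \<lambda>g\<in>Hom E A X. Comp E A X Y h g) \<rparr>"

definition realized :: "('e, 'u) cat \<Rightarrow> ('u, 'e, 'u) cone set \<Rightarrow> bool" where
  "realized E S \<longleftrightarrow> (\<forall>A\<in>Obj E. hom_fctr E A \<in> Obj (Mod E S))"

text \<open>An arrow \<open>A \<rightarrow> B\<close> of \<open>op_cat E\<close> is an arrow \<open>f : B \<rightarrow> A\<close> of \<open>E\<close>; it acts by \<open>g \<mapsto> g \<circ> f\<close>.\<close>

definition yoneda ::
  "('e, 'u) cat \<Rightarrow> ('e, 'u, ('e, 'u, 'u set, 'u \<Rightarrow> 'u) fctr, 'e \<Rightarrow> 'u \<Rightarrow> 'u) fctr" where
  "yoneda E = restrict_fctr (op_cat E)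
     \<lparr> FO = hom_fctr E,
       FM = (\<lambda>A B f. \<lambda>X\<in>Obj E. \<lambda>g\<in>Hom E A X. Comp E B A X g f) \<rparr>"

definition small_model ::
  "('e, 'u) cat \<Rightarrow> ('u, 'e, 'u) cone set \<Rightarrow> ('e, 'u, 'u set, 'u \<Rightarrow> 'u) fctr \<Rightarrow> bool" where
  "small_model E S M \<longleftrightarrow>
     (\<exists>c :: ('u, ('e, 'u, 'u set, 'u \<Rightarrow> 'u) fctr, 'e \<Rightarrow> 'u \<Rightarrow> 'u) cone.
        small_category TYPE('u) (index c) \<and> is_colimit (Mod E S) c \<and> apex c = M \<and>
        (\<forall>i\<in>Obj (index c). \<exists>A\<in>Obj E. FO (diagram c) i = hom_fctr E A))"

section \<open>Composition functors and universal examples\<close>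

text \<open>
  \<open>K\<close> is a category of functors: \<open>precomp K B Y\<close> is \<open>F \<mapsto> F \<circ> Y\<close> on \<open>K\<close>, where \<open>Y\<close> has source \<open>B\<close>, and
  \<open>postcomp K B H\<close> is \<open>F \<mapsto> H \<circ> F\<close> on \<open>K\<close>, where the members of \<open>K\<close> have source \<open>B\<close>.
\<close>

definition precomp ::
  "(('b, 'n, 'c, 'p) fctr, 'b \<Rightarrow> 'p) cat \<Rightarrow> ('a, 'm) cat \<Rightarrow> ('a, 'm, 'b, 'n) fctr \<Rightarrow>
   (('b, 'n, 'c, 'p) fctr, 'b \<Rightarrow> 'p, ('a, 'm, 'c, 'p) fctr, 'a \<Rightarrow> 'p) fctr" where
  "precomp K B Y = restrict_fctr K
     \<lparr> FO = (\<lambda>F. comp_fctr B F Y), FM = (\<lambda>F G \<eta>. \<lambda>X\<in>Obj B. \<eta> (FO Y X)) \<rparr>"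

definition postcomp ::
  "(('b, 'n, 'c, 'p) fctr, 'b \<Rightarrow> 'p) cat \<Rightarrow> ('b, 'n) cat \<Rightarrow> ('c, 'p, 'd, 'q) fctr \<Rightarrow>
   (('b, 'n, 'c, 'p) fctr, 'b \<Rightarrow> 'p, ('b, 'n, 'd, 'q) fctr, 'b \<Rightarrow> 'q) fctr" where
  "postcomp K B H = restrict_fctr K
     \<lparr> FO = (\<lambda>F. comp_fctr B H F),
       FM = (\<lambda>F G \<eta>. \<lambda>X\<in>Obj B. FM H (FO F X) (FO G X) (\<eta> X)) \<rparr>"

text \<open>
  \<open>Y\<close> makes \<open>D\<close> the universal example of a cocomplete category with a model of the colimit sketch
  \<open>(E, T)\<close>. HOL cannot quantify over types inside a formula, so the types of the objects and arrows
  of the test category \<open>C\<close> are arguments.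
\<close>

definition universal_example ::
  "'u itself \<Rightarrow> 'c itself \<Rightarrow> 'p itself \<Rightarrow> ('a, 'm) cat \<Rightarrow> ('i, 'a, 'm) cone set \<Rightarrow>
   ('b, 'n) cat \<Rightarrow> ('a, 'm, 'b, 'n) fctr \<Rightarrow> bool" where
  "universal_example U _ _ E T D Y \<longleftrightarrow>
     locally_small U D \<and> cocomplete U D \<and> Y \<in> Obj (colimit_models E T D) \<and>
     (\<forall>C :: ('c, 'p) cat. locally_small U C \<and> cocomplete U C \<longrightarrow>
        is_equivalence (Hom_c U D C) (colimit_models E T C) (precomp (Hom_c U D C) E Y))"

end

theory Submission
  imports Defs
begin

text \<open>
  Write \<open>Y\<close> for the Yoneda embedding of \<open>op_cat E\<close> into the category of models. It is a colimit model:
  by the Yoneda lemma, a cocone from \<open>Y\<close> of a diagram to a model \<open>M\<close> is an element of the limit of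
  the values of \<open>M\<close> on that diagram (\<open>yoneda_model\<close>). Hence restriction along \<open>Y\<close> sends
  cocontinuous functors to colimit models.

  A model \<open>M\<close> is a small colimit of representables, so a cocontinuous functor \<open>F\<close> is determined on \<open>M\<close>
  by its restriction \<open>G\<close> along \<open>Y\<close>. The difficulty is naturality in \<open>M\<close>: the colimit
  presenting \<open>M\<close> is taken inside the category of models, need not be pointwise, and so an arrow
  \<open>Y A \<rightarrow> M\<close> need not factor through a leg of it. The remedy is a description of
  \<open>F M\<close> that treats all arrows from representables to \<open>M\<close> alike. Whenever \<open>G\<close> is a colimit model with
  values in \<open>C\<close>, and \<open>T\<close> is an object of \<open>C\<close>, the functor \<open>A \<mapsto> Hom (G A, T)\<close> is a model
  (\<open>hom_into_model\<close>). An arrow from \<open>M\<close> into this model is a natural family of maps from \<open>M A\<close> to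
  \<open>Hom (G A, T)\<close>, called a weighted cocone with vertex \<open>T\<close> below. Therefore weighted cocones with
  a fixed vertex turn colimits of models into limits (\<open>glue_wcocones\<close>, \<open>wcocone_eqI\<close>). For
  \<open>M\<close> a colimit of representables at objects \<open>A i\<close>, this means that weighted cocones on \<open>M\<close> are
  cocones on the small diagram of the objects \<open>G (A i)\<close>, and a colimit of this diagram carries a
  universal weighted cocone (\<open>is_wcolimI\<close>).

  Everything follows from this. If \<open>F\<close> is cocontinuous with restriction \<open>G\<close>, then \<open>F M\<close> carries a
  universal weighted cocone on \<open>M\<close>, whose legs are the images under \<open>F\<close> of all arrows \<open>Y A \<rightarrow> M\<close>
  (\<open>cocontinuous_is_wcolim\<close>); this gives unique extensions of natural transformations between
  restrictions (\<open>nat_trans_extends_uniquely\<close>). If \<open>G\<close> is any colimit model with values in a cocomplete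
  category, universal weighted cocones exist for each \<open>M\<close> (\<open>wcolim_exists\<close>), and their vertices form
  a functor that is left adjoint to \<open>T \<mapsto> Hom (G -, T)\<close>, is therefore cocontinuous, and restricts to
  \<open>G\<close> up to isomorphism (\<open>model_extends_to_cocontinuous_functor\<close>). So restriction is fully faithful and
  essentially surjective. For the universal example it remains to see that the category of models is
  locally small, which holds because an arrow out of \<open>M\<close> is determined by its values at the generators
  of a presentation of \<open>M\<close> (\<open>locally_small_Mod\<close>).
\<close>

section \<open>Categories and functors\<close>

lemma id_in_Hom: "category C \<Longrightarrow> X \<in> Obj C \<Longrightarrow> Id C X \<in> Hom C X X"
  by (simp add: category_def)

lemma comp_in_Hom:
  "\<lbrakk>category C; X \<in> Obj C; Y \<in> Obj C; Z \<in> Obj C; f \<in> Hom C X Y; g \<in> Hom C Y Z\<rbrakk>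
    \<Longrightarrow> Comp C X Y Z g f \<in> Hom C X Z"
  by (simp add: category_def)

lemma comp_id_right:
  "\<lbrakk>category C; X \<in> Obj C; Y \<in> Obj C; f \<in> Hom C X Y\<rbrakk> \<Longrightarrow> Comp C X X Y f (Id C X) = f"
  by (simp add: category_def)

lemma comp_id_left:
  "\<lbrakk>category C; X \<in> Obj C; Y \<in> Obj C; f \<in> Hom C X Y\<rbrakk> \<Longrightarrow> Comp C X Y Y (Id C Y) f = f"
  by (simp add: category_def)

lemma comp_assoc:
  "\<lbrakk>category C; W \<in> Obj C; X \<in> Obj C; Y \<in> Obj C; Z \<in> Obj C;
    f \<in> Hom C W X; g \<in> Hom C X Y; h \<in> Hom C Y Z\<rbrakk>
    \<Longrightarrow> Comp C W Y Z h (Comp C W X Y g f) = Comp C W X Z (Comp C X Y Z h g) f"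
  by (simp add: category_def)

lemma op_cat_simps [simp]:
  "Obj (op_cat C) = Obj C" "Hom (op_cat C) X Y = Hom C Y X" "Id (op_cat C) = Id C"
  "Comp (op_cat C) X Y Z g f = Comp C Z Y X f g"
  by (simp_all add: op_cat_def)

lemma category_op_cat: "category C \<Longrightarrow> category (op_cat C)"
  unfolding category_def by auto

lemma full_subcat_simps [simp]:
  "Obj (full_subcat C P) = {X \<in> Obj C. P X}" "Hom (full_subcat C P) = Hom C"
  "Id (full_subcat C P) = Id C" "Comp (full_subcat C P) = Comp C"
  by (simp_all add: full_subcat_def)

lemma category_full_subcat: "category C \<Longrightarrow> category (full_subcat C P)"
  unfolding category_def by simp

lemma isomorphic_full_subcat:
  "isomorphic (full_subcat C P) X Y \<longleftrightarrow> isomorphic C X Y \<and> P X \<and> P Y"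
  by (auto simp: isomorphic_def)

lemma restrict_fctr_simps [simp]:
  "X \<in> Obj C \<Longrightarrow> FO (restrict_fctr C F) X = FO F X"
  "\<lbrakk>X \<in> Obj C; Y \<in> Obj C; f \<in> Hom C X Y\<rbrakk> \<Longrightarrow> FM (restrict_fctr C F) X Y f = FM F X Y f"
  by (simp_all add: restrict_fctr_def)

lemma restrict_fctr_cong:
  assumes "\<And>X. X \<in> Obj C \<Longrightarrow> FO F X = FO G X"
    and "\<And>X Y f. \<lbrakk>X \<in> Obj C; Y \<in> Obj C; f \<in> Hom C X Y\<rbrakk> \<Longrightarrow> FM F X Y f = FM G X Y f"
  shows "restrict_fctr C F = restrict_fctr C G"
  using assms by (auto simp: restrict_fctr_def fun_eq_iff)

lemma restrict_fctr_idem [simp]: "restrict_fctr C (restrict_fctr C F) = restrict_fctr C F"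
  by (rule restrict_fctr_cong) simp_all

lemma is_functorD:
  assumes "is_functor C D F"
  shows functor_dom: "category C" and functor_cod: "category D"
    and functor_restrict: "restrict_fctr C F = F"
    and functor_obj: "X \<in> Obj C \<Longrightarrow> FO F X \<in> Obj D"
    and functor_hom: "\<lbrakk>X \<in> Obj C; Y \<in> Obj C; f \<in> Hom C X Y\<rbrakk>
      \<Longrightarrow> FM F X Y f \<in> Hom D (FO F X) (FO F Y)"
    and functor_id: "X \<in> Obj C \<Longrightarrow> FM F X X (Id C X) = Id D (FO F X)"
    and functor_comp: "\<lbrakk>X \<in> Obj C; Y \<in> Obj C; Z \<in> Obj C; f \<in> Hom C X Y; g \<in> Hom C Y Z\<rbrakk>
      \<Longrightarrow> FM F X Z (Comp C X Y Z g f) =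
          Comp D (FO F X) (FO F Y) (FO F Z) (FM F Y Z g) (FM F X Y f)"
  using assms by (simp_all add: is_functor_def)

lemma functor_eqI:
  assumes "restrict_fctr C F = F" "restrict_fctr C G = G"
    and "\<And>X. X \<in> Obj C \<Longrightarrow> FO F X = FO G X"
    and "\<And>X Y f. \<lbrakk>X \<in> Obj C; Y \<in> Obj C; f \<in> Hom C X Y\<rbrakk> \<Longrightarrow> FM F X Y f = FM G X Y f"
  shows "F = G"
  using restrict_fctr_cong[of C F G] assms by simp

lemma is_functor_restrictI:
  assumes "category C" "category D"
    and "\<And>X. X \<in> Obj C \<Longrightarrow> FO F X \<in> Obj D"
    and "\<And>X Y f. \<lbrakk>X \<in> Obj C; Y \<in> Obj C; f \<in> Hom C X Y\<rbrakk>
      \<Longrightarrow> FM F X Y f \<in> Hom D (FO F X) (FO F Y)"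
    and "\<And>X. X \<in> Obj C \<Longrightarrow> FM F X X (Id C X) = Id D (FO F X)"
    and "\<And>X Y Z f g. \<lbrakk>X \<in> Obj C; Y \<in> Obj C; Z \<in> Obj C; f \<in> Hom C X Y; g \<in> Hom C Y Z\<rbrakk>
      \<Longrightarrow> FM F X Z (Comp C X Y Z g f) =
          Comp D (FO F X) (FO F Y) (FO F Z) (FM F Y Z g) (FM F X Y f)"
  shows "is_functor C D (restrict_fctr C F)"
  using assms by (simp add: is_functor_def id_in_Hom comp_in_Hom)

lemma comp_fctr_simps [simp]:
  "X \<in> Obj C \<Longrightarrow> FO (comp_fctr C G F) X = FO G (FO F X)"
  "\<lbrakk>X \<in> Obj C; Y \<in> Obj C; f \<in> Hom C X Y\<rbrakk>
    \<Longrightarrow> FM (comp_fctr C G F) X Y f = FM G (FO F X) (FO F Y) (FM F X Y f)"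
  by (simp_all add: comp_fctr_def)

lemma restrict_comp_fctr [simp]: "restrict_fctr C (comp_fctr C G F) = comp_fctr C G F"
  by (simp add: comp_fctr_def)

lemma is_functor_comp_fctr:
  assumes "is_functor B C F" "is_functor C D G"
  shows "is_functor B D (comp_fctr B G F)"
  unfolding comp_fctr_def
  by (rule is_functor_restrictI)
    (simp_all add: is_functorD[OF assms(1)] is_functorD[OF assms(2)])

lemma comp_fctr_assoc:
  assumes "is_functor A B F"
  shows "comp_fctr A (comp_fctr B H G) F = comp_fctr A H (comp_fctr A G F)"
  by (rule functor_eqI[of A]) (simp_all add: is_functorD[OF assms])

lemma id_fctr_simps [simp]:
  "X \<in> Obj C \<Longrightarrow> FO (id_fctr C) X = X"
  "\<lbrakk>X \<in> Obj C; Y \<in> Obj C; f \<in> Hom C X Y\<rbrakk> \<Longrightarrow> FM (id_fctr C) X Y f = f"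
  by (simp_all add: id_fctr_def)

lemma is_functor_id_fctr: "category C \<Longrightarrow> is_functor C C (id_fctr C)"
  unfolding id_fctr_def by (rule is_functor_restrictI) simp_all

lemma op_fctr_simps [simp]: "FO (op_fctr F) = FO F" "FM (op_fctr F) X Y = FM F Y X"
  by (simp_all add: op_fctr_def)

lemma is_functor_op_fctr:
  assumes "is_functor C D F"
  shows "is_functor (op_cat C) (op_cat D) (op_fctr F)"
proof -
  have "restrict_fctr (op_cat C) (op_fctr F) = op_fctr (restrict_fctr C F)"
    by (auto simp: restrict_fctr_def op_fctr_def fun_eq_iff)
  then show ?thesis
    using assms by (simp add: is_functor_def category_op_cat)
qed

section \<open>Natural transformations\<close>

lemma fctr_cat_simps [simp]:
  "Obj (fctr_cat C D) = {F. is_functor C D F}"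
  "Hom (fctr_cat C D) F G = {\<eta>. is_nat_trans C D F G \<eta>}"
  "Id (fctr_cat C D) F = (\<lambda>X\<in>Obj C. Id D (FO F X))"
  "Comp (fctr_cat C D) F G H \<beta> \<alpha> =
     (\<lambda>X\<in>Obj C. Comp D (FO F X) (FO G X) (FO H X) (\<beta> X) (\<alpha> X))"
  by (simp_all add: fctr_cat_def)

lemma nat_trans_in_Hom:
  "is_nat_trans C D F G \<eta> \<Longrightarrow> X \<in> Obj C \<Longrightarrow> \<eta> X \<in> Hom D (FO F X) (FO G X)"
  by (auto simp: is_nat_trans_def)

lemma nat_trans_natural:
  "\<lbrakk>is_nat_trans C D F G \<eta>; X \<in> Obj C; Y \<in> Obj C; f \<in> Hom C X Y\<rbrakk> \<Longrightarrow>
    Comp D (FO F X) (FO F Y) (FO G Y) (\<eta> Y) (FM F X Y f) =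
    Comp D (FO F X) (FO G X) (FO G Y) (FM G X Y f) (\<eta> X)"
  by (simp add: is_nat_trans_def)

lemma is_nat_trans_restrictI:
  assumes "\<And>X. X \<in> Obj C \<Longrightarrow> \<eta> X \<in> Hom D (FO F X) (FO G X)"
    and "\<And>X Y f. \<lbrakk>X \<in> Obj C; Y \<in> Obj C; f \<in> Hom C X Y\<rbrakk> \<Longrightarrow>
      Comp D (FO F X) (FO F Y) (FO G Y) (\<eta> Y) (FM F X Y f) =
      Comp D (FO F X) (FO G X) (FO G Y) (FM G X Y f) (\<eta> X)"
  shows "is_nat_trans C D F G (\<lambda>X\<in>Obj C. \<eta> X)"
  using assms by (auto simp: is_nat_trans_def)

lemma nat_trans_eqI:
  assumes "is_nat_trans C D F G \<eta>" "is_nat_trans C D F' G' \<theta>"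
    and "\<And>X. X \<in> Obj C \<Longrightarrow> \<eta> X = \<theta> X"
  shows "\<eta> = \<theta>"
proof (rule extensionalityI[of _ "Obj C"])
  show "\<eta> \<in> extensional (Obj C)" "\<theta> \<in> extensional (Obj C)"
    using assms(1,2) by (simp_all add: is_nat_trans_def PiE_def)
qed (rule assms(3))

lemma is_nat_trans_comp:
  assumes F: "is_functor C D F" and G: "is_functor C D G" and H: "is_functor C D H"
    and \<alpha>: "is_nat_trans C D F G \<alpha>" and \<beta>: "is_nat_trans C D G H \<beta>"
  shows "is_nat_trans C D F H (\<lambda>X\<in>Obj C. Comp D (FO F X) (FO G X) (FO H X) (\<beta> X) (\<alpha> X))"
proof (rule is_nat_trans_restrictI)
  note D = functor_cod[OF F] and obj = functor_obj[OF F] functor_obj[OF G] functor_obj[OF H]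
    and hom = functor_hom[OF F] functor_hom[OF G] functor_hom[OF H]
      nat_trans_in_Hom[OF \<alpha>] nat_trans_in_Hom[OF \<beta>]
  show "Comp D (FO F X) (FO G X) (FO H X) (\<beta> X) (\<alpha> X) \<in> Hom D (FO F X) (FO H X)"
    if "X \<in> Obj C" for X
    using that by (simp add: comp_in_Hom D obj hom)
  show "Comp D (FO F X) (FO F Y) (FO H Y)
      (Comp D (FO F Y) (FO G Y) (FO H Y) (\<beta> Y) (\<alpha> Y)) (FM F X Y f) =
    Comp D (FO F X) (FO H X) (FO H Y) (FM H X Y f)
      (Comp D (FO F X) (FO G X) (FO H X) (\<beta> X) (\<alpha> X))" (is "?l = ?r")
    if that: "X \<in> Obj C" "Y \<in> Obj C" "f \<in> Hom C X Y" for X Y f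
  proof -
    have "?l = Comp D (FO F X) (FO G Y) (FO H Y) (\<beta> Y)
        (Comp D (FO F X) (FO F Y) (FO G Y) (\<alpha> Y) (FM F X Y f))"
      using that by (simp add: comp_assoc D obj hom)
    also have "\<dots> = Comp D (FO F X) (FO G X) (FO H Y)
        (Comp D (FO G X) (FO G Y) (FO H Y) (\<beta> Y) (FM G X Y f)) (\<alpha> X)"
      using that by (simp add: nat_trans_natural[OF \<alpha>] comp_assoc D obj hom)
    also have "\<dots> = ?r"
      using that by (simp add: nat_trans_natural[OF \<beta>] comp_assoc D obj hom)
    finally show ?thesis .
  qed
qed

lemma is_nat_trans_id:
  assumes "is_functor C D F"
  shows "is_nat_trans C D F F (\<lambda>X\<in>Obj C. Id D (FO F X))"
  using is_functorD[OF assms]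
  by (intro is_nat_trans_restrictI) (simp_all add: id_in_Hom comp_id_left comp_id_right)

lemma category_fctr_cat: "category (fctr_cat C D)"
proof -
  have Pi: "\<eta> = (\<lambda>X\<in>Obj C. \<eta> X)" if "is_nat_trans C D F G \<eta>" for F G \<eta>
    using that by (auto simp: is_nat_trans_def PiE_def extensional_restrict)
  show ?thesis
    unfolding category_def
  proof (intro conjI ballI)
    fix F G \<eta> assume "F \<in> Obj (fctr_cat C D)" "G \<in> Obj (fctr_cat C D)" "\<eta> \<in> Hom (fctr_cat C D) F G"
    then have F: "is_functor C D F" and G: "is_functor C D G" and \<eta>: "is_nat_trans C D F G \<eta>"
      by simp_all
    show "Comp (fctr_cat C D) F F G \<eta> (Id (fctr_cat C D) F) = \<eta>"
      by (subst (2) Pi[OF \<eta>])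
        (auto intro!: restrict_ext comp_id_right
          simp: functor_cod[OF F] functor_obj[OF F] functor_obj[OF G] nat_trans_in_Hom[OF \<eta>])
    show "Comp (fctr_cat C D) F G G (Id (fctr_cat C D) G) \<eta> = \<eta>"
      by (subst (2) Pi[OF \<eta>])
        (auto intro!: restrict_ext comp_id_left
          simp: functor_cod[OF F] functor_obj[OF F] functor_obj[OF G] nat_trans_in_Hom[OF \<eta>])
  qed (auto intro!: restrict_ext is_nat_trans_id is_nat_trans_comp comp_assoc
      intro: functor_obj functor_cod nat_trans_in_Hom)
qed

text \<open>The inverses of the components form a natural transformation: compose each naturality square
  with them on both sides.\<close>

lemma isomorphic_fctrI:
  assumes F: "is_functor C D F" and G: "is_functor C D G" and \<eta>: "is_nat_trans C D F G \<eta>"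
    and inv: "\<And>X. X \<in> Obj C \<Longrightarrow> \<theta> X \<in> Hom D (FO G X) (FO F X)"
      "\<And>X. X \<in> Obj C \<Longrightarrow> Comp D (FO F X) (FO G X) (FO F X) (\<theta> X) (\<eta> X) = Id D (FO F X)"
      "\<And>X. X \<in> Obj C \<Longrightarrow> Comp D (FO G X) (FO F X) (FO G X) (\<eta> X) (\<theta> X) = Id D (FO G X)"
  shows "isomorphic (fctr_cat C D) F G"
proof -
  note D = functor_cod[OF F] and obj = functor_obj[OF F] functor_obj[OF G]
    and hom = functor_hom[OF F] functor_hom[OF G] nat_trans_in_Hom[OF \<eta>] inv(1)
  have "is_nat_trans C D G F (\<lambda>X\<in>Obj C. \<theta> X)"
  proof (rule is_nat_trans_restrictI)
    fix X Y f assume that: "X \<in> Obj C" "Y \<in> Obj C" "f \<in> Hom C X Y"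
    let ?F = "FM F X Y f" and ?G = "FM G X Y f"
    have "Comp D (FO G X) (FO G Y) (FO F Y) (\<theta> Y) ?G =
        Comp D (FO G X) (FO G Y) (FO F Y) (\<theta> Y)
          (Comp D (FO G X) (FO G X) (FO G Y) ?G (Comp D (FO G X) (FO F X) (FO G X) (\<eta> X) (\<theta> X)))"
      using that by (simp add: inv comp_id_right D obj hom)
    also have "\<dots> = Comp D (FO G X) (FO G Y) (FO F Y) (\<theta> Y)
        (Comp D (FO G X) (FO F X) (FO G Y) (Comp D (FO F X) (FO F Y) (FO G Y) (\<eta> Y) ?F) (\<theta> X))"
      using that by (simp add: nat_trans_natural[OF \<eta>] comp_assoc D obj hom)
    also have "\<dots> = Comp D (FO G X) (FO F X) (FO F Y)
        (Comp D (FO F X) (FO F Y) (FO F Y) (Comp D (FO F Y) (FO G Y) (FO F Y) (\<theta> Y) (\<eta> Y)) ?F) (\<theta> X)"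
      using that by (simp add: comp_assoc comp_in_Hom D obj hom)
    also have "\<dots> = Comp D (FO G X) (FO F X) (FO F Y) ?F (\<theta> X)"
      using that by (simp add: inv comp_id_left D obj hom)
    finally show "Comp D (FO G X) (FO G Y) (FO F Y) (\<theta> Y) ?G =
      Comp D (FO G X) (FO F X) (FO F Y) ?F (\<theta> X)" .
  qed (rule inv)
  then show ?thesis
    unfolding isomorphic_def using F G \<eta> inv
    by (intro conjI bexI[of _ \<eta>] bexI[of _ "\<lambda>X\<in>Obj C. \<theta> X"])
      (auto intro!: restrict_ext)
qed

lemma isomorphic_sym: "isomorphic C X Y \<Longrightarrow> isomorphic C Y X"
  by (auto simp: isomorphic_def)

section \<open>Equivalences\<close>

text \<open>The quasi-inverse sends \<open>Z\<close> to a chosen object \<open>P Z\<close> with an isomorphism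
  \<open>e Z : F (P Z) \<rightarrow> Z\<close>, and an arrow to the unique preimage of its conjugate by these isomorphisms.\<close>

lemma is_equivalenceI:
  assumes F: "is_functor A B F"
    and ff: "\<And>X Y g. \<lbrakk>X \<in> Obj A; Y \<in> Obj A; g \<in> Hom B (FO F X) (FO F Y)\<rbrakk>
      \<Longrightarrow> \<exists>!f. f \<in> Hom A X Y \<and> FM F X Y f = g"
    and es: "\<And>Z. Z \<in> Obj B \<Longrightarrow> \<exists>X\<in>Obj A. isomorphic B (FO F X) Z"
  shows "is_equivalence A B F"
proof -
  note A = functor_dom[OF F] and B = functor_cod[OF F]
  note Fo = functor_obj[OF F] and Fh = functor_hom[OF F]
  define pre where "pre X Y g = (THE f. f \<in> Hom A X Y \<and> FM F X Y f = g)" for X Y g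
  have pre: "pre X Y g \<in> Hom A X Y" "FM F X Y (pre X Y g) = g"
    if "X \<in> Obj A" "Y \<in> Obj A" "g \<in> Hom B (FO F X) (FO F Y)" for X Y g
    using theI'[OF ff[OF that]] by (simp_all add: pre_def)
  have faithful: "f = f'" if "X \<in> Obj A" "Y \<in> Obj A" "f \<in> Hom A X Y" "f' \<in> Hom A X Y"
    "FM F X Y f = FM F X Y f'" for X Y f f'
    using ff[of X Y "FM F X Y f"] Fh that by metis
  have "\<exists>X e d. X \<in> Obj A \<and> e \<in> Hom B (FO F X) Z \<and> d \<in> Hom B Z (FO F X) \<and>
      Comp B (FO F X) Z (FO F X) d e = Id B (FO F X) \<and> Comp B Z (FO F X) Z e d = Id B Z"
    if "Z \<in> Obj B" for Z
    using es[OF that] by (auto simp: isomorphic_def)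
  then obtain P e d where ch: "\<And>Z. Z \<in> Obj B \<Longrightarrow> P Z \<in> Obj A \<and> e Z \<in> Hom B (FO F (P Z)) Z \<and>
      d Z \<in> Hom B Z (FO F (P Z)) \<and>
      Comp B (FO F (P Z)) Z (FO F (P Z)) (d Z) (e Z) = Id B (FO F (P Z)) \<and>
      Comp B Z (FO F (P Z)) Z (e Z) (d Z) = Id B Z"
    by metis
  have P: "P Z \<in> Obj A" and e: "e Z \<in> Hom B (FO F (P Z)) Z" and d: "d Z \<in> Hom B Z (FO F (P Z))"
    and de: "Comp B (FO F (P Z)) Z (FO F (P Z)) (d Z) (e Z) = Id B (FO F (P Z))"
    and ed: "Comp B Z (FO F (P Z)) Z (e Z) (d Z) = Id B Z" if "Z \<in> Obj B" for Z
    using ch[OF that] by simp_all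
  \<comment> \<open>the conjugate of \<open>g : Z \<rightarrow> W\<close>\<close>
  define c where "c Z W g = Comp B (FO F (P Z)) W (FO F (P W)) (d W) (Comp B (FO F (P Z)) Z W g (e Z))"
    for Z W g
  have c: "c Z W g \<in> Hom B (FO F (P Z)) (FO F (P W))"
    if "Z \<in> Obj B" "W \<in> Obj B" "g \<in> Hom B Z W" for Z W g
    using that by (auto simp: c_def intro!: comp_in_Hom[OF B] Fo P e d)
  have ec: "Comp B (FO F (P Z)) (FO F (P W)) W (e W) (c Z W g) = Comp B (FO F (P Z)) Z W g (e Z)"
    if "Z \<in> Obj B" "W \<in> Obj B" "g \<in> Hom B Z W" for Z W g
    using that unfolding c_def
    by (subst comp_assoc[OF B])
      (auto simp: ed intro!: comp_id_left[OF B] Fo P e d comp_in_Hom[OF B])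
  define G where "G = restrict_fctr B \<lparr> FO = P, FM = (\<lambda>Z W g. pre (P Z) (P W) (c Z W g)) \<rparr>"
  have G_simps: "FO G Z = P Z" if "Z \<in> Obj B" for Z
    using that by (simp add: G_def)
  have G_FM: "FM G Z W g = pre (P Z) (P W) (c Z W g)"
    if "Z \<in> Obj B" "W \<in> Obj B" "g \<in> Hom B Z W" for Z W g
    using that by (simp add: G_def)
  have FG: "FM F (P Z) (P W) (FM G Z W g) = c Z W g"
    if "Z \<in> Obj B" "W \<in> Obj B" "g \<in> Hom B Z W" for Z W g
    using that by (simp add: G_FM pre c P)
  have G: "is_functor B A G"
    unfolding G_def
  proof (rule is_functor_restrictI[OF B A], simp_all only: fctr.simps)
    fix X assume X: "X \<in> Obj B"
    show "pre (P X) (P X) (c X X (Id B X)) = Id A (P X)"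
    proof (rule faithful[of "P X" "P X"])
      show "FM F (P X) (P X) (pre (P X) (P X) (c X X (Id B X))) = FM F (P X) (P X) (Id A (P X))"
        using X by (simp add: pre P c id_in_Hom B functor_id[OF F])
          (simp add: c_def comp_id_left B e Fo P de)
    qed (use X in \<open>simp_all add: P pre c id_in_Hom A B\<close>)
  next
    fix X Y Z f g
    assume h: "X \<in> Obj B" "Y \<in> Obj B" "Z \<in> Obj B" "f \<in> Hom B X Y" "g \<in> Hom B Y Z"
    note gf = comp_in_Hom[OF B h]
    have cc: "c X Z (Comp B X Y Z g f) =
        Comp B (FO F (P X)) (FO F (P Y)) (FO F (P Z)) (c Y Z g) (c X Y f)"
    proof -
      have "Comp B (FO F (P X)) (FO F (P Y)) (FO F (P Z)) (c Y Z g) (c X Y f) =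
          Comp B (FO F (P X)) Z (FO F (P Z)) (d Z) (Comp B (FO F (P X)) (FO F (P Y)) Z
            (Comp B (FO F (P Y)) Y Z g (e Y)) (c X Y f))"
        unfolding c_def[of Y Z g]
        using h by (intro comp_assoc[OF B, symmetric]) (auto intro!: comp_in_Hom[OF B] c Fo P e d)
      also have "Comp B (FO F (P X)) (FO F (P Y)) Z (Comp B (FO F (P Y)) Y Z g (e Y)) (c X Y f) =
          Comp B (FO F (P X)) Y Z g (Comp B (FO F (P X)) (FO F (P Y)) Y (e Y) (c X Y f))"
        using h by (intro comp_assoc[OF B, symmetric]) (auto intro!: c Fo P e)
      also have "\<dots> = Comp B (FO F (P X)) X Z (Comp B X Y Z g f) (e X)"
        using h by (simp add: ec) (intro comp_assoc[OF B], auto intro!: Fo P e)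
      finally show ?thesis by (simp add: c_def)
    qed
    show "pre (P X) (P Z) (c X Z (Comp B X Y Z g f)) =
        Comp A (P X) (P Y) (P Z) (pre (P Y) (P Z) (c Y Z g)) (pre (P X) (P Y) (c X Y f))"
    proof (rule faithful[of "P X" "P Z"])
      show "FM F (P X) (P Z) (pre (P X) (P Z) (c X Z (Comp B X Y Z g f))) =
        FM F (P X) (P Z) (Comp A (P X) (P Y) (P Z) (pre (P Y) (P Z) (c Y Z g)) (pre (P X) (P Y) (c X Y f)))"
        using h gf by (simp add: pre P c functor_comp[OF F] cc[symmetric])
    qed (use h gf in \<open>auto intro!: P pre c comp_in_Hom[OF A]\<close>)
  qed (auto intro: P pre c)
  have GF_id: "isomorphic (fctr_cat A A) (comp_fctr A G F) (id_fctr A)"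
  proof (rule isomorphic_fctrI[where \<theta> = "\<lambda>X. pre X (P (FO F X)) (d (FO F X))"])
    show "is_nat_trans A A (comp_fctr A G F) (id_fctr A) (\<lambda>X\<in>Obj A. pre (P (FO F X)) X (e (FO F X)))"
    proof (rule is_nat_trans_restrictI)
      fix X Y f assume h: "X \<in> Obj A" "Y \<in> Obj A" "f \<in> Hom A X Y"
      note G1 = functor_hom[OF G Fo Fo Fh, OF h(1,2) h, unfolded G_simps[OF Fo[OF h(1)]] G_simps[OF Fo[OF h(2)]]]
      have "Comp A (P (FO F X)) (P (FO F Y)) Y (pre (P (FO F Y)) Y (e (FO F Y)))
            (FM G (FO F X) (FO F Y) (FM F X Y f)) =
          Comp A (P (FO F X)) X Y f (pre (P (FO F X)) X (e (FO F X)))"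
      proof (rule faithful[of "P (FO F X)" Y])
        show "FM F (P (FO F X)) Y (Comp A (P (FO F X)) (P (FO F Y)) Y (pre (P (FO F Y)) Y (e (FO F Y)))
            (FM G (FO F X) (FO F Y) (FM F X Y f))) =
          FM F (P (FO F X)) Y (Comp A (P (FO F X)) X Y f (pre (P (FO F X)) X (e (FO F X))))"
          using h G1 by (simp add: functor_comp[OF F] P Fo pre e FG Fh ec)
      qed (use h G1 in \<open>auto intro!: P Fo pre e comp_in_Hom[OF A]\<close>)
      then show "Comp A (FO (comp_fctr A G F) X) (FO (comp_fctr A G F) Y) (FO (id_fctr A) Y)
          (pre (P (FO F Y)) Y (e (FO F Y))) (FM (comp_fctr A G F) X Y f) =
        Comp A (FO (comp_fctr A G F) X) (FO (id_fctr A) X) (FO (id_fctr A) Y)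
          (FM (id_fctr A) X Y f) (pre (P (FO F X)) X (e (FO F X)))"
        using h by (simp add: G_simps Fo)
    qed (auto simp: G_simps Fo intro!: pre e P)
    fix X assume X: "X \<in> Obj A"
    have "Comp A (P (FO F X)) X (P (FO F X)) (pre X (P (FO F X)) (d (FO F X)))
        (pre (P (FO F X)) X (e (FO F X))) = Id A (P (FO F X))"
      using X by (intro faithful[of "P (FO F X)" "P (FO F X)"])
        (simp_all add: P Fo pre e d functor_comp[OF F] functor_id[OF F] de id_in_Hom comp_in_Hom A)
    then show "Comp A (FO (comp_fctr A G F) X) (FO (id_fctr A) X) (FO (comp_fctr A G F) X)
        (pre X (P (FO F X)) (d (FO F X))) ((\<lambda>X\<in>Obj A. pre (P (FO F X)) X (e (FO F X))) X) =
      Id A (FO (comp_fctr A G F) X)"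
      using X by (simp add: G_simps Fo)
    have "Comp A X (P (FO F X)) X (pre (P (FO F X)) X (e (FO F X)))
        (pre X (P (FO F X)) (d (FO F X))) = Id A X"
      using X by (intro faithful[of X X])
        (simp_all add: P Fo pre e d functor_comp[OF F] functor_id[OF F] ed id_in_Hom comp_in_Hom A)
    then show "Comp A (FO (id_fctr A) X) (FO (comp_fctr A G F) X) (FO (id_fctr A) X)
        ((\<lambda>X\<in>Obj A. pre (P (FO F X)) X (e (FO F X))) X) (pre X (P (FO F X)) (d (FO F X))) =
      Id A (FO (id_fctr A) X)"
      using X by (simp add: G_simps Fo)
  qed (auto simp: G_simps Fo intro!: pre d P is_functor_comp_fctr[OF F G] is_functor_id_fctr A)
  have FG_id: "isomorphic (fctr_cat B B) (comp_fctr B F G) (id_fctr B)"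
  proof (rule isomorphic_fctrI[where \<theta> = d])
    show "is_nat_trans B B (comp_fctr B F G) (id_fctr B) (\<lambda>Z\<in>Obj B. e Z)"
      by (rule is_nat_trans_restrictI) (simp_all add: G_simps e FG ec)
  qed (simp_all add: G_simps d de ed is_functor_comp_fctr[OF G F] is_functor_id_fctr B)
  show ?thesis
    unfolding is_equivalence_def using F G GF_id FG_id by blast
qed

section \<open>Cones and cocones\<close>

lemma is_coconeD:
  assumes "is_cocone C c"
  shows cocone_diagram: "is_functor (index c) C (diagram c)"
    and cocone_apex: "apex c \<in> Obj C"
    and cocone_leg: "i \<in> Obj (index c) \<Longrightarrow> leg c i \<in> Hom C (FO (diagram c) i) (apex c)"
    and cocone_compat: "\<lbrakk>i \<in> Obj (index c); j \<in> Obj (index c); f \<in> Hom (index c) i j\<rbrakk> \<Longrightarrow>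
      Comp C (FO (diagram c) i) (FO (diagram c) j) (apex c) (leg c j) (FM (diagram c) i j f) = leg c i"
  using assms by (simp_all add: is_cocone_def Let_def)

lemma is_coconeI:
  assumes "is_functor (index c) C (diagram c)" "apex c \<in> Obj C"
    and "\<And>i. i \<in> Obj (index c) \<Longrightarrow> leg c i \<in> Hom C (FO (diagram c) i) (apex c)"
    and "\<And>i j f. \<lbrakk>i \<in> Obj (index c); j \<in> Obj (index c); f \<in> Hom (index c) i j\<rbrakk> \<Longrightarrow>
      Comp C (FO (diagram c) i) (FO (diagram c) j) (apex c) (leg c j) (FM (diagram c) i j f) = leg c i"
  shows "is_cocone C c"
  using assms by (simp add: is_cocone_def Let_def)

lemma is_coneD:
  assumes "is_cone C c"
  shows cone_diagram: "is_functor (index c) C (diagram c)"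
    and cone_apex: "apex c \<in> Obj C"
    and cone_leg: "i \<in> Obj (index c) \<Longrightarrow> leg c i \<in> Hom C (apex c) (FO (diagram c) i)"
    and cone_compat: "\<lbrakk>i \<in> Obj (index c); j \<in> Obj (index c); f \<in> Hom (index c) i j\<rbrakk> \<Longrightarrow>
      Comp C (apex c) (FO (diagram c) i) (FO (diagram c) j) (FM (diagram c) i j f) (leg c i) = leg c j"
  using assms by (simp_all add: is_cone_def Let_def)

lemma is_coneI:
  assumes "is_functor (index c) C (diagram c)" "apex c \<in> Obj C"
    and "\<And>i. i \<in> Obj (index c) \<Longrightarrow> leg c i \<in> Hom C (apex c) (FO (diagram c) i)"
    and "\<And>i j f. \<lbrakk>i \<in> Obj (index c); j \<in> Obj (index c); f \<in> Hom (index c) i j\<rbrakk> \<Longrightarrow>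
      Comp C (apex c) (FO (diagram c) i) (FO (diagram c) j) (FM (diagram c) i j f) (leg c i) = leg c j"
  shows "is_cone C c"
  using assms by (simp add: is_cone_def Let_def)

lemma map_cone_simps [simp]:
  "index (map_cone F c) = index c" "diagram (map_cone F c) = comp_fctr (index c) F (diagram c)"
  "apex (map_cone F c) = FO F (apex c)"
  "leg (map_cone F c) i = FM F (apex c) (FO (diagram c) i) (leg c i)"
  by (simp_all add: map_cone_def)

lemma map_cocone_simps [simp]:
  "index (map_cocone F c) = index c" "diagram (map_cocone F c) = comp_fctr (index c) F (diagram c)"
  "apex (map_cocone F c) = FO F (apex c)"
  "leg (map_cocone F c) i = FM F (FO (diagram c) i) (apex c) (leg c i)"
  by (simp_all add: map_cocone_def)

lemma op_cone_simps [simp]: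
  "index (op_cone c) = op_cat (index c)" "diagram (op_cone c) = op_fctr (diagram c)"
  "apex (op_cone c) = apex c" "leg (op_cone c) = leg c"
  by (simp_all add: op_cone_def)

lemma is_cocone_op_cone:
  assumes "is_cone C c"
  shows "is_cocone (op_cat C) (op_cone c)"
  using is_coneD[OF assms] by (intro is_coconeI) (simp_all add: is_functor_op_fctr)

lemma is_cone_map_cone:
  assumes c: "is_cone C c" and F: "is_functor C D F"
  shows "is_cone D (map_cone F c)"
proof (rule is_coneI, simp_all)
  note d = cone_diagram[OF c]
  show "is_functor (index c) D (comp_fctr (index c) F (diagram c))"
    by (rule is_functor_comp_fctr[OF d F])
qed (auto simp: functor_comp[OF F, symmetric] cone_compat[OF c]
    intro!: functor_obj[OF F] functor_hom[OF F] functor_obj[OF cone_diagram[OF c]]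
      functor_hom[OF cone_diagram[OF c]] cone_apex[OF c] cone_leg[OF c]
    simp: functor_obj[OF cone_diagram[OF c]] functor_hom[OF cone_diagram[OF c]] cone_apex[OF c] cone_leg[OF c])

lemma is_cocone_map_cocone:
  assumes c: "is_cocone C c" and F: "is_functor C D F"
  shows "is_cocone D (map_cocone F c)"
proof (rule is_coconeI, simp_all)
  note d = cocone_diagram[OF c]
  show "is_functor (index c) D (comp_fctr (index c) F (diagram c))"
    by (rule is_functor_comp_fctr[OF d F])
qed (auto simp: functor_comp[OF F, symmetric] cocone_compat[OF c]
    intro!: functor_obj[OF F] functor_hom[OF F] functor_obj[OF cocone_diagram[OF c]]
      functor_hom[OF cocone_diagram[OF c]] cocone_apex[OF c] cocone_leg[OF c]
    simp: functor_obj[OF cocone_diagram[OF c]] functor_hom[OF cocone_diagram[OF c]]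
      cocone_apex[OF c] cocone_leg[OF c])

lemma colimit_cocone: "is_colimit C c \<Longrightarrow> is_cocone C c"
  by (simp add: is_colimit_def)

lemma colimit_ex1:
  assumes "is_colimit C c" "X \<in> Obj C"
    and "\<And>i. i \<in> Obj (index c) \<Longrightarrow> \<mu> i \<in> Hom C (FO (diagram c) i) X"
    and "\<And>i j f. \<lbrakk>i \<in> Obj (index c); j \<in> Obj (index c); f \<in> Hom (index c) i j\<rbrakk> \<Longrightarrow>
      Comp C (FO (diagram c) i) (FO (diagram c) j) X (\<mu> j) (FM (diagram c) i j f) = \<mu> i"
  shows "\<exists>!u. u \<in> Hom C (apex c) X \<and>
    (\<forall>i\<in>Obj (index c). Comp C (FO (diagram c) i) (apex c) X u (leg c i) = \<mu> i)"
proof -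
  have "is_cocone C (c\<lparr> apex := X, leg := \<mu> \<rparr>)"
    using assms(2-) cocone_diagram[OF colimit_cocone[OF assms(1)]] by (intro is_coconeI) simp_all
  then show ?thesis
    using assms(1) unfolding is_colimit_def by blast
qed

lemma colimit_arrow_eqI:
  assumes c: "is_colimit C c" and C: "category C" and X: "X \<in> Obj C"
    and u: "u \<in> Hom C (apex c) X" and v: "v \<in> Hom C (apex c) X"
    and eq: "\<And>i. i \<in> Obj (index c) \<Longrightarrow> Comp C (FO (diagram c) i) (apex c) X u (leg c i) =
      Comp C (FO (diagram c) i) (apex c) X v (leg c i)"
  shows "u = v"
proof -
  note k = colimit_cocone[OF c]
  have "\<exists>!w. w \<in> Hom C (apex c) X \<and> (\<forall>i\<in>Obj (index c).
      Comp C (FO (diagram c) i) (apex c) X w (leg c i) =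
      Comp C (FO (diagram c) i) (apex c) X u (leg c i))"
  proof (rule colimit_ex1[OF c X])
    fix i j f assume h: "i \<in> Obj (index c)" "j \<in> Obj (index c)" "f \<in> Hom (index c) i j"
    show "Comp C (FO (diagram c) i) (FO (diagram c) j) X
        (Comp C (FO (diagram c) j) (apex c) X u (leg c j)) (FM (diagram c) i j f) =
      Comp C (FO (diagram c) i) (apex c) X u (leg c i)"
      using h functor_obj[OF cocone_diagram[OF k]] functor_hom[OF cocone_diagram[OF k]]
      by (simp add: comp_assoc[OF C, symmetric] cocone_apex[OF k] cocone_leg[OF k] X u
          cocone_compat[OF k])
  qed (use functor_obj[OF cocone_diagram[OF k]] in
      \<open>auto intro!: comp_in_Hom[OF C] cocone_leg[OF k] cocone_apex[OF k] X u\<close>)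
  then show ?thesis using u v eq by metis
qed

lemma is_colimitI:
  assumes "is_cocone C c"
    and "\<And>X \<mu>. \<lbrakk>X \<in> Obj C; \<And>i. i \<in> Obj (index c) \<Longrightarrow> \<mu> i \<in> Hom C (FO (diagram c) i) X;
      \<And>i j f. \<lbrakk>i \<in> Obj (index c); j \<in> Obj (index c); f \<in> Hom (index c) i j\<rbrakk> \<Longrightarrow>
        Comp C (FO (diagram c) i) (FO (diagram c) j) X (\<mu> j) (FM (diagram c) i j f) = \<mu> i\<rbrakk> \<Longrightarrow>
      \<exists>!u. u \<in> Hom C (apex c) X \<and>
        (\<forall>i\<in>Obj (index c). Comp C (FO (diagram c) i) (apex c) X u (leg c i) = \<mu> i)"
  shows "is_colimit C c"
  unfolding is_colimit_def
proof (intro conjI allI impI)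
  fix X \<mu> assume "is_cocone C (c\<lparr> apex := X, leg := \<mu> \<rparr>)"
  note k = is_coconeD[OF this, simplified]
  show "\<exists>!u. u \<in> Hom C (apex c) X \<and>
      (\<forall>i\<in>Obj (index c). Comp C (FO (diagram c) i) (apex c) X u (leg c i) = \<mu> i)"
    by (rule assms(2)) (use k in auto)
qed (rule assms(1))

text \<open>Cocones are records with total functions as legs, and the image of a cocone under a composite
  functor equals the iterated image only on the objects of the index category.\<close>

lemma is_colimit_cong:
  assumes "is_colimit C c" "index c' = index c" "diagram c' = diagram c" "apex c' = apex c"
    and "\<And>i. i \<in> Obj (index c) \<Longrightarrow> leg c' i = leg c i"
  shows "is_colimit C c'"
proof (rule is_colimitI)
  note k = is_coconeD[OF colimit_cocone[OF assms(1)]]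
  show "is_cocone C c'"
    using k by (intro is_coconeI) (simp_all add: assms)
qed (use colimit_ex1[OF assms(1)] in \<open>simp add: assms cong: conj_cong ball_cong\<close>)

section \<open>Set-valued functors\<close>

lemma Set_cat_simps [simp]:
  "Obj (Set_cat :: ('u set, 'u \<Rightarrow> 'u) cat) = {X. small TYPE('u) X}"
  "Hom Set_cat X Y = (X \<rightarrow>\<^sub>E Y)" "Id Set_cat X = (\<lambda>x\<in>X. x)" "Comp Set_cat X Y Z g f = compose X g f"
  by (simp_all add: Set_cat_def)

lemma category_Set_cat: "category Set_cat"
  by (auto simp: category_def compose_def PiE_def extensional_def Pi_def fun_eq_iff restrict_def)

lemma
  assumes M: "is_functor E Set_cat M"
  shows set_fctr_apply: "\<lbrakk>A \<in> Obj E; B \<in> Obj E; f \<in> Hom E A B; x \<in> FO M A\<rbrakk> \<Longrightarrow> FM M A B f x \<in> FO M B"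
    and set_fctr_id: "\<lbrakk>A \<in> Obj E; x \<in> FO M A\<rbrakk> \<Longrightarrow> FM M A A (Id E A) x = x"
    and set_fctr_comp: "\<lbrakk>A \<in> Obj E; B \<in> Obj E; D \<in> Obj E; f \<in> Hom E A B; g \<in> Hom E B D; x \<in> FO M A\<rbrakk>
      \<Longrightarrow> FM M A D (Comp E A B D g f) x = FM M B D g (FM M A B f x)"
  using functor_hom[OF M, of A B f] functor_id[OF M, of A] functor_comp[OF M, of A B D f g]
  by (auto simp: compose_def)

lemma is_set_functorI:
  fixes X :: "'e \<Rightarrow> 'u set"
  assumes E: "category E" and sm: "\<And>A. A \<in> Obj E \<Longrightarrow> small TYPE('u) (X A)"
    and ap: "\<And>A B f x. \<lbrakk>A \<in> Obj E; B \<in> Obj E; f \<in> Hom E A B; x \<in> X A\<rbrakk> \<Longrightarrow> a A B f x \<in> X B"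
    and id: "\<And>A x. \<lbrakk>A \<in> Obj E; x \<in> X A\<rbrakk> \<Longrightarrow> a A A (Id E A) x = x"
    and co: "\<And>A B D f g x. \<lbrakk>A \<in> Obj E; B \<in> Obj E; D \<in> Obj E; f \<in> Hom E A B; g \<in> Hom E B D; x \<in> X A\<rbrakk>
      \<Longrightarrow> a A D (Comp E A B D g f) x = a B D g (a A B f x)"
  shows "is_functor E Set_cat (restrict_fctr E \<lparr> FO = X, FM = (\<lambda>A B f. \<lambda>x\<in>X A. a A B f x) \<rparr>)"
  using assms by (intro is_functor_restrictI category_Set_cat) (auto simp: compose_def intro!: restrict_ext)

lemma
  assumes "is_nat_trans E Set_cat M N m"
  shows set_nat_trans_apply: "\<lbrakk>A \<in> Obj E; x \<in> FO M A\<rbrakk> \<Longrightarrow> m A x \<in> FO N A"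
    and set_nat_trans_natural: "\<lbrakk>is_functor E Set_cat M; A \<in> Obj E; B \<in> Obj E; f \<in> Hom E A B; x \<in> FO M A\<rbrakk>
      \<Longrightarrow> m B (FM M A B f x) = FM N A B f (m A x)"
proof -
  show "m A x \<in> FO N A" if "A \<in> Obj E" "x \<in> FO M A"
    using nat_trans_in_Hom[OF assms that(1)] that(2) by auto
  show "m B (FM M A B f x) = FM N A B f (m A x)"
    if "is_functor E Set_cat M" "A \<in> Obj E" "B \<in> Obj E" "f \<in> Hom E A B" "x \<in> FO M A"
    using fun_cong[OF nat_trans_natural[OF assms that(2-4)], of x] that(5)
    by (simp add: compose_def)
qed

lemma set_nat_trans_eqI:
  assumes m: "is_nat_trans E Set_cat M N m" and n: "is_nat_trans E Set_cat M N n"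
    and eq: "\<And>A x. \<lbrakk>A \<in> Obj E; x \<in> FO M A\<rbrakk> \<Longrightarrow> m A x = n A x"
  shows "m = n"
proof (rule nat_trans_eqI[OF m n])
  fix A assume A: "A \<in> Obj E"
  show "m A = n A"
    using nat_trans_in_Hom[OF m A] nat_trans_in_Hom[OF n A] eq[OF A]
    by (auto intro: PiE_ext)
qed

lemma is_set_nat_transI:
  assumes M: "is_functor E Set_cat M"
    and ap: "\<And>A x. \<lbrakk>A \<in> Obj E; x \<in> FO M A\<rbrakk> \<Longrightarrow> m A x \<in> FO N A"
    and nt: "\<And>A B f x. \<lbrakk>A \<in> Obj E; B \<in> Obj E; f \<in> Hom E A B; x \<in> FO M A\<rbrakk>
      \<Longrightarrow> m B (FM M A B f x) = FM N A B f (m A x)"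
  shows "is_nat_trans E Set_cat M N (\<lambda>A\<in>Obj E. \<lambda>x\<in>FO M A. m A x)"
  using ap nt set_fctr_apply[OF M]
  by (intro is_nat_trans_restrictI) (auto simp: compose_def intro!: restrict_ext)

text \<open>A cone with apex \<open>X\<close> is a compatible family for each point of \<open>X\<close>.\<close>

lemma is_limit_SetI:
  assumes c: "is_cone Set_cat c"
    and ex1: "\<And>y. \<lbrakk>\<And>i. i \<in> Obj (index c) \<Longrightarrow> y i \<in> FO (diagram c) i;
      \<And>i j f. \<lbrakk>i \<in> Obj (index c); j \<in> Obj (index c); f \<in> Hom (index c) i j\<rbrakk> \<Longrightarrow>
        FM (diagram c) i j f (y i) = y j\<rbrakk> \<Longrightarrow>
      \<exists>!a. a \<in> apex c \<and> (\<forall>i\<in>Obj (index c). leg c i a = y i)"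
  shows "is_limit Set_cat c"
  unfolding is_limit_def
proof (intro conjI allI impI)
  fix X \<mu> assume "is_cone Set_cat (c\<lparr> apex := X, leg := \<mu> \<rparr>)"
  note k = is_coneD[OF this, simplified]
  have \<mu>: "\<mu> i x \<in> FO (diagram c) i" if "i \<in> Obj (index c)" "x \<in> X" for i x
    using k(3)[OF that(1)] that(2) by auto
  have "\<exists>!a. a \<in> apex c \<and> (\<forall>i\<in>Obj (index c). leg c i a = \<mu> i x)" if x: "x \<in> X" for x
  proof (rule ex1)
    show "FM (diagram c) i j f (\<mu> i x) = \<mu> j x"
      if "i \<in> Obj (index c)" "j \<in> Obj (index c)" "f \<in> Hom (index c) i j" for i j f
      using fun_cong[OF k(4)[OF that], of x] x by (simp add: compose_def)
  qed (rule \<mu>[OF _ x])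
  then obtain u where u: "\<And>x. x \<in> X \<Longrightarrow> u x \<in> apex c \<and> (\<forall>i\<in>Obj (index c). leg c i (u x) = \<mu> i x)"
    and uu: "\<And>x a. \<lbrakk>x \<in> X; a \<in> apex c; \<forall>i\<in>Obj (index c). leg c i a = \<mu> i x\<rbrakk> \<Longrightarrow> a = u x"
    by metis
  show "\<exists>!u. u \<in> Hom Set_cat X (apex c) \<and>
      (\<forall>i\<in>Obj (index c). Comp Set_cat X (apex c) (FO (diagram c) i) (leg c i) u = \<mu> i)"
  proof (rule ex1I[of _ "\<lambda>x\<in>X. u x"], intro conjI ballI)
    fix i assume i: "i \<in> Obj (index c)"
    show "Comp Set_cat X (apex c) (FO (diagram c) i) (leg c i) (\<lambda>x\<in>X. u x) = \<mu> i"
      using k(3)[OF i] u i by (auto simp: compose_def fun_eq_iff PiE_def extensional_def)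
  next
    fix v assume v: "v \<in> Hom Set_cat X (apex c) \<and>
      (\<forall>i\<in>Obj (index c). Comp Set_cat X (apex c) (FO (diagram c) i) (leg c i) v = \<mu> i)"
    have "v x = u x" if x: "x \<in> X" for x
    proof (rule uu[OF x])
      show "v x \<in> apex c" using v x by auto
      show "\<forall>i\<in>Obj (index c). leg c i (v x) = \<mu> i x"
        using v x by (fastforce simp: compose_def dest: fun_cong[of _ _ x])
    qed
    then show "v = (\<lambda>x\<in>X. u x)"
      using v by (auto simp: fun_eq_iff PiE_def extensional_def)
  qed (use u in auto)
qed (rule c)

text \<open>Conversely, a compatible family is a cone with a one-point apex; the universe is infinite, so
  that a point is small.\<close>

lemma limit_Set_ex1:
  fixes c :: "('i, 'u set, 'u \<Rightarrow> 'u) cone"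
  assumes inf: "infinite (UNIV :: 'u set)" and c: "is_limit Set_cat c"
    and y: "\<And>i. i \<in> Obj (index c) \<Longrightarrow> y i \<in> FO (diagram c) i"
      "\<And>i j f. \<lbrakk>i \<in> Obj (index c); j \<in> Obj (index c); f \<in> Hom (index c) i j\<rbrakk> \<Longrightarrow>
        FM (diagram c) i j f (y i) = y j"
  shows "\<exists>!a. a \<in> apex c \<and> (\<forall>i\<in>Obj (index c). leg c i a = y i)"
proof -
  define X :: "'u set" where "X = {undefined}"
  define \<mu> where "\<mu> i = (\<lambda>x\<in>X. y i)" for i
  have "is_cone Set_cat (c\<lparr> apex := X, leg := \<mu> \<rparr>)"
  proof (rule is_coneI)
    have "small TYPE('u) X"
      unfolding small_def X_def using inf by (intro finite_lesspoll_infinite) auto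
    then show "apex (c\<lparr> apex := X, leg := \<mu> \<rparr>) \<in> Obj Set_cat" by simp
    show "is_functor (index (c\<lparr> apex := X, leg := \<mu> \<rparr>)) Set_cat (diagram (c\<lparr> apex := X, leg := \<mu> \<rparr>))"
      using c by (simp add: is_limit_def is_coneD)
  qed (use y in \<open>auto simp: \<mu>_def compose_def intro!: restrict_ext\<close>)
  then obtain u where u: "u \<in> X \<rightarrow>\<^sub>E apex c" "\<And>i. i \<in> Obj (index c) \<Longrightarrow> compose X (leg c i) u = \<mu> i"
    and uu: "\<And>v. \<lbrakk>v \<in> X \<rightarrow>\<^sub>E apex c; \<And>i. i \<in> Obj (index c) \<Longrightarrow> compose X (leg c i) v = \<mu> i\<rbrakk> \<Longrightarrow> v = u"
    using c unfolding is_limit_def by (simp add: Ex1_def) metis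
  show ?thesis
  proof (rule ex1I[of _ "u undefined"], intro conjI ballI)
    show "u undefined \<in> apex c" using u(1) by (auto simp: X_def)
    show "leg c i (u undefined) = y i" if "i \<in> Obj (index c)" for i
      using fun_cong[OF u(2)[OF that], of undefined] by (simp add: compose_def \<mu>_def X_def)
  next
    fix a assume a: "a \<in> apex c \<and> (\<forall>i\<in>Obj (index c). leg c i a = y i)"
    have "(\<lambda>x\<in>X. a) = u"
      by (rule uu) (use a in \<open>auto simp: compose_def \<mu>_def intro!: restrict_ext\<close>)
    then have "(\<lambda>x\<in>X. a) undefined = u undefined" by simp
    then show "a = u undefined" by (simp add: X_def)
  qed
qed

section \<open>The Yoneda lemma\<close>

lemma hom_fctr_simps [simp]:
  "X \<in> Obj E \<Longrightarrow> FO (hom_fctr E A) X = Hom E A X"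
  "\<lbrakk>X \<in> Obj E; Y \<in> Obj E; h \<in> Hom E X Y; g \<in> Hom E A X\<rbrakk>
    \<Longrightarrow> FM (hom_fctr E A) X Y h g = Comp E A X Y h g"
  by (simp_all add: hom_fctr_def)

lemma is_functor_hom_fctr:
  fixes E :: "('e, 'u) cat"
  assumes "locally_small TYPE('u) E" "A \<in> Obj E"
  shows "is_functor E Set_cat (hom_fctr E A)"
proof -
  have E: "category E" using assms(1) by (simp add: locally_small_def)
  show ?thesis
    unfolding hom_fctr_def using assms
    by (intro is_set_functorI E)
      (auto simp: locally_small_def comp_id_left[OF E] comp_assoc[OF E] intro!: comp_in_Hom[OF E])
qed

text \<open>The arrow from the representable functor at \<open>A\<close> to \<open>M\<close> that the Yoneda lemma assigns to an
  element \<open>x\<close> of \<open>M A\<close>.\<close>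

definition element_arrow ::
  "('e, 'u) cat \<Rightarrow> ('e, 'u, 'u set, 'u \<Rightarrow> 'u) fctr \<Rightarrow> 'e \<Rightarrow> 'u \<Rightarrow> 'e \<Rightarrow> 'u \<Rightarrow> 'u" where
  "element_arrow E M A x = (\<lambda>X\<in>Obj E. \<lambda>g\<in>Hom E A X. FM M A X g x)"

lemma element_arrow_apply [simp]:
  "\<lbrakk>X \<in> Obj E; g \<in> Hom E A X\<rbrakk> \<Longrightarrow> element_arrow E M A x X g = FM M A X g x"
  by (simp add: element_arrow_def)

lemma is_nat_trans_element_arrow:
  fixes E :: "('e, 'u) cat"
  assumes E: "locally_small TYPE('u) E" and M: "is_functor E Set_cat M"
    and x: "A \<in> Obj E" "x \<in> FO M A"
  shows "is_nat_trans E Set_cat (hom_fctr E A) M (element_arrow E M A x)"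
proof -
  have eq: "element_arrow E M A x = (\<lambda>X\<in>Obj E. \<lambda>g\<in>FO (hom_fctr E A) X. FM M A X g x)"
    unfolding element_arrow_def by (rule restrict_ext) simp
  show ?thesis
    unfolding eq by (rule is_set_nat_transI[OF is_functor_hom_fctr[OF E x(1)]])
      (use x in \<open>simp_all add: set_fctr_apply[OF M] set_fctr_comp[OF M]\<close>)
qed

lemma nat_trans_hom_fctr_apply:
  fixes E :: "('e, 'u) cat"
  assumes E: "locally_small TYPE('u) E" and A: "A \<in> Obj E"
    and m: "is_nat_trans E Set_cat (hom_fctr E A) M m"
    and X: "X \<in> Obj E" "g \<in> Hom E A X"
  shows "m X g = FM M A X g (m A (Id E A))"
proof -
  have C: "category E" using E by (simp add: locally_small_def)
  show ?thesis
    using set_nat_trans_natural[OF m is_functor_hom_fctr[OF E A] A X, of "Id E A"] A X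
    by (simp add: id_in_Hom[OF C] comp_id_right[OF C])
qed

lemma nat_trans_hom_fctr_eqI:
  fixes E :: "('e, 'u) cat"
  assumes E: "locally_small TYPE('u) E" and A: "A \<in> Obj E"
    and m: "is_nat_trans E Set_cat (hom_fctr E A) M m"
    and n: "is_nat_trans E Set_cat (hom_fctr E A) M n"
    and eq: "m A (Id E A) = n A (Id E A)"
  shows "m = n"
  by (rule set_nat_trans_eqI[OF m n])
    (simp add: nat_trans_hom_fctr_apply[OF E A m] nat_trans_hom_fctr_apply[OF E A n] eq)

lemma element_arrow_unique:
  fixes E :: "('e, 'u) cat"
  assumes E: "locally_small TYPE('u) E" and A: "A \<in> Obj E" and M: "is_functor E Set_cat M"
    and m: "is_nat_trans E Set_cat (hom_fctr E A) M m"
  shows "m = element_arrow E M A (m A (Id E A))"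
proof -
  have C: "category E" using E by (simp add: locally_small_def)
  note x = set_nat_trans_apply[OF m A, of "Id E A"]
  show ?thesis
    by (rule nat_trans_hom_fctr_eqI[OF E A m is_nat_trans_element_arrow[OF E M A]])
      (use x in \<open>simp_all add: A id_in_Hom[OF C] set_fctr_id[OF M]\<close>)
qed

lemma yoneda_simps [simp]:
  "A \<in> Obj E \<Longrightarrow> FO (yoneda E) A = hom_fctr E A"
  "\<lbrakk>A \<in> Obj E; B \<in> Obj E; f \<in> Hom E B A\<rbrakk>
    \<Longrightarrow> FM (yoneda E) A B f = element_arrow E (hom_fctr E B) A f"
  by (auto simp: yoneda_def element_arrow_def intro!: restrict_ext)

section \<open>Weighted cocones\<close>

text \<open>Here \<open>G\<close> is a contravariant functor from \<open>E\<close> to \<open>C\<close>. A weighted cocone with weight \<open>M\<close> can be seen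
  as an ordinary cocone on the diagram that has one copy of \<open>G A\<close> for each element of \<open>M A\<close>, and which
  is large if \<open>E\<close> is.\<close>

definition is_wcocone ::
  "('e, 'u) cat \<Rightarrow> ('c, 'p) cat \<Rightarrow> ('e, 'u, 'c, 'p) fctr \<Rightarrow> ('e, 'u, 'u set, 'u \<Rightarrow> 'u) fctr \<Rightarrow>
   'c \<Rightarrow> ('e \<Rightarrow> 'u \<Rightarrow> 'p) \<Rightarrow> bool" where
  "is_wcocone E C G M T \<phi> \<longleftrightarrow>
     (\<forall>A\<in>Obj E. \<forall>x\<in>FO M A. \<phi> A x \<in> Hom C (FO G A) T) \<and>
     (\<forall>A\<in>Obj E. \<forall>B\<in>Obj E. \<forall>f\<in>Hom E A B. \<forall>x\<in>FO M A.
        \<phi> B (FM M A B f x) = Comp C (FO G B) (FO G A) T (\<phi> A x) (FM G B A f))"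

definition is_wcolim ::
  "('e, 'u) cat \<Rightarrow> ('c, 'p) cat \<Rightarrow> ('e, 'u, 'c, 'p) fctr \<Rightarrow> ('e, 'u, 'u set, 'u \<Rightarrow> 'u) fctr \<Rightarrow>
   'c \<Rightarrow> ('e \<Rightarrow> 'u \<Rightarrow> 'p) \<Rightarrow> bool" where
  "is_wcolim E C G M L \<kappa> \<longleftrightarrow> L \<in> Obj C \<and> is_wcocone E C G M L \<kappa> \<and>
     (\<forall>T\<in>Obj C. \<forall>\<phi>. is_wcocone E C G M T \<phi> \<longrightarrow>
        (\<exists>!u. u \<in> Hom C L T \<and>
          (\<forall>A\<in>Obj E. \<forall>x\<in>FO M A. Comp C (FO G A) L T u (\<kappa> A x) = \<phi> A x)))"

lemma wcocone_in_Hom: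
  "\<lbrakk>is_wcocone E C G M T \<phi>; A \<in> Obj E; x \<in> FO M A\<rbrakk> \<Longrightarrow> \<phi> A x \<in> Hom C (FO G A) T"
  by (simp add: is_wcocone_def)

lemma wcocone_natural:
  "\<lbrakk>is_wcocone E C G M T \<phi>; A \<in> Obj E; B \<in> Obj E; f \<in> Hom E A B; x \<in> FO M A\<rbrakk> \<Longrightarrow>
    \<phi> B (FM M A B f x) = Comp C (FO G B) (FO G A) T (\<phi> A x) (FM G B A f)"
  by (simp add: is_wcocone_def)

lemma wcocone_postcomp:
  assumes G: "is_functor (op_cat E) C G" and M: "is_functor E Set_cat M"
    and \<phi>: "is_wcocone E C G M T \<phi>" and u: "u \<in> Hom C T X" "T \<in> Obj C" "X \<in> Obj C"
  shows "is_wcocone E C G M X (\<lambda>A x. Comp C (FO G A) T X u (\<phi> A x))"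
  unfolding is_wcocone_def
  using functor_cod[OF G] functor_obj[OF G] functor_hom[OF G] u
  by (auto simp: wcocone_natural[OF \<phi>] wcocone_in_Hom[OF \<phi>] intro!: comp_in_Hom comp_assoc)

lemma wcocone_precomp:
  assumes N: "is_functor E Set_cat N" and \<phi>: "is_wcocone E C G M T \<phi>"
    and m: "is_nat_trans E Set_cat N M m"
  shows "is_wcocone E C G N T (\<lambda>A x. \<phi> A (m A x))"
  unfolding is_wcocone_def
  by (auto simp: set_nat_trans_natural[OF m N] wcocone_natural[OF \<phi>] set_nat_trans_apply[OF m]
      intro!: wcocone_in_Hom[OF \<phi>])

lemma wcocone_hom_fctr:
  assumes E: "locally_small TYPE('u) (E :: ('e, 'u) cat)"
    and G: "is_functor (op_cat E) C G" and A: "A \<in> Obj E" and T: "T \<in> Obj C"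
    and a: "a \<in> Hom C (FO G A) T"
  shows "is_wcocone E C G (hom_fctr E A) T (\<lambda>B h. Comp C (FO G B) (FO G A) T a (FM G B A h))"
  unfolding is_wcocone_def
proof (intro conjI ballI)
  have C: "category E" using E by (simp add: locally_small_def)
  note Go = functor_obj[OF G, simplified] and Gh = functor_hom[OF G, simplified]
  show "Comp C (FO G B) (FO G A) T a (FM G B A h) \<in> Hom C (FO G B) T"
    if "B \<in> Obj E" "h \<in> FO (hom_fctr E A) B" for B h
    using that A T a by (auto intro!: comp_in_Hom[OF functor_cod[OF G]] Go Gh)
  fix X Y f h
  assume h: "X \<in> Obj E" "Y \<in> Obj E" "f \<in> Hom E X Y" "h \<in> FO (hom_fctr E A) X"
  then show "Comp C (FO G Y) (FO G A) T a (FM G Y A (FM (hom_fctr E A) X Y f h)) =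
      Comp C (FO G Y) (FO G X) T (Comp C (FO G X) (FO G A) T a (FM G X A h)) (FM G Y X f)"
    using functor_comp[OF G, of Y X A f h] A T a
    by (simp add: comp_assoc[OF functor_cod[OF G]] Go Gh)
qed

lemma wcolimD:
  assumes "is_wcolim E C G M L \<kappa>"
  shows wcolim_obj: "L \<in> Obj C" and wcolim_wcocone: "is_wcocone E C G M L \<kappa>"
  using assms by (simp_all add: is_wcolim_def)

lemma wcolim_ex1:
  "\<lbrakk>is_wcolim E C G M L \<kappa>; T \<in> Obj C; is_wcocone E C G M T \<phi>\<rbrakk> \<Longrightarrow>
    \<exists>!u. u \<in> Hom C L T \<and> (\<forall>A\<in>Obj E. \<forall>x\<in>FO M A. Comp C (FO G A) L T u (\<kappa> A x) = \<phi> A x)"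
  by (simp add: is_wcolim_def)

lemma wcolim_arrow_eqI:
  assumes G: "is_functor (op_cat E) C G" and M: "is_functor E Set_cat M"
    and L: "is_wcolim E C G M L \<kappa>" and T: "T \<in> Obj C"
    and u: "u \<in> Hom C L T" and v: "v \<in> Hom C L T"
    and eq: "\<And>A x. \<lbrakk>A \<in> Obj E; x \<in> FO M A\<rbrakk> \<Longrightarrow>
      Comp C (FO G A) L T u (\<kappa> A x) = Comp C (FO G A) L T v (\<kappa> A x)"
  shows "u = v"
  using wcolim_ex1[OF L T wcocone_postcomp[OF G M wcolim_wcocone[OF L] u wcolim_obj[OF L] T]]
    u v eq by (metis (no_types, lifting))

text \<open>The hom-sets of \<open>C\<close> are sets over an arbitrary type. To become values of a set-valued functor
  they have to be moved into the universe.\<close>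

definition enc :: "('c, 'p) cat \<Rightarrow> 'c \<Rightarrow> 'c \<Rightarrow> 'p \<Rightarrow> 'u" where
  "enc C X T = (SOME e. inj_on e (Hom C X T))"

lemma inj_on_enc:
  fixes C :: "('c, 'p) cat"
  assumes "locally_small TYPE('u) C" "X \<in> Obj C" "T \<in> Obj C"
  shows "inj_on (enc C X T :: 'p \<Rightarrow> 'u) (Hom C X T)"
proof -
  have "Hom C X T \<lesssim> (UNIV :: 'u set)"
    using assms by (auto simp: locally_small_def small_def intro: lesspoll_imp_lepoll)
  then have "\<exists>e :: 'p \<Rightarrow> 'u. inj_on e (Hom C X T)"
    by (auto simp: lepoll_def)
  then show ?thesis unfolding enc_def by (rule someI_ex)
qed

text \<open>The functor \<open>A \<mapsto> Hom (G A, T)\<close>. The arrows from \<open>M\<close> into it are the weighted cocones on \<open>M\<close>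
  with vertex \<open>T\<close>.\<close>

definition hom_into ::
  "('e, 'u) cat \<Rightarrow> ('c, 'p) cat \<Rightarrow> ('e, 'u, 'c, 'p) fctr \<Rightarrow> 'c \<Rightarrow> ('e, 'u, 'u set, 'u \<Rightarrow> 'u) fctr"
  where
  "hom_into E C G T = restrict_fctr E
     \<lparr> FO = (\<lambda>A. enc C (FO G A) T ` Hom C (FO G A) T),
       FM = (\<lambda>A B f. \<lambda>y\<in>enc C (FO G A) T ` Hom C (FO G A) T.
         enc C (FO G B) T (Comp C (FO G B) (FO G A) T
           (inv_into (Hom C (FO G A) T) (enc C (FO G A) T) y) (FM G B A f))) \<rparr>"

lemma FO_hom_into [simp]:
  "A \<in> Obj E \<Longrightarrow> FO (hom_into E C G T) A = enc C (FO G A) T ` Hom C (FO G A) T"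
  by (simp add: hom_into_def)

lemma FM_hom_into:
  assumes "locally_small TYPE('u) C" "is_functor (op_cat (E :: ('e, 'u) cat)) C G" "T \<in> Obj C"
    and "A \<in> Obj E" "B \<in> Obj E" "f \<in> Hom E A B" "a \<in> Hom C (FO G A) T"
  shows "FM (hom_into E C G T) A B f (enc C (FO G A) T a) =
    enc C (FO G B) T (Comp C (FO G B) (FO G A) T a (FM G B A f))"
  using assms inj_on_enc[OF assms(1) functor_obj[OF assms(2), of A] assms(3)]
  by (simp add: hom_into_def inv_into_f_f)

lemma is_functor_hom_into:
  fixes E :: "('e, 'u) cat" and C :: "('c, 'p) cat"
  assumes C: "locally_small TYPE('u) C" and G: "is_functor (op_cat E) C G"
    and T: "T \<in> Obj C" and E: "category E"
  shows "is_functor E Set_cat (hom_into E C G T)"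
proof -
  note Go = functor_obj[OF G, simplified] and Gh = functor_hom[OF G, simplified]
    and CC = functor_cod[OF G]
  have dec [simp]: "inv_into (Hom C (FO G A) T) (enc C (FO G A) T :: 'p \<Rightarrow> 'u) (enc C (FO G A) T a) = a"
    if "A \<in> Obj E" "a \<in> Hom C (FO G A) T" for A a
    using that inj_on_enc[OF C Go T, of A] by (simp add: inv_into_f_f)
  show ?thesis
    unfolding hom_into_def
  proof (rule is_set_functorI[OF E])
    fix A assume A: "A \<in> Obj E"
    have "enc C (FO G A) T ` Hom C (FO G A) T \<lesssim> Hom C (FO G A) T"
      by (rule image_lepoll)
    moreover have "Hom C (FO G A) T \<prec> (UNIV :: 'u set)"
      using C Go[OF A] T by (simp add: locally_small_def small_def)
    ultimately show "small TYPE('u) (enc C (FO G A) T ` Hom C (FO G A) T)"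
      unfolding small_def by (rule lesspoll_trans1)
  next
    fix A and x :: 'u assume h: "A \<in> Obj E" "x \<in> enc C (FO G A) T ` Hom C (FO G A) T"
    then show "enc C (FO G A) T (Comp C (FO G A) (FO G A) T
        (inv_into (Hom C (FO G A) T) (enc C (FO G A) T) x) (FM G A A (Id E A))) = x"
      using functor_id[OF G, of A] by (auto simp: comp_id_right[OF CC] Go T)
  next
    fix A B D f g and x :: 'u
    assume h: "A \<in> Obj E" "B \<in> Obj E" "D \<in> Obj E" "f \<in> Hom E A B" "g \<in> Hom E B D"
      "x \<in> enc C (FO G A) T ` Hom C (FO G A) T"
    then obtain a where a: "a \<in> Hom C (FO G A) T" "x = enc C (FO G A) T a" by auto
    have "Comp C (FO G B) (FO G A) T a (FM G B A f) \<in> Hom C (FO G B) T"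
      using h a by (auto intro!: comp_in_Hom[OF CC] Go Gh T)
    then show "enc C (FO G D) T (Comp C (FO G D) (FO G A) T
          (inv_into (Hom C (FO G A) T) (enc C (FO G A) T) x) (FM G D A (Comp E A B D g f))) =
        enc C (FO G D) T (Comp C (FO G D) (FO G B) T
          (inv_into (Hom C (FO G B) T) (enc C (FO G B) T)
            (enc C (FO G B) T (Comp C (FO G B) (FO G A) T
              (inv_into (Hom C (FO G A) T) (enc C (FO G A) T) x) (FM G B A f)) :: 'u)) (FM G D B g))"
      using h a functor_comp[OF G, of D B A g f] by (simp add: comp_assoc[OF CC] Go Gh T)
  qed (auto intro!: imageI comp_in_Hom[OF CC] Go Gh T)
qed

lemma hom_into_wcocone:
  fixes E :: "('e, 'u) cat" and C :: "('c, 'p) cat"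
  assumes C: "locally_small TYPE('u) C" and G: "is_functor (op_cat E) C G"
    and T: "T \<in> Obj C" and M: "is_functor E Set_cat M" and \<phi>: "is_wcocone E C G M T \<phi>"
  shows "is_nat_trans E Set_cat M (hom_into E C G T) (\<lambda>A\<in>Obj E. \<lambda>x\<in>FO M A. enc C (FO G A) T (\<phi> A x))"
  by (rule is_set_nat_transI[OF M])
    (simp_all add: wcocone_in_Hom[OF \<phi>] FM_hom_into[OF C G T] wcocone_natural[OF \<phi>])

lemma wcocone_hom_into:
  fixes E :: "('e, 'u) cat" and C :: "('c, 'p) cat"
  assumes C: "locally_small TYPE('u) C" and G: "is_functor (op_cat E) C G"
    and T: "T \<in> Obj C" and M: "is_functor E Set_cat M"
    and m: "is_nat_trans E Set_cat M (hom_into E C G T) m"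
  shows "\<exists>\<phi>. is_wcocone E C G M T \<phi> \<and> (\<forall>A\<in>Obj E. \<forall>x\<in>FO M A. m A x = enc C (FO G A) T (\<phi> A x))"
proof -
  have "\<exists>a. a \<in> Hom C (FO G A) T \<and> m A x = enc C (FO G A) T a" if "A \<in> Obj E" "x \<in> FO M A" for A x
    using set_nat_trans_apply[OF m that] that by auto
  then obtain \<phi> where \<phi>: "\<And>A x. \<lbrakk>A \<in> Obj E; x \<in> FO M A\<rbrakk> \<Longrightarrow>
      \<phi> A x \<in> Hom C (FO G A) T \<and> m A x = enc C (FO G A) T (\<phi> A x)"
    by metis
  have "is_wcocone E C G M T \<phi>"
    unfolding is_wcocone_def
  proof (intro conjI ballI)
    fix A B f x assume h: "A \<in> Obj E" "B \<in> Obj E" "f \<in> Hom E A B" "x \<in> FO M A"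
    note Mx = set_fctr_apply[OF M h]
    note Go = functor_obj[OF G, simplified]
    have co: "Comp C (FO G B) (FO G A) T (\<phi> A x) (FM G B A f) \<in> Hom C (FO G B) T"
      using h \<phi> by (auto intro!: comp_in_Hom[OF functor_cod[OF G]] Go T functor_hom[OF G])
    have "enc C (FO G B) T (\<phi> B (FM M A B f x)) =
        (enc C (FO G B) T (Comp C (FO G B) (FO G A) T (\<phi> A x) (FM G B A f)) :: 'u)"
      using set_nat_trans_natural[OF m M h] h \<phi> Mx by (simp add: FM_hom_into[OF C G T])
    then show "\<phi> B (FM M A B f x) = Comp C (FO G B) (FO G A) T (\<phi> A x) (FM G B A f)"
      using inj_on_enc[OF C Go[OF h(2)] T] \<phi>[OF h(2) Mx] co by (metis inj_onD)
  qed (use \<phi> in simp)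
  with \<phi> show ?thesis by blast
qed

section \<open>Models of a realized sketch\<close>

lemma Mod_simps [simp]:
  "M \<in> Obj (Mod E S) \<longleftrightarrow> is_functor E Set_cat M \<and> (\<forall>c\<in>S. is_limit Set_cat (map_cone M c))"
  "Hom (Mod E S) M N = {m. is_nat_trans E Set_cat M N m}"
  "Id (Mod E S) = Id (fctr_cat E Set_cat)" "Comp (Mod E S) = Comp (fctr_cat E Set_cat)"
  by (auto simp: Mod_def limit_models_def)

lemma category_Mod: "category (Mod E S)"
  unfolding Mod_def limit_models_def by (intro category_full_subcat category_fctr_cat)

lemma Comp_Mod_apply:
  "\<lbrakk>A \<in> Obj E; x \<in> FO M A\<rbrakk> \<Longrightarrow> Comp (Mod E S) M N P n m A x = n A (m A x)"
  by (simp add: compose_def)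

lemma Id_Mod_apply: "\<lbrakk>A \<in> Obj E; x \<in> FO M A\<rbrakk> \<Longrightarrow> Id (Mod E S) M A x = x"
  by simp

lemma colimit_models_simps [simp]:
  "G \<in> Obj (colimit_models E T C) \<longleftrightarrow> is_functor E C G \<and> (\<forall>c\<in>T. is_colimit C (map_cocone G c))"
  "Hom (colimit_models E T C) F G = {\<eta>. is_nat_trans E C F G \<eta>}"
  "Id (colimit_models E T C) = Id (fctr_cat E C)" "Comp (colimit_models E T C) = Comp (fctr_cat E C)"
  by (auto simp: colimit_models_def)

lemma category_colimit_models: "category (colimit_models E T C)"
  unfolding colimit_models_def by (intro category_full_subcat category_fctr_cat)

text \<open>Let \<open>L\<close> be the apex and \<open>D\<close> the diagram of a distinguished cone. A compatible family in the sets
  \<open>Hom (G (D i), T)\<close> is a cocone with vertex \<open>T\<close> on the objects \<open>G (D i)\<close>. Since \<open>G\<close> turns the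
  distinguished cone into a colimit cocone, it is the same thing as an arrow \<open>G L \<rightarrow> T\<close>.\<close>

lemma hom_into_model:
  fixes E :: "('e, 'u) cat" and S :: "('u, 'e, 'u) cone set" and C :: "('c, 'p) cat"
  assumes S: "limit_sketch E S" and C: "locally_small TYPE('u) C"
    and G: "G \<in> Obj (colimit_models (op_cat E) (op_cone ` S) C)" and T: "T \<in> Obj C"
  shows "hom_into E C G T \<in> Obj (Mod E S)"
proof -
  have Gf: "is_functor (op_cat E) C G" using G by simp
  note Go = functor_obj[OF Gf, simplified] and Gh = functor_hom[OF Gf, simplified]
    and CC = functor_cod[OF Gf]
  have H: "is_functor E Set_cat (hom_into E C G T)"
    using S by (intro is_functor_hom_into[OF C Gf T]) (simp add: limit_sketch_def locally_small_def)
  have "is_limit Set_cat (map_cone (hom_into E C G T) c)" if c: "c \<in> S" for c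
  proof (rule is_limit_SetI)
    have cone: "is_cone E c" using S c by (simp add: limit_sketch_def)
    note D = cone_diagram[OF cone]
    note Do = functor_obj[OF D] and Dh = functor_hom[OF D] and L = cone_apex[OF cone]
      and leg = cone_leg[OF cone]
    show "is_cone Set_cat (map_cone (hom_into E C G T) c)"
      by (rule is_cone_map_cone[OF cone H])
    fix y
    assume "\<And>i. i \<in> Obj (index (map_cone (hom_into E C G T) c)) \<Longrightarrow>
        y i \<in> FO (diagram (map_cone (hom_into E C G T) c)) i"
      and "\<And>i j f. \<lbrakk>i \<in> Obj (index (map_cone (hom_into E C G T) c));
        j \<in> Obj (index (map_cone (hom_into E C G T) c));
        f \<in> Hom (index (map_cone (hom_into E C G T) c)) i j\<rbrakk> \<Longrightarrow>
        FM (diagram (map_cone (hom_into E C G T) c)) i j f (y i) = y j"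
    then have y: "\<And>i. i \<in> Obj (index c) \<Longrightarrow>
        y i \<in> enc C (FO G (FO (diagram c) i)) T ` Hom C (FO G (FO (diagram c) i)) T"
      and yy: "\<And>i j f. \<lbrakk>i \<in> Obj (index c); j \<in> Obj (index c); f \<in> Hom (index c) i j\<rbrakk> \<Longrightarrow>
        FM (hom_into E C G T) (FO (diagram c) i) (FO (diagram c) j) (FM (diagram c) i j f) (y i) = y j"
      by (simp_all add: Do)
    have "\<exists>a. a \<in> Hom C (FO G (FO (diagram c) i)) T \<and> y i = enc C (FO G (FO (diagram c) i)) T a"
      if "i \<in> Obj (index c)" for i using y[OF that] by auto
    then obtain a where a: "\<And>i. i \<in> Obj (index c) \<Longrightarrow> a i \<in> Hom C (FO G (FO (diagram c) i)) T"
      and ya: "\<And>i. i \<in> Obj (index c) \<Longrightarrow> y i = enc C (FO G (FO (diagram c) i)) T (a i)"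
      by metis
    have inj: "inj_on (enc C (FO G A) T :: 'p \<Rightarrow> 'u) (Hom C (FO G A) T)" if "A \<in> Obj E" for A
      by (rule inj_on_enc[OF C Go[OF that] T])
    have compat: "Comp C (FO G (FO (diagram c) j)) (FO G (FO (diagram c) i)) T (a i)
        (FM G (FO (diagram c) j) (FO (diagram c) i) (FM (diagram c) i j f)) = a j"
      if h: "i \<in> Obj (index c)" "j \<in> Obj (index c)" "f \<in> Hom (index c) i j" for i j f
    proof (rule inj_onD[OF inj[OF Do[OF h(2)]]])
      show "enc C (FO G (FO (diagram c) j)) T
          (Comp C (FO G (FO (diagram c) j)) (FO G (FO (diagram c) i)) T (a i)
            (FM G (FO (diagram c) j) (FO (diagram c) i) (FM (diagram c) i j f))) =
          (enc C (FO G (FO (diagram c) j)) T (a j) :: 'u)"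
        using yy[OF h] h by (simp add: ya FM_hom_into[OF C Gf T] Do Dh a)
    qed (use h in \<open>auto intro!: comp_in_Hom[OF CC] Go Gh Do Dh T a\<close>)
    have "is_colimit C (map_cocone G (op_cone c))" using G c by auto
    from colimit_ex1[OF this T, of a]
    have ex: "\<exists>!u. u \<in> Hom C (FO G (apex c)) T \<and> (\<forall>i\<in>Obj (index c).
        Comp C (FO G (FO (diagram c) i)) (FO G (apex c)) T u
          (FM G (FO (diagram c) i) (apex c) (leg c i)) = a i)"
      by (simp add: a compat cong: ball_cong)
    have leg_enc: "FM (hom_into E C G T) (apex c) (FO (diagram c) i) (leg c i)
          (enc C (FO G (apex c)) T u) = y i \<longleftrightarrow>
        Comp C (FO G (FO (diagram c) i)) (FO G (apex c)) T u
          (FM G (FO (diagram c) i) (apex c) (leg c i)) = a i"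
      if "i \<in> Obj (index c)" "u \<in> Hom C (FO G (apex c)) T" for i u
    proof -
      have "Comp C (FO G (FO (diagram c) i)) (FO G (apex c)) T u
          (FM G (FO (diagram c) i) (apex c) (leg c i)) \<in> Hom C (FO G (FO (diagram c) i)) T"
        using that by (auto intro!: comp_in_Hom[OF CC] Go Gh Do L leg T)
      then show ?thesis
        using that inj[OF Do[OF that(1)]]
        by (simp add: FM_hom_into[OF C Gf T] Do L leg ya a inj_on_eq_iff)
    qed
    from ex obtain u where u: "u \<in> Hom C (FO G (apex c)) T"
        "\<And>i. i \<in> Obj (index c) \<Longrightarrow> Comp C (FO G (FO (diagram c) i)) (FO G (apex c)) T u
          (FM G (FO (diagram c) i) (apex c) (leg c i)) = a i"
      and uu: "\<And>v. \<lbrakk>v \<in> Hom C (FO G (apex c)) T;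
        \<forall>i\<in>Obj (index c). Comp C (FO G (FO (diagram c) i)) (FO G (apex c)) T v
          (FM G (FO (diagram c) i) (apex c) (leg c i)) = a i\<rbrakk> \<Longrightarrow> v = u"
      by (auto simp: Ex1_def)
    have "\<exists>!b. b \<in> enc C (FO G (apex c)) T ` Hom C (FO G (apex c)) T \<and> (\<forall>i\<in>Obj (index c).
        FM (hom_into E C G T) (apex c) (FO (diagram c) i) (leg c i) b = y i)"
    proof (rule ex1I[of _ "enc C (FO G (apex c)) T u"])
      fix b assume b: "b \<in> enc C (FO G (apex c)) T ` Hom C (FO G (apex c)) T \<and>
        (\<forall>i\<in>Obj (index c). FM (hom_into E C G T) (apex c) (FO (diagram c) i) (leg c i) b = y i)"
      then obtain v where v: "v \<in> Hom C (FO G (apex c)) T" "b = enc C (FO G (apex c)) T v" by auto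
      with b have "v = u" by (intro uu) (simp_all add: leg_enc)
      with v show "b = enc C (FO G (apex c)) T u" by simp
    qed (use u in \<open>simp add: leg_enc\<close>)
    then show "\<exists>!b. b \<in> apex (map_cone (hom_into E C G T) c) \<and>
        (\<forall>i\<in>Obj (index (map_cone (hom_into E C G T) c)). leg (map_cone (hom_into E C G T) c) i b = y i)"
      by (simp add: L)
  qed
  with H show ?thesis by simp
qed

text \<open>A colimit of models need not be computed pointwise, so its elements need not come
  from the diagram. But a weighted cocone on \<open>M\<close> with vertex \<open>T\<close> is an arrow from \<open>M\<close> into
  \<open>Hom (G -, T)\<close>, and as this is a model, the universal property of the colimit inside the category
  of models applies. Here this gives existence; \<open>wcocone_eqI\<close> is the corresponding uniqueness.\<close>

lemma glue_wcocones:
  fixes E :: "('e, 'u) cat" and S :: "('u, 'e, 'u) cone set" and C :: "('c, 'p) cat"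
  assumes S: "limit_sketch E S" and C: "locally_small TYPE('u) C"
    and G: "G \<in> Obj (colimit_models (op_cat E) (op_cone ` S) C)" and T: "T \<in> Obj C"
    and c: "is_colimit (Mod E S) (c :: ('i, ('e, 'u, 'u set, 'u \<Rightarrow> 'u) fctr, 'e \<Rightarrow> 'u \<Rightarrow> 'u) cone)"
    and \<phi>: "\<And>i. i \<in> Obj (index c) \<Longrightarrow> is_wcocone E C G (FO (diagram c) i) T (\<phi> i)"
    and compat: "\<And>i j f A x. \<lbrakk>i \<in> Obj (index c); j \<in> Obj (index c); f \<in> Hom (index c) i j;
      A \<in> Obj E; x \<in> FO (FO (diagram c) i) A\<rbrakk> \<Longrightarrow> \<phi> j A (FM (diagram c) i j f A x) = \<phi> i A x"
  shows "\<exists>\<psi>. is_wcocone E C G (apex c) T \<psi> \<and>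
    (\<forall>i\<in>Obj (index c). \<forall>A\<in>Obj E. \<forall>x\<in>FO (FO (diagram c) i) A. \<psi> A (leg c i A x) = \<phi> i A x)"
proof -
  have Gf: "is_functor (op_cat E) C G" using G by simp
  note H = hom_into_model[OF S C G T] and k = colimit_cocone[OF c]
  have Hf: "is_functor E Set_cat (hom_into E C G T)" using H by simp
  note D = functor_obj[OF cocone_diagram[OF k], simplified, THEN conjunct1]
    and Dh = functor_hom[OF cocone_diagram[OF k], simplified]
    and leg = cocone_leg[OF k, simplified] and M = cocone_apex[OF k, simplified, THEN conjunct1]
  define \<mu> :: "'i \<Rightarrow> 'e \<Rightarrow> 'u \<Rightarrow> 'u" where
    "\<mu> i = (\<lambda>A\<in>Obj E. \<lambda>x\<in>FO (FO (diagram c) i) A. enc C (FO G A) T (\<phi> i A x))" for i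
  have \<mu>: "is_nat_trans E Set_cat (FO (diagram c) i) (hom_into E C G T) (\<mu> i)"
    if "i \<in> Obj (index c)" for i
    unfolding \<mu>_def by (rule hom_into_wcocone[OF C Gf T D[OF that] \<phi>[OF that]])
  have "\<exists>!u. u \<in> Hom (Mod E S) (apex c) (hom_into E C G T) \<and> (\<forall>i\<in>Obj (index c).
      Comp (Mod E S) (FO (diagram c) i) (apex c) (hom_into E C G T) u (leg c i) = \<mu> i)"
  proof (rule colimit_ex1[OF c H])
    fix i j f assume h: "i \<in> Obj (index c)" "j \<in> Obj (index c)" "f \<in> Hom (index c) i j"
    have "is_nat_trans E Set_cat (FO (diagram c) i) (hom_into E C G T)
        (Comp (Mod E S) (FO (diagram c) i) (FO (diagram c) j) (hom_into E C G T) (\<mu> j) (FM (diagram c) i j f))"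
      using is_nat_trans_comp[OF D[OF h(1)] D[OF h(2)] Hf Dh[OF h] \<mu>[OF h(2)]] by simp
    then show "Comp (Mod E S) (FO (diagram c) i) (FO (diagram c) j) (hom_into E C G T)
        (\<mu> j) (FM (diagram c) i j f) = \<mu> i"
    proof (rule set_nat_trans_eqI[OF _ \<mu>[OF h(1)]])
      fix A x assume Ax: "A \<in> Obj E" "x \<in> FO (FO (diagram c) i) A"
      then show "Comp (Mod E S) (FO (diagram c) i) (FO (diagram c) j) (hom_into E C G T)
          (\<mu> j) (FM (diagram c) i j f) A x = \<mu> i A x"
        using compat[OF h Ax] set_nat_trans_apply[OF Dh[OF h] Ax]
        by (simp add: Comp_Mod_apply \<mu>_def del: Mod_simps)
    qed
  qed (simp add: \<mu>)
  then obtain u where u: "is_nat_trans E Set_cat (apex c) (hom_into E C G T) u"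
    and u\<mu>: "\<And>i. i \<in> Obj (index c) \<Longrightarrow>
      Comp (Mod E S) (FO (diagram c) i) (apex c) (hom_into E C G T) u (leg c i) = \<mu> i"
    by auto
  obtain \<psi> where \<psi>: "is_wcocone E C G (apex c) T \<psi>"
    and u\<psi>: "\<forall>A\<in>Obj E. \<forall>x\<in>FO (apex c) A. u A x = enc C (FO G A) T (\<psi> A x)"
    using wcocone_hom_into[OF C Gf T M u] by auto
  have "\<psi> A (leg c i A x) = \<phi> i A x"
    if h: "i \<in> Obj (index c)" "A \<in> Obj E" "x \<in> FO (FO (diagram c) i) A" for i A x
  proof (rule inj_onD[OF inj_on_enc[OF C functor_obj[OF Gf] T]])
    have lx: "leg c i A x \<in> FO (apex c) A" using set_nat_trans_apply[OF leg] h by blast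
    show "enc C (FO G A) T (\<psi> A (leg c i A x)) = (enc C (FO G A) T (\<phi> i A x) :: 'u)"
      using fun_cong[OF fun_cong[OF u\<mu>[OF h(1)], of A], of x] h lx u\<psi>
      by (simp add: Comp_Mod_apply \<mu>_def del: Mod_simps)
    show "\<psi> A (leg c i A x) \<in> Hom C (FO G A) T" "\<phi> i A x \<in> Hom C (FO G A) T"
      using h lx wcocone_in_Hom[OF \<psi>] wcocone_in_Hom[OF \<phi>] by blast+
  qed (use h in simp)
  with \<psi> show ?thesis by blast
qed

lemma wcocone_eqI:
  fixes E :: "('e, 'u) cat" and S :: "('u, 'e, 'u) cone set" and C :: "('c, 'p) cat"
  assumes S: "limit_sketch E S" and C: "locally_small TYPE('u) C"
    and G: "G \<in> Obj (colimit_models (op_cat E) (op_cone ` S) C)" and T: "T \<in> Obj C"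
    and c: "is_colimit (Mod E S) c"
    and \<phi>: "is_wcocone E C G (apex c) T \<phi>" and \<psi>: "is_wcocone E C G (apex c) T \<psi>"
    and eq: "\<And>i A x. \<lbrakk>i \<in> Obj (index c); A \<in> Obj E; x \<in> FO (FO (diagram c) i) A\<rbrakk> \<Longrightarrow>
      \<phi> A (leg c i A x) = \<psi> A (leg c i A x)"
    and A: "A \<in> Obj E" "x \<in> FO (apex c) A"
  shows "\<phi> A x = \<psi> A x"
proof -
  have Gf: "is_functor (op_cat E) C G" using G by simp
  note H = hom_into_model[OF S C G T] and k = colimit_cocone[OF c]
  have Hf: "is_functor E Set_cat (hom_into E C G T)" using H by simp
  note D = functor_obj[OF cocone_diagram[OF k], simplified, THEN conjunct1]
    and leg = cocone_leg[OF k, simplified] and M = cocone_apex[OF k, simplified, THEN conjunct1]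
  define arr :: "('e \<Rightarrow> 'u \<Rightarrow> 'p) \<Rightarrow> 'e \<Rightarrow> 'u \<Rightarrow> 'u" where
    "arr \<phi> = (\<lambda>A\<in>Obj E. \<lambda>x\<in>FO (apex c) A. enc C (FO G A) T (\<phi> A x))" for \<phi>
  have arr: "is_nat_trans E Set_cat (apex c) (hom_into E C G T) (arr \<phi>)"
    if "is_wcocone E C G (apex c) T \<phi>" for \<phi>
    unfolding arr_def by (rule hom_into_wcocone[OF C Gf T M that])
  have "arr \<phi> = arr \<psi>"
  proof (rule colimit_arrow_eqI[OF c category_Mod H])
    fix i assume i: "i \<in> Obj (index c)"
    note co = is_nat_trans_comp[OF D[OF i] M Hf leg[OF i] arr]
    show "Comp (Mod E S) (FO (diagram c) i) (apex c) (hom_into E C G T) (arr \<phi>) (leg c i) =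
      Comp (Mod E S) (FO (diagram c) i) (apex c) (hom_into E C G T) (arr \<psi>) (leg c i)"
    proof (rule set_nat_trans_eqI)
      show "is_nat_trans E Set_cat (FO (diagram c) i) (hom_into E C G T)
        (Comp (Mod E S) (FO (diagram c) i) (apex c) (hom_into E C G T) (arr \<phi>) (leg c i))"
        using co[OF \<phi>] by simp
      show "is_nat_trans E Set_cat (FO (diagram c) i) (hom_into E C G T)
        (Comp (Mod E S) (FO (diagram c) i) (apex c) (hom_into E C G T) (arr \<psi>) (leg c i))"
        using co[OF \<psi>] by simp
      fix B y assume By: "B \<in> Obj E" "y \<in> FO (FO (diagram c) i) B"
      then show "Comp (Mod E S) (FO (diagram c) i) (apex c) (hom_into E C G T) (arr \<phi>) (leg c i) B y =
          Comp (Mod E S) (FO (diagram c) i) (apex c) (hom_into E C G T) (arr \<psi>) (leg c i) B y"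
        using eq[OF i By] set_nat_trans_apply[OF leg[OF i] By]
        by (simp add: Comp_Mod_apply arr_def del: Mod_simps)
    qed
  qed (simp_all add: arr \<phi> \<psi>)
  then have "arr \<phi> A x = arr \<psi> A x" by simp
  then have "enc C (FO G A) T (\<phi> A x) = (enc C (FO G A) T (\<psi> A x) :: 'u)"
    using A by (simp add: arr_def)
  then show ?thesis
    using inj_onD[OF inj_on_enc[OF C functor_obj[OF Gf] T]] wcocone_in_Hom[OF \<phi> A]
      wcocone_in_Hom[OF \<psi> A] A by (metis op_cat_simps(1))
qed

section \<open>Smallness of sets of families\<close>

text \<open>A family is determined by its graph, which is a subset of a small disjoint union.\<close>

lemma small_PiE:
  fixes I :: "'u set" and X :: "'u \<Rightarrow> 'u set"
  assumes U: "small_universe TYPE('u)" and I: "small TYPE('u) I"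
    and X: "\<And>i. i \<in> I \<Longrightarrow> small TYPE('u) (X i)"
  shows "small TYPE('u) (Pi\<^sub>E I X)"
proof -
  have "infinite (UNIV :: 'u set)" using U by (simp add: small_universe_def)
  then obtain p :: "'u \<times> 'u \<Rightarrow> 'u" where p: "inj p"
    using iffD2[OF card_of_ordIso card_of_Times_same_infinite, of "UNIV :: 'u set"]
    by (auto simp: bij_betw_def)
  define P where "P = (\<Union>i\<in>I. (\<lambda>x. p (i, x)) ` X i)"
  have "small TYPE('u) ((\<lambda>x. p (i, x)) ` X i)" if "i \<in> I" for i
    using X[OF that] unfolding small_def by (rule lesspoll_trans1[OF image_lepoll])
  then have "small TYPE('u) P"
    unfolding P_def using U I by (simp add: small_universe_def)
  then have Pow: "small TYPE('u) (Pow P)"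
    using U by (simp add: small_universe_def)
  \<comment> \<open>the graph of \<open>h\<close>, with pairs coded by \<open>p\<close> as elements of the universe\<close>
  have "inj_on (\<lambda>h. (\<lambda>i. p (i, h i)) ` I) (Pi\<^sub>E I X)"
  proof (rule inj_onI)
    fix h k assume hk: "h \<in> Pi\<^sub>E I X" "k \<in> Pi\<^sub>E I X" and eq: "(\<lambda>i. p (i, h i)) ` I = (\<lambda>i. p (i, k i)) ` I"
    show "h = k"
    proof (rule PiE_ext[OF hk])
      fix i assume "i \<in> I"
      then obtain j where "p (i, h i) = p (j, k j)" using eq by blast
      then show "h i = k i" using p by (auto dest: injD)
    qed
  qed
  moreover have "(\<lambda>h. (\<lambda>i. p (i, h i)) ` I) ` Pi\<^sub>E I X \<subseteq> Pow P"
    by (auto simp: P_def)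
  ultimately have "Pi\<^sub>E I X \<lesssim> Pow P" by (auto simp: lepoll_def)
  then show ?thesis using Pow unfolding small_def by (rule lesspoll_trans1)
qed

lemma small_category_op_cat: "small_category U C \<Longrightarrow> small_category U (op_cat C)"
  by (simp add: small_category_def locally_small_def category_op_cat)

section \<open>Cocontinuous functors\<close>

lemma cocontinuousD:
  assumes "cocontinuous (U :: 'u itself) C D F"
  shows cocontinuous_functor: "is_functor C D F"
    and cocontinuous_colimit: "\<lbrakk>small_category U (index (c :: ('u, 'a, 'm) cone)); is_colimit C c\<rbrakk>
      \<Longrightarrow> is_colimit D (map_cocone F c)"
  using assms by (auto simp: cocontinuous_def)

lemma Hom_c_simps [simp]:
  "F \<in> Obj (Hom_c U A C) \<longleftrightarrow> cocontinuous U A C F"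
  "Hom (Hom_c U A C) F G = {\<eta>. is_nat_trans A C F G \<eta>}"
  "Id (Hom_c U A C) = Id (fctr_cat A C)" "Comp (Hom_c U A C) = Comp (fctr_cat A C)"
  by (auto simp: Hom_c_def cocontinuous_def)

lemma category_Hom_c: "category (Hom_c U A C)"
  unfolding Hom_c_def by (intro category_full_subcat category_fctr_cat)

lemma is_colimit_map_cocone_comp:
  assumes c: "is_cocone B c" and Y: "is_functor B D Y"
    and col: "is_colimit C (map_cocone F (map_cocone Y c))"
  shows "is_colimit C (map_cocone (comp_fctr B F Y) c)"
proof (rule is_colimit_cong[OF col])
  note D = cocone_diagram[OF c]
  show "diagram (map_cocone (comp_fctr B F Y) c) = diagram (map_cocone F (map_cocone Y c))"
    using comp_fctr_assoc[OF D] by simp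
qed (simp_all add: cocone_apex[OF c] cocone_leg[OF c] functor_obj[OF cocone_diagram[OF c]])

lemma cocontinuous_comp:
  assumes F: "cocontinuous U B C F" and H: "cocontinuous U C D H"
  shows "cocontinuous U B D (comp_fctr B H F)"
  unfolding cocontinuous_def
proof (intro conjI allI impI)
  show "is_functor B D (comp_fctr B H F)"
    by (rule is_functor_comp_fctr[OF cocontinuous_functor[OF F] cocontinuous_functor[OF H]])
  fix c :: "('a, 'b, 'c) cone"
  assume c: "small_category U (index c) \<and> is_colimit B c"
  then show "is_colimit D (map_cocone (comp_fctr B H F) c)"
    by (intro is_colimit_map_cocone_comp[OF colimit_cocone cocontinuous_functor[OF F]]
        cocontinuous_colimit[OF H] cocontinuous_colimit[OF F]) auto
qed

lemma colimit_models_comp: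
  fixes T :: "('u, 'a, 'm) cone set" and U :: "'u itself"
  assumes T: "\<And>c. c \<in> T \<Longrightarrow> small_category U (index c) \<and> is_cocone B c"
    and Y: "Y \<in> Obj (colimit_models B T D)" and F: "cocontinuous U D C F"
  shows "comp_fctr B F Y \<in> Obj (colimit_models B T C)"
proof -
  have Yf: "is_functor B D Y" using Y by simp
  have "is_colimit C (map_cocone (comp_fctr B F Y) c)" if c: "c \<in> T" for c
    using T[OF c] Y c
    by (intro is_colimit_map_cocone_comp[OF _ Yf] cocontinuous_colimit[OF F]) auto
  then show ?thesis
    using is_functor_comp_fctr[OF Yf cocontinuous_functor[OF F]] by simp
qed

section \<open>Presentations of models\<close>

locale small_model_sketch =
  fixes E :: "('e, 'u) cat" and S :: "('u, 'e, 'u) cone set"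
  assumes universe: "small_universe TYPE('u)"
    and sketch: "limit_sketch E S"
    and realized: "realized E S"
    and small_models: "\<forall>M\<in>Obj (Mod E S). small_model E S M"
begin

lemma locally_small_E: "locally_small TYPE('u) E"
  using sketch by (simp add: limit_sketch_def)

lemma category_E: "category E"
  using locally_small_E by (simp add: locally_small_def)

lemma hom_fctr_model: "A \<in> Obj E \<Longrightarrow> hom_fctr E A \<in> Obj (Mod E S)"
  using realized by (simp add: realized_def)

lemma is_functor_hom: "A \<in> Obj E \<Longrightarrow> is_functor E Set_cat (hom_fctr E A)"
  by (rule is_functor_hom_fctr[OF locally_small_E])

lemma element_arrow_Hom:
  "\<lbrakk>M \<in> Obj (Mod E S); A \<in> Obj E; x \<in> FO M A\<rbrakk>
    \<Longrightarrow> element_arrow E M A x \<in> Hom (Mod E S) (hom_fctr E A) M"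
  using is_nat_trans_element_arrow[OF locally_small_E] by simp

lemma comp_element_arrow:
  assumes M: "M \<in> Obj (Mod E S)" and N: "N \<in> Obj (Mod E S)" and m: "m \<in> Hom (Mod E S) M N"
    and A: "A \<in> Obj E" "x \<in> FO M A"
  shows "Comp (Mod E S) (hom_fctr E A) M N m (element_arrow E M A x) = element_arrow E N A (m A x)"
proof -
  have x: "m A x \<in> FO N A" using m A by (auto dest: set_nat_trans_apply)
  have "Comp (Mod E S) (hom_fctr E A) M N m (element_arrow E M A x) \<in> Hom (Mod E S) (hom_fctr E A) N"
    by (rule comp_in_Hom[OF category_Mod hom_fctr_model[OF A(1)] M N element_arrow_Hom[OF M A] m])
  moreover have "element_arrow E N A (m A x) \<in> Hom (Mod E S) (hom_fctr E A) N"
    by (rule element_arrow_Hom[OF N A(1) x])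
  moreover have Mf: "is_functor E Set_cat M" and Nf: "is_functor E Set_cat N" using M N by simp_all
  ultimately show ?thesis
    using A x by (intro nat_trans_hom_fctr_eqI[OF locally_small_E A(1)])
      (simp_all add: compose_def id_in_Hom[OF category_E] set_fctr_id[OF Mf] set_fctr_id[OF Nf])
qed

lemma comp_element_arrows:
  assumes M: "M \<in> Obj (Mod E S)" and h: "A \<in> Obj E" "B \<in> Obj E" "f \<in> Hom E A B" "x \<in> FO M A"
  shows "Comp (Mod E S) (hom_fctr E B) (hom_fctr E A) M (element_arrow E M A x)
      (element_arrow E (hom_fctr E A) B f) = element_arrow E M B (FM M A B f x)"
  using comp_element_arrow[OF hom_fctr_model[OF h(1)] M element_arrow_Hom[OF M h(1,4)] h(2), of f] h
  by simp

lemma is_functor_yoneda: "is_functor (op_cat E) (Mod E S) (yoneda E)"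
proof -
  have eq: "yoneda E = restrict_fctr (op_cat E)
      \<lparr> FO = hom_fctr E, FM = (\<lambda>A B f. element_arrow E (hom_fctr E B) A f) \<rparr>"
    by (subst yoneda_def, rule restrict_fctr_cong)
      (auto simp: element_arrow_def intro!: restrict_ext)
  show ?thesis
    unfolding eq
  proof (rule is_functor_restrictI[OF category_op_cat[OF category_E] category_Mod], simp_all only: fctr.simps op_cat_simps)
    show "hom_fctr E A \<in> Obj (Mod E S)" if "A \<in> Obj E" for A by (rule hom_fctr_model[OF that])
    show "element_arrow E (hom_fctr E B) A f \<in> Hom (Mod E S) (hom_fctr E A) (hom_fctr E B)"
      if "A \<in> Obj E" "B \<in> Obj E" "f \<in> Hom E B A" for A B f
      using that by (intro element_arrow_Hom hom_fctr_model) simp_all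
    show "element_arrow E (hom_fctr E A) A (Id E A) = Id (Mod E S) (hom_fctr E A)" if A: "A \<in> Obj E" for A
      using element_arrow_Hom[OF hom_fctr_model[OF A] A, of "Id E A"]
        id_in_Hom[OF category_Mod hom_fctr_model[OF A]] A
      by (intro nat_trans_hom_fctr_eqI[OF locally_small_E A])
        (simp_all add: id_in_Hom[OF category_E] comp_id_left[OF category_E])
    show "element_arrow E (hom_fctr E Z) X (Comp E Z Y X f g) =
        Comp (Mod E S) (hom_fctr E X) (hom_fctr E Y) (hom_fctr E Z)
          (element_arrow E (hom_fctr E Z) Y g) (element_arrow E (hom_fctr E Y) X f)"
      if h: "X \<in> Obj E" "Y \<in> Obj E" "Z \<in> Obj E" "f \<in> Hom E Y X" "g \<in> Hom E Z Y" for X Y Z f g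
      using comp_element_arrows[OF hom_fctr_model[OF h(3)] h(2,1,4), of g] h by simp
  qed
qed

text \<open>By the Yoneda lemma, a cocone from the representables at the objects \<open>D i\<close> to a model \<open>M\<close> is a
  compatible family of elements of the sets \<open>M (D i)\<close>. If \<open>D\<close> is the diagram of a distinguished cone
  with apex \<open>L\<close>, such a family is an element of \<open>M L\<close>, because \<open>M\<close> is a model, and hence an arrow
  from the representable at \<open>L\<close> to \<open>M\<close>.\<close>

lemma yoneda_model: "yoneda E \<in> Obj (colimit_models (op_cat E) (op_cone ` S) (Mod E S))"
proof -
  note Y = is_functor_yoneda
  have inf: "infinite (UNIV :: 'u set)" using universe by (simp add: small_universe_def)
  have "is_colimit (Mod E S) (map_cocone (yoneda E) (op_cone c))" if c: "c \<in> S" for c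
  proof (rule is_colimitI)
    have cone: "is_cone E c" using sketch c by (simp add: limit_sketch_def)
    note D = cone_diagram[OF cone]
    note Do [simp] = functor_obj[OF D] and Dh [simp] = functor_hom[OF D] and L [simp] = cone_apex[OF cone]
      and leg [simp] = cone_leg[OF cone]
    let ?c = "map_cocone (yoneda E) (op_cone c)"
    show "is_cocone (Mod E S) ?c"
      by (rule is_cocone_map_cocone[OF is_cocone_op_cone[OF cone] Y])
    fix M \<mu>
    assume M: "M \<in> Obj (Mod E S)"
      and "\<And>i. i \<in> Obj (index ?c) \<Longrightarrow> \<mu> i \<in> Hom (Mod E S) (FO (diagram ?c) i) M"
      and "\<And>i j f. \<lbrakk>i \<in> Obj (index ?c); j \<in> Obj (index ?c); f \<in> Hom (index ?c) i j\<rbrakk> \<Longrightarrow>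
        Comp (Mod E S) (FO (diagram ?c) i) (FO (diagram ?c) j) M (\<mu> j) (FM (diagram ?c) i j f) = \<mu> i"
    then have \<mu>: "is_nat_trans E Set_cat (hom_fctr E (FO (diagram c) i)) M (\<mu> i)"
      if "i \<in> Obj (index c)" for i
      using that by simp
    have \<mu>\<mu>: "Comp (Mod E S) (hom_fctr E (FO (diagram c) j)) (hom_fctr E (FO (diagram c) i)) M (\<mu> i)
        (element_arrow E (hom_fctr E (FO (diagram c) i)) (FO (diagram c) j) (FM (diagram c) i j f)) = \<mu> j"
      if h: "i \<in> Obj (index c)" "j \<in> Obj (index c)" "f \<in> Hom (index c) i j" for i j f
      using \<open>\<And>i j f. \<lbrakk>i \<in> Obj (index ?c); j \<in> Obj (index ?c); f \<in> Hom (index ?c) i j\<rbrakk> \<Longrightarrow>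
        Comp (Mod E S) (FO (diagram ?c) i) (FO (diagram ?c) j) M (\<mu> j) (FM (diagram ?c) i j f) = \<mu> i\<close>[of j i f] h
      by (simp del: Mod_simps)
    have Mf: "is_functor E Set_cat M" and lim: "is_limit Set_cat (map_cone M c)" using M c by simp_all
    define y where "y i = \<mu> i (FO (diagram c) i) (Id E (FO (diagram c) i))" for i
    have y: "y i \<in> FO M (FO (diagram c) i)" if "i \<in> Obj (index c)" for i
      using set_nat_trans_apply[OF \<mu>[OF that]] that by (simp add: y_def id_in_Hom[OF category_E])
    have \<mu>_apply: "\<mu> i X g = FM M (FO (diagram c) i) X g (y i)"
      if "i \<in> Obj (index c)" "X \<in> Obj E" "g \<in> Hom E (FO (diagram c) i) X" for i X g
      using nat_trans_hom_fctr_apply[OF locally_small_E _ \<mu>] that by (simp add: y_def)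
    have ex: "\<exists>!a. a \<in> apex (map_cone M c) \<and> (\<forall>i\<in>Obj (index (map_cone M c)). leg (map_cone M c) i a = y i)"
    proof (rule limit_Set_ex1[OF inf lim])
      fix i j f
      assume "i \<in> Obj (index (map_cone M c))" "j \<in> Obj (index (map_cone M c))"
        "f \<in> Hom (index (map_cone M c)) i j"
      then have h: "i \<in> Obj (index c)" "j \<in> Obj (index c)" "f \<in> Hom (index c) i j" by simp_all
      have "y j = \<mu> i (FO (diagram c) j) (FM (diagram c) i j f)"
        unfolding y_def[of j] using h
        by (subst \<mu>\<mu>[OF h, symmetric]) (simp add: compose_def id_in_Hom[OF category_E] comp_id_left[OF category_E])
      then show "FM (diagram (map_cone M c)) i j f (y i) = y j"
        using h by (simp add: \<mu>_apply)
    qed (simp add: y)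
    have arrow_iff: "Comp (Mod E S) (hom_fctr E (FO (diagram c) i)) (hom_fctr E (apex c)) M
          u (element_arrow E (hom_fctr E (apex c)) (FO (diagram c) i) (leg c i)) = \<mu> i \<longleftrightarrow>
        FM M (apex c) (FO (diagram c) i) (leg c i) (u (apex c) (Id E (apex c))) = y i" (is "?l = _ \<longleftrightarrow> ?r")
      if i: "i \<in> Obj (index c)" and u: "u \<in> Hom (Mod E S) (hom_fctr E (apex c)) M" for i u
    proof -
      have "?l = element_arrow E M (FO (diagram c) i) (u (FO (diagram c) i) (leg c i))"
        using i by (intro comp_element_arrow[OF hom_fctr_model M u]) simp_all
      also have "u (FO (diagram c) i) (leg c i) = FM M (apex c) (FO (diagram c) i) (leg c i) (u (apex c) (Id E (apex c)))"
        using nat_trans_hom_fctr_apply[OF locally_small_E L] u i by simp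
      finally have l: "?l = element_arrow E M (FO (diagram c) i)
        (FM M (apex c) (FO (diagram c) i) (leg c i) (u (apex c) (Id E (apex c))))" .
      have ux: "u (apex c) (Id E (apex c)) \<in> FO M (apex c)"
        using u set_nat_trans_apply[of E "hom_fctr E (apex c)" M u "apex c"] by (simp add: id_in_Hom[OF category_E])
      have \<mu>i: "\<mu> i = element_arrow E M (FO (diagram c) i) (y i)"
        unfolding y_def using i by (intro element_arrow_unique[OF locally_small_E _ Mf \<mu>]) simp_all
      have "?r" if "?l = \<mu> i"
      proof -
        have "?l (FO (diagram c) i) (Id E (FO (diagram c) i)) = y i" by (simp only: that y_def)
        then show ?thesis
          unfolding l using i ux by (simp add: id_in_Hom[OF category_E] set_fctr_id[OF Mf] set_fctr_apply[OF Mf])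
      qed
      moreover have "?l = \<mu> i" if "?r" using that l \<mu>i by simp
      ultimately show ?thesis by blast
    qed
    from ex obtain a where a: "a \<in> FO M (apex c)"
        "\<And>i. i \<in> Obj (index c) \<Longrightarrow> FM M (apex c) (FO (diagram c) i) (leg c i) a = y i"
      and aa: "\<And>b. \<lbrakk>b \<in> FO M (apex c);
        \<forall>i\<in>Obj (index c). FM M (apex c) (FO (diagram c) i) (leg c i) b = y i\<rbrakk> \<Longrightarrow> b = a"
      by (auto simp: Ex1_def)
    have "\<exists>!u. u \<in> Hom (Mod E S) (hom_fctr E (apex c)) M \<and> (\<forall>i\<in>Obj (index c).
        Comp (Mod E S) (hom_fctr E (FO (diagram c) i)) (hom_fctr E (apex c)) M
          u (element_arrow E (hom_fctr E (apex c)) (FO (diagram c) i) (leg c i)) = \<mu> i)"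
    proof (rule ex1I[of _ "element_arrow E M (apex c) a"], intro conjI ballI)
      show el: "element_arrow E M (apex c) a \<in> Hom (Mod E S) (hom_fctr E (apex c)) M"
        by (rule element_arrow_Hom[OF M L a(1)])
      show "Comp (Mod E S) (hom_fctr E (FO (diagram c) i)) (hom_fctr E (apex c)) M
          (element_arrow E M (apex c) a) (element_arrow E (hom_fctr E (apex c)) (FO (diagram c) i) (leg c i)) = \<mu> i"
        if "i \<in> Obj (index c)" for i
        unfolding arrow_iff[OF that el] using a that
        by (simp add: id_in_Hom[OF category_E] set_fctr_id[OF Mf])
    next
      fix u assume u: "u \<in> Hom (Mod E S) (hom_fctr E (apex c)) M \<and> (\<forall>i\<in>Obj (index c).
        Comp (Mod E S) (hom_fctr E (FO (diagram c) i)) (hom_fctr E (apex c)) M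
          u (element_arrow E (hom_fctr E (apex c)) (FO (diagram c) i) (leg c i)) = \<mu> i)"
      then have un: "is_nat_trans E Set_cat (hom_fctr E (apex c)) M u" by simp
      have "u (apex c) (Id E (apex c)) = a"
      proof (rule aa)
        show "u (apex c) (Id E (apex c)) \<in> FO M (apex c)"
          using set_nat_trans_apply[OF un L] by (simp add: id_in_Hom[OF category_E])
      qed (use u arrow_iff in blast)
      then show "u = element_arrow E M (apex c) a"
        using element_arrow_unique[OF locally_small_E L Mf un] by simp
    qed
    then show "\<exists>!u. u \<in> Hom (Mod E S) (apex ?c) M \<and> (\<forall>i\<in>Obj (index ?c).
        Comp (Mod E S) (FO (diagram ?c) i) (apex ?c) M u (leg ?c i) = \<mu> i)"
      by (simp del: Mod_simps cong: ball_cong)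
  qed
  then show ?thesis using Y by simp
qed

lemma yoneda_comp_model:
  assumes "cocontinuous TYPE('u) (Mod E S) C F"
  shows "comp_fctr (op_cat E) F (yoneda E) \<in> Obj (colimit_models (op_cat E) (op_cone ` S) C)"
  by (rule colimit_models_comp[OF _ yoneda_model assms])
    (use sketch in \<open>auto simp: limit_sketch_def small_category_op_cat intro: is_cocone_op_cone\<close>)

definition presents ::
  "('u, ('e, 'u, 'u set, 'u \<Rightarrow> 'u) fctr, 'e \<Rightarrow> 'u \<Rightarrow> 'u) cone \<Rightarrow> ('u \<Rightarrow> 'e) \<Rightarrow>
   ('e, 'u, 'u set, 'u \<Rightarrow> 'u) fctr \<Rightarrow> bool" where
  "presents c A M \<longleftrightarrow> small_category TYPE('u) (index c) \<and> is_colimit (Mod E S) c \<and> apex c = M \<and>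
     (\<forall>i\<in>Obj (index c). A i \<in> Obj E \<and> FO (diagram c) i = hom_fctr E (A i))"

lemma presentation_exists:
  assumes "M \<in> Obj (Mod E S)"
  shows "\<exists>c A. presents c A M"
proof -
  obtain c :: "('u, ('e, 'u, 'u set, 'u \<Rightarrow> 'u) fctr, 'e \<Rightarrow> 'u \<Rightarrow> 'u) cone"
    where c: "small_category TYPE('u) (index c)" "is_colimit (Mod E S) c" "apex c = M"
      "\<forall>i\<in>Obj (index c). \<exists>A\<in>Obj E. FO (diagram c) i = hom_fctr E A"
    using small_models assms unfolding small_model_def by meson
  from c(4) obtain A where "\<forall>i\<in>Obj (index c). A i \<in> Obj E \<and> FO (diagram c) i = hom_fctr E (A i)"
    by metis
  with c show ?thesis unfolding presents_def by blast
qed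

text \<open>By the Yoneda lemma the legs of a presentation correspond to elements of \<open>M\<close>, the generators, and
  the arrows of its diagram to arrows of \<open>E\<close>, which act on \<open>M\<close> by taking generators to generators.\<close>

definition gen where "gen c A i = leg c i (A i) (Id E (A i))"

definition rel where "rel c A i j f = FM (diagram c) i j f (A i) (Id E (A i))"

lemma presentsD:
  assumes "presents c A M"
  shows presents_small: "small_category TYPE('u) (index c)"
    and presents_colimit: "is_colimit (Mod E S) c"
    and presents_apex: "apex c = M"
    and presents_obj: "i \<in> Obj (index c) \<Longrightarrow> A i \<in> Obj E"
    and presents_diagram: "i \<in> Obj (index c) \<Longrightarrow> FO (diagram c) i = hom_fctr E (A i)"
  using assms by (auto simp: presents_def)

lemma
  assumes P: "presents c A M"
  shows presents_functor: "is_functor E Set_cat M"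
    and presents_leg: "i \<in> Obj (index c) \<Longrightarrow> is_nat_trans E Set_cat (hom_fctr E (A i)) M (leg c i)"
    and presents_FM: "\<lbrakk>i \<in> Obj (index c); j \<in> Obj (index c); f \<in> Hom (index c) i j\<rbrakk> \<Longrightarrow>
      is_nat_trans E Set_cat (hom_fctr E (A i)) (hom_fctr E (A j)) (FM (diagram c) i j f)"
proof -
  note k = colimit_cocone[OF presents_colimit[OF P]]
  have "M \<in> Obj (Mod E S)" using cocone_apex[OF k] presents_apex[OF P] by metis
  then show "is_functor E Set_cat M" by simp
  show "is_nat_trans E Set_cat (hom_fctr E (A i)) M (leg c i)" if "i \<in> Obj (index c)"
    using cocone_leg[OF k that] presents_diagram[OF P that] presents_apex[OF P] by simp
  show "is_nat_trans E Set_cat (hom_fctr E (A i)) (hom_fctr E (A j)) (FM (diagram c) i j f)"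
    if "i \<in> Obj (index c)" "j \<in> Obj (index c)" "f \<in> Hom (index c) i j"
    using functor_hom[OF cocone_diagram[OF k] that] that presents_diagram[OF P] by simp
qed

lemma
  assumes P: "presents c A M"
  shows gen_in: "i \<in> Obj (index c) \<Longrightarrow> gen c A i \<in> FO M (A i)"
    and leg_eq_element_arrow:
      "i \<in> Obj (index c) \<Longrightarrow> leg c i = element_arrow E M (A i) (gen c A i)"
    and rel_in: "\<lbrakk>i \<in> Obj (index c); j \<in> Obj (index c); f \<in> Hom (index c) i j\<rbrakk> \<Longrightarrow>
      rel c A i j f \<in> Hom E (A j) (A i)"
    and diagram_eq_element_arrow:
      "\<lbrakk>i \<in> Obj (index c); j \<in> Obj (index c); f \<in> Hom (index c) i j\<rbrakk> \<Longrightarrow>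
      FM (diagram c) i j f = element_arrow E (hom_fctr E (A j)) (A i) (rel c A i j f)"
proof -
  show "gen c A i \<in> FO M (A i)" if i: "i \<in> Obj (index c)"
    using set_nat_trans_apply[OF presents_leg[OF P i] presents_obj[OF P i]]
    by (simp add: gen_def id_in_Hom[OF category_E] presents_obj[OF P i])
  show "leg c i = element_arrow E M (A i) (gen c A i)" if i: "i \<in> Obj (index c)"
    unfolding gen_def by (rule element_arrow_unique[OF locally_small_E presents_obj[OF P i]
          presents_functor[OF P] presents_leg[OF P i]])
  show "rel c A i j f \<in> Hom E (A j) (A i)"
    if h: "i \<in> Obj (index c)" "j \<in> Obj (index c)" "f \<in> Hom (index c) i j"
    using set_nat_trans_apply[OF presents_FM[OF P h] presents_obj[OF P h(1)]]
    by (simp add: rel_def id_in_Hom[OF category_E] presents_obj[OF P] h)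
  show "FM (diagram c) i j f = element_arrow E (hom_fctr E (A j)) (A i) (rel c A i j f)"
    if h: "i \<in> Obj (index c)" "j \<in> Obj (index c)" "f \<in> Hom (index c) i j"
    unfolding rel_def by (rule element_arrow_unique[OF locally_small_E presents_obj[OF P h(1)]
          is_functor_hom[OF presents_obj[OF P h(2)]] presents_FM[OF P h]])
qed

lemma FM_rel_gen:
  assumes P: "presents c A M"
    and h: "i \<in> Obj (index c)" "j \<in> Obj (index c)" "f \<in> Hom (index c) i j"
  shows "FM M (A j) (A i) (rel c A i j f) (gen c A j) = gen c A i"
proof -
  note k = colimit_cocone[OF presents_colimit[OF P]]
  have "gen c A i = Comp (Mod E S) (FO (diagram c) i) (FO (diagram c) j) (apex c) (leg c j)
      (FM (diagram c) i j f) (A i) (Id E (A i))"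
    by (simp only: gen_def cocone_compat[OF k h])
  also have "\<dots> = leg c j (A i) (rel c A i j f)"
    using h by (simp add: compose_def rel_def presents_diagram[OF P] presents_obj[OF P] id_in_Hom[OF category_E])
  also have "\<dots> = FM M (A j) (A i) (rel c A i j f) (gen c A j)"
    using h rel_in[OF P h] by (simp add: leg_eq_element_arrow[OF P] presents_obj[OF P])
  finally show ?thesis by simp
qed

lemma wcocone_eq_if_eq_gen:
  assumes P: "presents c A M" and C: "locally_small TYPE('u) C"
    and G: "G \<in> Obj (colimit_models (op_cat E) (op_cone ` S) C)" and T: "T \<in> Obj C"
    and \<phi>: "is_wcocone E C G M T \<phi>" and \<psi>: "is_wcocone E C G M T \<psi>"
    and eq: "\<And>i. i \<in> Obj (index c) \<Longrightarrow> \<phi> (A i) (gen c A i) = \<psi> (A i) (gen c A i)"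
    and X: "X \<in> Obj E" "x \<in> FO M X"
  shows "\<phi> X x = \<psi> X x"
proof (rule wcocone_eqI[OF sketch C G T presents_colimit[OF P]])
  fix i B h assume h: "i \<in> Obj (index c)" "B \<in> Obj E" "h \<in> FO (FO (diagram c) i) B"
  note o = presents_obj[OF P h(1)]
  have hh: "h \<in> Hom E (A i) B" using h by (simp add: presents_diagram[OF P])
  show "\<phi> B (leg c i B h) = \<psi> B (leg c i B h)"
    unfolding leg_eq_element_arrow[OF P h(1)] element_arrow_apply[OF h(2) hh]
    using wcocone_natural[OF \<phi> o h(2) hh gen_in[OF P h(1)]]
      wcocone_natural[OF \<psi> o h(2) hh gen_in[OF P h(1)]] eq[OF h(1)] by simp
qed (use \<phi> \<psi> X presents_apex[OF P] in simp_all)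

lemma wcocone_extends:
  assumes P: "presents c A M" and C: "locally_small TYPE('u) C"
    and G: "G \<in> Obj (colimit_models (op_cat E) (op_cone ` S) C)" and T: "T \<in> Obj C"
    and a: "\<And>i. i \<in> Obj (index c) \<Longrightarrow> a i \<in> Hom C (FO G (A i)) T"
    and compat: "\<And>i j f. \<lbrakk>i \<in> Obj (index c); j \<in> Obj (index c); f \<in> Hom (index c) i j\<rbrakk> \<Longrightarrow>
      Comp C (FO G (A i)) (FO G (A j)) T (a j) (FM G (A i) (A j) (rel c A i j f)) = a i"
  shows "\<exists>\<psi>. is_wcocone E C G M T \<psi> \<and> (\<forall>i\<in>Obj (index c). \<psi> (A i) (gen c A i) = a i)"
proof -
  have Gf: "is_functor (op_cat E) C G" using G by simp
  note Go = functor_obj[OF Gf, simplified] and Gh = functor_hom[OF Gf, simplified]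
    and CC = functor_cod[OF Gf] and Ao = presents_obj[OF P]
  have "\<exists>\<psi>. is_wcocone E C G (apex c) T \<psi> \<and>
      (\<forall>i\<in>Obj (index c). \<forall>B\<in>Obj E. \<forall>h\<in>FO (FO (diagram c) i) B.
        \<psi> B (leg c i B h) = Comp C (FO G B) (FO G (A i)) T (a i) (FM G B (A i) h))"
  proof (rule glue_wcocones[OF sketch C G T presents_colimit[OF P]])
    show "is_wcocone E C G (FO (diagram c) i) T (\<lambda>B h. Comp C (FO G B) (FO G (A i)) T (a i) (FM G B (A i) h))"
      if "i \<in> Obj (index c)" for i
      unfolding presents_diagram[OF P that]
      by (rule wcocone_hom_fctr[OF locally_small_E Gf Ao[OF that] T a[OF that]])
    fix i j f B h
    assume h: "i \<in> Obj (index c)" "j \<in> Obj (index c)" "f \<in> Hom (index c) i j"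
      and B: "B \<in> Obj E" "h \<in> FO (FO (diagram c) i) B"
    then have hh: "h \<in> Hom E (A i) B" by (simp add: presents_diagram[OF P])
    show "Comp C (FO G B) (FO G (A j)) T (a j) (FM G B (A j) (FM (diagram c) i j f B h)) =
        Comp C (FO G B) (FO G (A i)) T (a i) (FM G B (A i) h)"
      using h B hh rel_in[OF P h] functor_comp[OF Gf, of B "A i" "A j" h "rel c A i j f"]
      by (simp add: diagram_eq_element_arrow[OF P] Ao compat[symmetric] comp_assoc[OF CC] Go Gh T a)
  qed
  then obtain \<psi> where \<psi>: "is_wcocone E C G M T \<psi>"
    and leg: "\<And>i B h. \<lbrakk>i \<in> Obj (index c); B \<in> Obj E; h \<in> FO (FO (diagram c) i) B\<rbrakk> \<Longrightarrow>
        \<psi> B (leg c i B h) = Comp C (FO G B) (FO G (A i)) T (a i) (FM G B (A i) h)"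
    unfolding presents_apex[OF P] by blast
  have "\<psi> (A i) (gen c A i) = a i" if i: "i \<in> Obj (index c)" for i
    using leg[OF i Ao[OF i], of "Id E (A i)"] functor_id[OF Gf, of "A i"] i a[OF i]
    by (simp add: gen_def presents_diagram[OF P] Ao id_in_Hom[OF category_E] comp_id_right[OF CC] Go T)
  with \<psi> show ?thesis by blast
qed

text \<open>A weighted cocone on \<open>M\<close> is determined by its values at the generators, and these form a cocone
  on the diagram of the objects \<open>G (A i)\<close>. So a colimit of this small diagram has the universal
  property with respect to the large diagram of all elements of \<open>M\<close>.\<close>

lemma is_wcolimI:
  fixes k :: "('u, 'c, 'p) cone"
  assumes P: "presents c A M" and C: "locally_small TYPE('u) C"
    and G: "G \<in> Obj (colimit_models (op_cat E) (op_cone ` S) C)"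
    and k: "is_colimit C k" "index k = index c" "apex k = L"
      "\<And>i. i \<in> Obj (index c) \<Longrightarrow> FO (diagram k) i = FO G (A i)"
      "\<And>i j f. \<lbrakk>i \<in> Obj (index c); j \<in> Obj (index c); f \<in> Hom (index c) i j\<rbrakk> \<Longrightarrow>
        FM (diagram k) i j f = FM G (A i) (A j) (rel c A i j f)"
    and \<kappa>: "is_wcocone E C G M L \<kappa>"
      "\<And>i. i \<in> Obj (index c) \<Longrightarrow> leg k i = \<kappa> (A i) (gen c A i)"
  shows "is_wcolim E C G M L \<kappa>"
  unfolding is_wcolim_def
proof (intro conjI ballI allI impI)
  show L: "L \<in> Obj C" using cocone_apex[OF colimit_cocone[OF k(1)]] k(3) by simp
  have Gf: "is_functor (op_cat E) C G" using G by simp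
  note M = presents_functor[OF P] and Ao = presents_obj[OF P]
  fix T \<phi> assume T: "T \<in> Obj C" and \<phi>: "is_wcocone E C G M T \<phi>"
  have "\<exists>!u. u \<in> Hom C (apex k) T \<and> (\<forall>i\<in>Obj (index k).
      Comp C (FO (diagram k) i) (apex k) T u (leg k i) = \<phi> (A i) (gen c A i))"
  proof (rule colimit_ex1[OF k(1) T])
    show "\<phi> (A i) (gen c A i) \<in> Hom C (FO (diagram k) i) T" if "i \<in> Obj (index k)" for i
      using that by (simp add: k wcocone_in_Hom[OF \<phi>] Ao gen_in[OF P])
    show "Comp C (FO (diagram k) i) (FO (diagram k) j) T (\<phi> (A j) (gen c A j)) (FM (diagram k) i j f) =
        \<phi> (A i) (gen c A i)"
      if "i \<in> Obj (index k)" "j \<in> Obj (index k)" "f \<in> Hom (index k) i j" for i j f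
    proof -
      have h: "i \<in> Obj (index c)" "j \<in> Obj (index c)" "f \<in> Hom (index c) i j"
        using that by (simp_all add: k)
      show ?thesis
        using wcocone_natural[OF \<phi> Ao[OF h(2)] Ao[OF h(1)] rel_in[OF P h] gen_in[OF P h(2)]] h
        by (simp add: k FM_rel_gen[OF P])
    qed
  qed
  then have ex: "\<exists>!u. u \<in> Hom C L T \<and> (\<forall>i\<in>Obj (index c).
      Comp C (FO G (A i)) L T u (\<kappa> (A i) (gen c A i)) = \<phi> (A i) (gen c A i))"
    by (simp add: k \<kappa>(2) cong: ball_cong)
  have iff: "(\<forall>i\<in>Obj (index c). Comp C (FO G (A i)) L T u (\<kappa> (A i) (gen c A i)) = \<phi> (A i) (gen c A i))
      \<longleftrightarrow> (\<forall>B\<in>Obj E. \<forall>x\<in>FO M B. Comp C (FO G B) L T u (\<kappa> B x) = \<phi> B x)" (is "?l \<longleftrightarrow> ?r")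
    if u: "u \<in> Hom C L T" for u
  proof
    assume ?l
    then show ?r
      using wcocone_eq_if_eq_gen[OF P C G T wcocone_postcomp[OF Gf M \<kappa>(1) u L T] \<phi>] by blast
  next
    assume ?r then show ?l using Ao gen_in[OF P] by blast
  qed
  show "\<exists>!u. u \<in> Hom C L T \<and> (\<forall>B\<in>Obj E. \<forall>x\<in>FO M B. Comp C (FO G B) L T u (\<kappa> B x) = \<phi> B x)"
    using ex iff by (simp cong: conj_cong)
qed (rule \<kappa>(1))

text \<open>Cocompleteness of \<open>C\<close> provides the colimit of the objects \<open>G (A i)\<close>. Its legs are prescribed
  values at the generators, and extend to all elements of \<open>M\<close> by gluing.\<close>

lemma wcolim_exists:
  fixes C :: "('c, 'p) cat"
  assumes M: "M \<in> Obj (Mod E S)" and C: "locally_small TYPE('u) C" "cocomplete TYPE('u) C"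
    and G: "G \<in> Obj (colimit_models (op_cat E) (op_cone ` S) C)"
  shows "\<exists>L \<kappa>. is_wcolim E C G M L \<kappa>"
proof -
  obtain c A where P: "presents c A M" using presentation_exists[OF M] by blast
  have Gf: "is_functor (op_cat E) C G" using G by simp
  note Go = functor_obj[OF Gf, simplified] and Gh = functor_hom[OF Gf, simplified]
    and CC = functor_cod[OF Gf] and Ao = presents_obj[OF P]
  note D = cocone_diagram[OF colimit_cocone[OF presents_colimit[OF P]]]
  note I = functor_dom[OF D]
  define D' where "D' = restrict_fctr (index c)
    \<lparr> FO = (\<lambda>i. FO G (A i)), FM = (\<lambda>i j f. FM G (A i) (A j) (rel c A i j f)) \<rparr>"
  \<comment> \<open>both functor laws come from those of the diagram of \<open>c\<close>, by evaluation at identities\<close>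
  have "is_functor (index c) C D'"
    unfolding D'_def
  proof (rule is_functor_restrictI[OF I CC], simp_all only: fctr.simps)
    fix i assume i: "i \<in> Obj (index c)"
    have "rel c A i i (Id (index c) i) = Id E (A i)"
      using functor_id[OF D i] i
      by (simp add: rel_def presents_diagram[OF P] Ao id_in_Hom[OF category_E])
    then show "FM G (A i) (A i) (rel c A i i (Id (index c) i)) = Id C (FO G (A i))"
      using functor_id[OF Gf, of "A i"] i by (simp add: Ao)
  next
    fix i j l f g
    assume h: "i \<in> Obj (index c)" "j \<in> Obj (index c)" "l \<in> Obj (index c)"
      "f \<in> Hom (index c) i j" "g \<in> Hom (index c) j l"
    have "rel c A i l (Comp (index c) i j l g f) = FM (diagram c) j l g (A i) (rel c A i j f)"
      unfolding rel_def[of _ _ i] functor_comp[OF D h]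
      using h by (simp add: presents_diagram[OF P] Ao id_in_Hom[OF category_E] compose_def)
    also have "\<dots> = Comp E (A l) (A j) (A i) (rel c A i j f) (rel c A j l g)"
      using h by (simp add: diagram_eq_element_arrow[OF P] Ao rel_in[OF P])
    finally show "FM G (A i) (A l) (rel c A i l (Comp (index c) i j l g f)) =
        Comp C (FO G (A i)) (FO G (A j)) (FO G (A l)) (FM G (A j) (A l) (rel c A j l g)) (FM G (A i) (A j) (rel c A i j f))"
      using functor_comp[OF Gf, of "A i" "A j" "A l" "rel c A i j f" "rel c A j l g"] h
      by (simp add: Ao rel_in[OF P])
  qed (auto intro!: Go Gh Ao rel_in[OF P])
  then obtain k where k: "is_colimit C k" "index k = index c" "diagram k = D'"
    using C(2) presents_small[OF P] unfolding cocomplete_def by blast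
  note kc = is_coconeD[OF colimit_cocone[OF k(1)], unfolded k(2,3)]
  have D'_simps: "i \<in> Obj (index c) \<Longrightarrow> FO D' i = FO G (A i)"
    "\<lbrakk>i \<in> Obj (index c); j \<in> Obj (index c); f \<in> Hom (index c) i j\<rbrakk> \<Longrightarrow>
      FM D' i j f = FM G (A i) (A j) (rel c A i j f)" for i j f
    by (simp_all add: D'_def)
  have "\<exists>\<kappa>. is_wcocone E C G M (apex k) \<kappa> \<and> (\<forall>i\<in>Obj (index c). \<kappa> (A i) (gen c A i) = leg k i)"
    by (rule wcocone_extends[OF P C(1) G kc(2)])
      (use kc(3,4) in \<open>simp_all add: D'_simps\<close>)
  then obtain \<kappa> where "is_wcocone E C G M (apex k) \<kappa>" "\<forall>i\<in>Obj (index c). \<kappa> (A i) (gen c A i) = leg k i"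
    by blast
  then have "is_wcolim E C G M (apex k) \<kappa>"
    by (intro is_wcolimI[OF P C(1) G k(1,2)]) (simp_all add: k(3) D'_simps)
  then show ?thesis by blast
qed

text \<open>A cocontinuous functor on the category of models is the weighted colimit of its restriction
  along the Yoneda embedding, with the images of all arrows out of representables as legs. As these
  legs are indexed by all elements of \<open>M\<close>, rather than by those of a presentation of \<open>M\<close>, this
  description is natural in \<open>M\<close>.\<close>

lemma cocontinuous_is_wcolim:
  fixes C :: "('c, 'p) cat"
  assumes M: "M \<in> Obj (Mod E S)" and C: "locally_small TYPE('u) C"
    and F: "cocontinuous TYPE('u) (Mod E S) C F"
  shows "is_wcolim E C (comp_fctr (op_cat E) F (yoneda E)) M (FO F M)
    (\<lambda>A x. FM F (hom_fctr E A) M (element_arrow E M A x))"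
proof -
  obtain c A where P: "presents c A M" using presentation_exists[OF M] by blast
  note Ff = cocontinuous_functor[OF F] and Ao = presents_obj[OF P]
  note D = cocone_diagram[OF colimit_cocone[OF presents_colimit[OF P]]]
  show ?thesis
  proof (rule is_wcolimI[OF P C yoneda_comp_model[OF F], of "map_cocone F c"])
    show "is_colimit C (map_cocone F c)"
      by (rule cocontinuous_colimit[OF F presents_small[OF P] presents_colimit[OF P]])
    show "FO (diagram (map_cocone F c)) i = FO (comp_fctr (op_cat E) F (yoneda E)) (A i)"
      if "i \<in> Obj (index c)" for i
      using that by (simp add: presents_diagram[OF P] Ao)
    show "FM (diagram (map_cocone F c)) i j f =
        FM (comp_fctr (op_cat E) F (yoneda E)) (A i) (A j) (rel c A i j f)"
      if "i \<in> Obj (index c)" "j \<in> Obj (index c)" "f \<in> Hom (index c) i j" for i j f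
      using that by (simp add: presents_diagram[OF P] diagram_eq_element_arrow[OF P] rel_in[OF P] Ao)
    show "is_wcocone E C (comp_fctr (op_cat E) F (yoneda E)) M (FO F M)
        (\<lambda>A x. FM F (hom_fctr E A) M (element_arrow E M A x))"
      unfolding is_wcocone_def
    proof (intro conjI ballI)
      fix X x assume X: "X \<in> Obj E" "x \<in> FO M X"
      then show "FM F (hom_fctr E X) M (element_arrow E M X x)
          \<in> Hom C (FO (comp_fctr (op_cat E) F (yoneda E)) X) (FO F M)"
        using functor_hom[OF Ff hom_fctr_model[OF X(1)] M element_arrow_Hom[OF M X]] by simp
    next
      fix X Y f x assume h: "X \<in> Obj E" "Y \<in> Obj E" "f \<in> Hom E X Y" "x \<in> FO M X"
      have f: "element_arrow E (hom_fctr E X) Y f \<in> Hom (Mod E S) (hom_fctr E Y) (hom_fctr E X)"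
        using h by (intro element_arrow_Hom hom_fctr_model) simp_all
      show "FM F (hom_fctr E Y) M (element_arrow E M Y (FM M X Y f x)) =
          Comp C (FO (comp_fctr (op_cat E) F (yoneda E)) Y) (FO (comp_fctr (op_cat E) F (yoneda E)) X) (FO F M)
            (FM F (hom_fctr E X) M (element_arrow E M X x)) (FM (comp_fctr (op_cat E) F (yoneda E)) Y X f)"
        using functor_comp[OF Ff hom_fctr_model[OF h(2)] hom_fctr_model[OF h(1)] M f element_arrow_Hom[OF M h(1,4)]] h
        by (simp add: comp_element_arrows[OF M h] del: Mod_simps)
    qed
    show "leg (map_cocone F c) i = FM F (hom_fctr E (A i)) M (element_arrow E M (A i) (gen c A i))"
      if "i \<in> Obj (index c)" for i
      using that by (simp add: presents_diagram[OF P] presents_apex[OF P] leg_eq_element_arrow[OF P])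
  qed (simp_all add: presents_apex[OF P])
qed

text \<open>An arrow \<open>M \<rightarrow> N\<close> is determined by its values at the generators of a presentation of \<open>M\<close>, which
  form an element of a small product of the sets \<open>N (A i)\<close>.\<close>

lemma locally_small_Mod: "locally_small TYPE('u) (Mod E S)"
  unfolding locally_small_def
proof (intro conjI ballI category_Mod)
  fix M N assume M: "M \<in> Obj (Mod E S)" and N: "N \<in> Obj (Mod E S)"
  obtain c A where P: "presents c A M" using presentation_exists[OF M] by blast
  let ?I = "Obj (index c)"
  define v where "v m = (\<lambda>i\<in>?I. m (A i) (gen c A i) :: 'u)" for m
  have "inj_on v (Hom (Mod E S) M N)"
  proof (rule inj_onI)
    fix m n assume m: "m \<in> Hom (Mod E S) M N" and n: "n \<in> Hom (Mod E S) M N" and eq: "v m = v n"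
    show "m = n"
    proof (rule colimit_arrow_eqI[OF presents_colimit[OF P] category_Mod N])
      fix i assume i: "i \<in> ?I"
      have "m (A i) (gen c A i) = n (A i) (gen c A i)"
        using fun_cong[OF eq, of i] i by (simp add: v_def)
      then show "Comp (Mod E S) (FO (diagram c) i) (apex c) N m (leg c i) =
          Comp (Mod E S) (FO (diagram c) i) (apex c) N n (leg c i)"
        unfolding presents_apex[OF P] presents_diagram[OF P i] leg_eq_element_arrow[OF P i]
        using comp_element_arrow[OF M N m presents_obj[OF P i] gen_in[OF P i]]
          comp_element_arrow[OF M N n presents_obj[OF P i] gen_in[OF P i]] by metis
    qed (use m n presents_apex[OF P] in simp_all)
  qed
  moreover have "v ` Hom (Mod E S) M N \<subseteq> (\<Pi>\<^sub>E i\<in>?I. FO N (A i))"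
  proof -
    have "m (A i) (gen c A i) \<in> FO N (A i)" if "m \<in> Hom (Mod E S) M N" "i \<in> ?I" for m i
      using that set_nat_trans_apply[of E M N m, OF _ presents_obj[OF P] gen_in[OF P]] by simp
    then show ?thesis by (auto simp: v_def)
  qed
  ultimately have "Hom (Mod E S) M N \<lesssim> (\<Pi>\<^sub>E i\<in>?I. FO N (A i))" by (auto simp: lepoll_def)
  moreover have "small TYPE('u) (\<Pi>\<^sub>E i\<in>?I. FO N (A i))"
  proof (rule small_PiE[OF universe])
    show "small TYPE('u) ?I" using presents_small[OF P] by (simp add: small_category_def)
    have Nf: "is_functor E Set_cat N" using N by simp
    show "small TYPE('u) (FO N (A i))" if "i \<in> ?I" for i
      using functor_obj[OF Nf presents_obj[OF P that]] by simp
  qed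
  ultimately show "small TYPE('u) (Hom (Mod E S) M N)"
    unfolding small_def by (rule lesspoll_trans1)
qed

end

section \<open>Precomposition and postcomposition\<close>

lemma is_nat_trans_precomp:
  assumes Y: "is_functor B D Y" and \<eta>: "is_nat_trans D C F G \<eta>"
  shows "is_nat_trans B C (comp_fctr B F Y) (comp_fctr B G Y) (\<lambda>X\<in>Obj B. \<eta> (FO Y X))"
  by (rule is_nat_trans_restrictI)
    (simp_all add: functor_obj[OF Y] functor_hom[OF Y] nat_trans_in_Hom[OF \<eta>] nat_trans_natural[OF \<eta>])

lemma is_nat_trans_postcomp:
  assumes F: "is_functor B C F" and G: "is_functor B C G" and H: "is_functor C D H"
    and \<eta>: "is_nat_trans B C F G \<eta>"
  shows "is_nat_trans B D (comp_fctr B H F) (comp_fctr B H G)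
    (\<lambda>X\<in>Obj B. FM H (FO F X) (FO G X) (\<eta> X))"
  by (rule is_nat_trans_restrictI)
    (simp_all add: functor_obj[OF F] functor_obj[OF G] functor_hom[OF F] functor_hom[OF G]
      functor_hom[OF H] nat_trans_in_Hom[OF \<eta>] nat_trans_natural[OF \<eta>] functor_comp[OF H, symmetric])

lemma precomp_simps [simp]:
  "F \<in> Obj K \<Longrightarrow> FO (precomp K B Y) F = comp_fctr B F Y"
  "\<lbrakk>F \<in> Obj K; G \<in> Obj K; \<eta> \<in> Hom K F G\<rbrakk> \<Longrightarrow> FM (precomp K B Y) F G \<eta> = (\<lambda>X\<in>Obj B. \<eta> (FO Y X))"
  by (simp_all add: precomp_def)

lemma postcomp_simps [simp]:
  "F \<in> Obj K \<Longrightarrow> FO (postcomp K B H) F = comp_fctr B H F"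
  "\<lbrakk>F \<in> Obj K; G \<in> Obj K; \<eta> \<in> Hom K F G\<rbrakk> \<Longrightarrow>
    FM (postcomp K B H) F G \<eta> = (\<lambda>X\<in>Obj B. FM H (FO F X) (FO G X) (\<eta> X))"
  by (simp_all add: postcomp_def)

lemma is_functor_precomp:
  fixes T :: "('u, 'a, 'm) cone set" and U :: "'u itself"
  assumes T: "\<And>c. c \<in> T \<Longrightarrow> small_category U (index c) \<and> is_cocone B c"
    and Y: "Y \<in> Obj (colimit_models B T D)"
  shows "is_functor (Hom_c U D C) (colimit_models B T C) (precomp (Hom_c U D C) B Y)"
  unfolding precomp_def
proof (rule is_functor_restrictI[OF category_Hom_c category_colimit_models], simp_all only: fctr.simps)
  have Yf: "is_functor B D Y" using Y by simp
  show "comp_fctr B F Y \<in> Obj (colimit_models B T C)" if "F \<in> Obj (Hom_c U D C)" for F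
    using colimit_models_comp[OF T Y] that by simp
  show "(\<lambda>X\<in>Obj B. \<eta> (FO Y X)) \<in> Hom (colimit_models B T C) (comp_fctr B F Y) (comp_fctr B G Y)"
    if "\<eta> \<in> Hom (Hom_c U D C) F G" for F G \<eta>
    using that is_nat_trans_precomp[OF Yf] by simp
qed (use Y functor_obj[of B D Y] in \<open>auto intro!: restrict_ext\<close>)

text \<open>Naturality in the target category is associativity of composition.\<close>

lemma precomp_postcomp:
  fixes T :: "('u, 'a, 'm) cone set" and U :: "'u itself"
  assumes T: "\<And>c. c \<in> T \<Longrightarrow> small_category U (index c) \<and> is_cocone B c"
    and Y: "Y \<in> Obj (colimit_models B T D)" and H: "cocontinuous U C C' H"
  shows "comp_fctr (Hom_c U D C) (precomp (Hom_c U D C') B Y) (postcomp (Hom_c U D C) D H) =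
    comp_fctr (Hom_c U D C) (postcomp (colimit_models B T C) B H) (precomp (Hom_c U D C) B Y)"
    (is "?l = ?r")
proof (rule functor_eqI[of "Hom_c U D C"])
  have Yf: "is_functor B D Y" using Y by simp
  note Hf = cocontinuous_functor[OF H]
  have HF: "comp_fctr D H F \<in> Obj (Hom_c U D C')" if "F \<in> Obj (Hom_c U D C)" for F
    using cocontinuous_comp[OF _ H] that by simp
  have FY: "comp_fctr B F Y \<in> Obj (colimit_models B T C)" if "F \<in> Obj (Hom_c U D C)" for F
    using colimit_models_comp[OF T Y] that by simp
  fix F assume F: "F \<in> Obj (Hom_c U D C)"
  show "FO ?l F = FO ?r F"
    using F HF[OF F] FY[OF F] comp_fctr_assoc[OF Yf]
    by (simp del: Hom_c_simps colimit_models_simps)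
  fix G \<eta> assume G: "G \<in> Obj (Hom_c U D C)" and \<eta>: "\<eta> \<in> Hom (Hom_c U D C) F G"
  have Ff: "is_functor D C F" and Gf: "is_functor D C G"
    using F G by (simp_all add: cocontinuous_functor)
  have H\<eta>: "(\<lambda>X\<in>Obj D. FM H (FO F X) (FO G X) (\<eta> X)) \<in> Hom (Hom_c U D C') (comp_fctr D H F) (comp_fctr D H G)"
    using is_nat_trans_postcomp[OF Ff Gf Hf] \<eta> by simp
  have \<eta>Y: "(\<lambda>X\<in>Obj B. \<eta> (FO Y X)) \<in> Hom (colimit_models B T C) (comp_fctr B F Y) (comp_fctr B G Y)"
    using is_nat_trans_precomp[OF Yf] \<eta> by simp
  show "FM ?l F G \<eta> = FM ?r F G \<eta>"
    using F G \<eta> HF[OF F] HF[OF G] FY[OF F] FY[OF G] H\<eta> \<eta>Y functor_obj[OF Yf]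
    by (simp del: Hom_c_simps colimit_models_simps cong: restrict_cong)
qed simp_all

section \<open>Restriction along the Yoneda embedding\<close>

lemma wcocone_change_base:
  assumes G: "is_functor (op_cat E) C G" and G': "is_functor (op_cat E) C G'"
    and M: "is_functor E Set_cat M" and T: "T \<in> Obj C"
    and \<alpha>: "is_nat_trans (op_cat E) C G G' \<alpha>" and \<phi>: "is_wcocone E C G' M T \<phi>"
  shows "is_wcocone E C G M T (\<lambda>A x. Comp C (FO G A) (FO G' A) T (\<phi> A x) (\<alpha> A))"
proof -
  note CC = functor_cod[OF G] and o = functor_obj[OF G, simplified] functor_obj[OF G', simplified] T
    and \<alpha>h = nat_trans_in_Hom[OF \<alpha>, simplified]
    and h = functor_hom[OF G, simplified] functor_hom[OF G', simplified]
  show ?thesis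
    unfolding is_wcocone_def
  proof (intro conjI ballI)
    fix A B f x assume hx: "A \<in> Obj E" "B \<in> Obj E" "f \<in> Hom E A B" "x \<in> FO M A"
    note \<phi>x = wcocone_in_Hom[OF \<phi> hx(1,4)]
    have "Comp C (FO G B) (FO G' B) T (\<phi> B (FM M A B f x)) (\<alpha> B) =
        Comp C (FO G B) (FO G' A) T (\<phi> A x) (Comp C (FO G B) (FO G' B) (FO G' A) (FM G' B A f) (\<alpha> B))"
      using hx \<phi>x by (simp add: wcocone_natural[OF \<phi> hx] comp_assoc[OF CC] o h \<alpha>h)
    also have "\<dots> = Comp C (FO G B) (FO G A) T (Comp C (FO G A) (FO G' A) T (\<phi> A x) (\<alpha> A)) (FM G B A f)"
      unfolding nat_trans_natural[OF \<alpha>, simplified, OF hx(2,1,3), symmetric]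
      using hx \<phi>x by (simp add: comp_assoc[OF CC] o h \<alpha>h)
    finally show "Comp C (FO G B) (FO G' B) T (\<phi> B (FM M A B f x)) (\<alpha> B) =
      Comp C (FO G B) (FO G A) T (Comp C (FO G A) (FO G' A) T (\<phi> A x) (\<alpha> A)) (FM G B A f)" .
  qed (auto intro!: comp_in_Hom[OF CC] o \<alpha>h wcocone_in_Hom[OF \<phi>])
qed

context small_model_sketch
begin

lemma op_sketch_small_cocones:
  "c \<in> op_cone ` S \<Longrightarrow> small_category TYPE('u) (index c) \<and> is_cocone (op_cat E) c"
  using sketch by (auto simp: limit_sketch_def small_category_op_cat intro: is_cocone_op_cone)

text \<open>Restriction is fully faithful, because an arrow out of a weighted colimit \<open>F M\<close> is a weighted
  cocone on \<open>M\<close>. The component at \<open>M\<close> of the extension of \<open>\<alpha>\<close> corresponds to the legs of \<open>F' M\<close>,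
  precomposed with \<open>\<alpha>\<close>.\<close>

lemma nat_trans_extends_uniquely:
  fixes C :: "('c, 'p) cat"
  assumes C: "locally_small TYPE('u) C"
    and F: "cocontinuous TYPE('u) (Mod E S) C F" and F': "cocontinuous TYPE('u) (Mod E S) C F'"
    and \<alpha>: "is_nat_trans (op_cat E) C (comp_fctr (op_cat E) F (yoneda E))
      (comp_fctr (op_cat E) F' (yoneda E)) \<alpha>"
  shows "\<exists>!\<eta>. is_nat_trans (Mod E S) C F F' \<eta> \<and> (\<lambda>A\<in>Obj E. \<eta> (FO (yoneda E) A)) = \<alpha>"
proof -
  note Ff = cocontinuous_functor[OF F] and Ff' = cocontinuous_functor[OF F']
  note CC = functor_cod[OF Ff] and Y = is_functor_yoneda
  note FY = is_functor_comp_fctr[OF Y Ff] and FY' = is_functor_comp_fctr[OF Y Ff']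
  note L = cocontinuous_is_wcolim[OF _ C F] and L' = cocontinuous_is_wcolim[OF _ C F']
  note o [simp] = functor_obj[OF Ff] functor_obj[OF Ff'] hom_fctr_model
  note el = element_arrow_Hom and h [simp] = functor_hom[OF Ff] functor_hom[OF Ff']
  have \<alpha>_in: "\<alpha> A \<in> Hom C (FO F (hom_fctr E A)) (FO F' (hom_fctr E A))" if "A \<in> Obj E" for A
    using nat_trans_in_Hom[OF \<alpha>] that by simp
  \<comment> \<open>naturality with respect to all arrows from representables to \<open>M\<close>, with \<open>\<alpha>\<close> for the components
    at representables\<close>
  define P where "P M u \<longleftrightarrow> u \<in> Hom C (FO F M) (FO F' M) \<and> (\<forall>A\<in>Obj E. \<forall>x\<in>FO M A.
      Comp C (FO F (hom_fctr E A)) (FO F M) (FO F' M) u (FM F (hom_fctr E A) M (element_arrow E M A x)) =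
      Comp C (FO F (hom_fctr E A)) (FO F' (hom_fctr E A)) (FO F' M)
        (FM F' (hom_fctr E A) M (element_arrow E M A x)) (\<alpha> A))" for M u
  have P_ex1: "\<exists>!u. P M u" if M: "M \<in> Obj (Mod E S)" for M
  proof -
    have Mf: "is_functor E Set_cat M" using M by simp
    show ?thesis
      using wcolim_ex1[OF L[OF M] _ wcocone_change_base[OF FY FY' Mf _ \<alpha> wcolim_wcocone[OF L'[OF M]]]] M
      by (simp add: P_def del: Mod_simps cong: ball_cong conj_cong)
  qed
  define \<eta> where "\<eta> = (\<lambda>M\<in>Obj (Mod E S). THE u. P M u)"
  have \<eta>P: "P M (\<eta> M)" if "M \<in> Obj (Mod E S)" for M
    using theI'[OF P_ex1[OF that]] that by (simp add: \<eta>_def del: Mod_simps)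
  then have \<eta>_in [simp]: "\<eta> M \<in> Hom C (FO F M) (FO F' M)" if "M \<in> Obj (Mod E S)" for M
    using that by (simp add: P_def)
  have \<eta>_eq: "Comp C (FO F (hom_fctr E A)) (FO F M) (FO F' M) (\<eta> M) (FM F (hom_fctr E A) M (element_arrow E M A x)) =
      Comp C (FO F (hom_fctr E A)) (FO F' (hom_fctr E A)) (FO F' M)
        (FM F' (hom_fctr E A) M (element_arrow E M A x)) (\<alpha> A)"
    if "M \<in> Obj (Mod E S)" "A \<in> Obj E" "x \<in> FO M A" for M A x
    using \<eta>P that by (simp add: P_def)
  show ?thesis
  proof (rule ex1I[of _ \<eta>], intro conjI)
    have "is_nat_trans (Mod E S) C F F' (\<lambda>M\<in>Obj (Mod E S). \<eta> M)"
    proof (rule is_nat_trans_restrictI[OF \<eta>_in])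
      fix M N m assume MN: "M \<in> Obj (Mod E S)" "N \<in> Obj (Mod E S)" and m: "m \<in> Hom (Mod E S) M N"
      have Mf: "is_functor E Set_cat M" using MN by simp
      show "Comp C (FO F M) (FO F N) (FO F' N) (\<eta> N) (FM F M N m) =
          Comp C (FO F M) (FO F' M) (FO F' N) (FM F' M N m) (\<eta> M)"
      proof (rule wcolim_arrow_eqI[OF FY Mf L[OF MN(1)]])
        fix A x assume A: "A \<in> Obj E" "x \<in> FO M A"
        note x = el[OF MN(1) A]
        have mx: "m A x \<in> FO N A" using m A by (auto dest: set_nat_trans_apply)
        have Fmx: "FM F (hom_fctr E A) N (element_arrow E N A (m A x)) =
            Comp C (FO F (hom_fctr E A)) (FO F M) (FO F N) (FM F M N m) (FM F (hom_fctr E A) M (element_arrow E M A x))"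
          unfolding comp_element_arrow[OF MN m A, symmetric]
          by (rule functor_comp[OF Ff hom_fctr_model[OF A(1)] MN x m])
        have Fmx': "FM F' (hom_fctr E A) N (element_arrow E N A (m A x)) =
            Comp C (FO F' (hom_fctr E A)) (FO F' M) (FO F' N) (FM F' M N m) (FM F' (hom_fctr E A) M (element_arrow E M A x))"
          unfolding comp_element_arrow[OF MN m A, symmetric]
          by (rule functor_comp[OF Ff' hom_fctr_model[OF A(1)] MN x m])
        have "Comp C (FO F (hom_fctr E A)) (FO F M) (FO F' N) (Comp C (FO F M) (FO F N) (FO F' N) (\<eta> N) (FM F M N m))
              (FM F (hom_fctr E A) M (element_arrow E M A x)) =
            Comp C (FO F (hom_fctr E A)) (FO F N) (FO F' N) (\<eta> N) (FM F (hom_fctr E A) N (element_arrow E N A (m A x)))"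
          unfolding Fmx using A MN m x by (simp add: comp_assoc[OF CC] del: Mod_simps)
        also have "\<dots> = Comp C (FO F (hom_fctr E A)) (FO F' (hom_fctr E A)) (FO F' N)
            (FM F' (hom_fctr E A) N (element_arrow E N A (m A x))) (\<alpha> A)"
          by (rule \<eta>_eq[OF MN(2) A(1) mx])
        also have "\<dots> = Comp C (FO F (hom_fctr E A)) (FO F' M) (FO F' N) (FM F' M N m)
            (Comp C (FO F (hom_fctr E A)) (FO F' (hom_fctr E A)) (FO F' M)
              (FM F' (hom_fctr E A) M (element_arrow E M A x)) (\<alpha> A))"
          unfolding Fmx' using A MN m x \<alpha>_in by (simp add: comp_assoc[OF CC] del: Mod_simps)
        also have "\<dots> = Comp C (FO F (hom_fctr E A)) (FO F M) (FO F' N)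
            (Comp C (FO F M) (FO F' M) (FO F' N) (FM F' M N m) (\<eta> M)) (FM F (hom_fctr E A) M (element_arrow E M A x))"
          unfolding \<eta>_eq[OF MN(1) A, symmetric] using A MN m x by (simp add: comp_assoc[OF CC] del: Mod_simps)
        finally show "Comp C (FO (comp_fctr (op_cat E) F (yoneda E)) A) (FO F M) (FO F' N)
              (Comp C (FO F M) (FO F N) (FO F' N) (\<eta> N) (FM F M N m))
              (FM F (hom_fctr E A) M (element_arrow E M A x)) =
            Comp C (FO (comp_fctr (op_cat E) F (yoneda E)) A) (FO F M) (FO F' N)
              (Comp C (FO F M) (FO F' M) (FO F' N) (FM F' M N m) (\<eta> M))
              (FM F (hom_fctr E A) M (element_arrow E M A x))"
          using A by simp
      qed (use MN m in \<open>auto intro!: comp_in_Hom[OF CC] simp del: Mod_simps\<close>)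
    qed
    then show "is_nat_trans (Mod E S) C F F' \<eta>"
      by (simp only: \<eta>_def restrict_restrict Int_absorb)
    show "(\<lambda>A\<in>Obj E. \<eta> (FO (yoneda E) A)) = \<alpha>"
    proof (rule extensionalityI[of _ "Obj E"])
      show "\<alpha> \<in> extensional (Obj E)" using \<alpha> by (simp add: is_nat_trans_def PiE_def)
      fix A assume A: "A \<in> Obj E"
      note YA = hom_fctr_model[OF A]
      have "P (hom_fctr E A) (\<alpha> A)"
        unfolding P_def using nat_trans_natural[OF \<alpha>, of _ A] A \<alpha>_in[OF A] by simp
      then have "\<alpha> A = \<eta> (hom_fctr E A)" using P_ex1[OF YA] \<eta>P[OF YA] by blast
      then show "(\<lambda>A\<in>Obj E. \<eta> (FO (yoneda E) A)) A = \<alpha> A" using A by simp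
    qed simp
  next
    fix \<theta> assume \<theta>: "is_nat_trans (Mod E S) C F F' \<theta> \<and> (\<lambda>A\<in>Obj E. \<theta> (FO (yoneda E) A)) = \<alpha>"
    then have \<theta>\<alpha>: "\<theta> (hom_fctr E A) = \<alpha> A" if "A \<in> Obj E" for A
      using that by auto
    have "\<theta> M = \<eta> M" if M: "M \<in> Obj (Mod E S)" for M
    proof -
      have "P M (\<theta> M)"
        unfolding P_def
      proof (intro conjI ballI)
        show "\<theta> M \<in> Hom C (FO F M) (FO F' M)" using nat_trans_in_Hom[OF conjunct1[OF \<theta>] M] .
        fix A x assume A: "A \<in> Obj E" "x \<in> FO M A"
        show "Comp C (FO F (hom_fctr E A)) (FO F M) (FO F' M) (\<theta> M) (FM F (hom_fctr E A) M (element_arrow E M A x)) =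
            Comp C (FO F (hom_fctr E A)) (FO F' (hom_fctr E A)) (FO F' M)
              (FM F' (hom_fctr E A) M (element_arrow E M A x)) (\<alpha> A)"
          using nat_trans_natural[OF conjunct1[OF \<theta>] hom_fctr_model[OF A(1)] M el[OF M A]] \<theta>\<alpha>[OF A(1)] by simp
      qed
      then show ?thesis using P_ex1[OF M] \<eta>P[OF M] by blast
    qed
    then show "\<theta> = \<eta>"
      using \<theta> by (intro extensionalityI[of _ "Obj (Mod E S)"]) (auto simp: \<eta>_def is_nat_trans_def PiE_def)
  qed
qed

text \<open>Restriction is essentially surjective: the weighted colimits of a colimit model \<open>G\<close> form a
  functor on the category of models. As an arrow \<open>F M \<rightarrow> X\<close> is a weighted cocone on \<open>M\<close>,
  and thus an arrow from \<open>M\<close> into the model \<open>Hom (G -, X)\<close>, this functor is a left adjoint, and hence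
  cocontinuous; on representables it agrees with \<open>G\<close> by the Yoneda lemma.\<close>

lemma model_extends_to_cocontinuous_functor:
  fixes C :: "('c, 'p) cat"
  assumes C: "locally_small TYPE('u) C" "cocomplete TYPE('u) C"
    and G: "G \<in> Obj (colimit_models (op_cat E) (op_cone ` S) C)"
  shows "\<exists>F. cocontinuous TYPE('u) (Mod E S) C F \<and>
    isomorphic (colimit_models (op_cat E) (op_cone ` S) C) (comp_fctr (op_cat E) F (yoneda E)) G"
proof -
  have Gf: "is_functor (op_cat E) C G" using G by simp
  note Go [simp] = functor_obj[OF Gf, simplified] and Gh = functor_hom[OF Gf, simplified]
    and CC = functor_cod[OF Gf]
  have Mf: "is_functor E Set_cat M" if "M \<in> Obj (Mod E S)" for M using that by simp
  have "\<exists>L \<kappa>. \<forall>M\<in>Obj (Mod E S). is_wcolim E C G M (L M) (\<kappa> M)"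
    using wcolim_exists[OF _ C G] by metis
  then obtain L \<kappa> where L: "\<And>M. M \<in> Obj (Mod E S) \<Longrightarrow> is_wcolim E C G M (L M) (\<kappa> M)"
    by blast
  note Lo [simp] = wcolim_obj[OF L] and \<kappa> = wcolim_wcocone[OF L]
  have \<kappa>_in [simp]: "\<kappa> M A x \<in> Hom C (FO G A) (L M)"
    if "M \<in> Obj (Mod E S)" "A \<in> Obj E" "x \<in> FO M A" for M A x
    using wcocone_in_Hom[OF \<kappa>] that by blast
  have L_eqI: "u = v" if "M \<in> Obj (Mod E S)" "T \<in> Obj C" "u \<in> Hom C (L M) T" "v \<in> Hom C (L M) T"
    "\<And>A x. \<lbrakk>A \<in> Obj E; x \<in> FO M A\<rbrakk> \<Longrightarrow>
      Comp C (FO G A) (L M) T u (\<kappa> M A x) = Comp C (FO G A) (L M) T v (\<kappa> M A x)" for M T u v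
    by (rule wcolim_arrow_eqI[OF Gf Mf[OF that(1)] L[OF that(1)] that(2-)])
  define P where "P M N m u \<longleftrightarrow> u \<in> Hom C (L M) (L N) \<and> (\<forall>A\<in>Obj E. \<forall>x\<in>FO M A.
      Comp C (FO G A) (L M) (L N) u (\<kappa> M A x) = \<kappa> N A (m A x))" for M N m u
  define arr where "arr M N m = (THE u. P M N m u)" for M N m
  have P_arr: "P M N m (arr M N m)"
    if "M \<in> Obj (Mod E S)" "N \<in> Obj (Mod E S)" "m \<in> Hom (Mod E S) M N" for M N m
    unfolding arr_def P_def
  proof (rule theI', rule wcolim_ex1[OF L[OF that(1)] Lo[OF that(2)]])
    show "is_wcocone E C G M (L N) (\<lambda>A x. \<kappa> N A (m A x))"
      using that by (intro wcocone_precomp[OF Mf \<kappa>]) simp_all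
  qed
  then have arr_in [simp]: "arr M N m \<in> Hom C (L M) (L N)"
    and arr_\<kappa>: "\<And>A x. \<lbrakk>A \<in> Obj E; x \<in> FO M A\<rbrakk> \<Longrightarrow>
      Comp C (FO G A) (L M) (L N) (arr M N m) (\<kappa> M A x) = \<kappa> N A (m A x)"
    if "M \<in> Obj (Mod E S)" "N \<in> Obj (Mod E S)" "m \<in> Hom (Mod E S) M N" for M N m
    using that by (simp_all add: P_def)
  have app: "m A x \<in> FO N A" if "m \<in> Hom (Mod E S) M N" "A \<in> Obj E" "x \<in> FO M A" for M N m A x
    using that by (auto dest: set_nat_trans_apply)
  define F where "F = restrict_fctr (Mod E S) \<lparr> FO = L, FM = arr \<rparr>"
  have F_simps [simp]: "FO F M = L M" if "M \<in> Obj (Mod E S)" for M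
    using that by (simp add: F_def del: Mod_simps)
  have F_FM [simp]: "FM F M N m = arr M N m"
    if "M \<in> Obj (Mod E S)" "N \<in> Obj (Mod E S)" "m \<in> Hom (Mod E S) M N" for M N m
    using that by (simp add: F_def del: Mod_simps)
  have Ff: "is_functor (Mod E S) C F"
    unfolding F_def
  proof (rule is_functor_restrictI[OF category_Mod CC], simp_all only: fctr.simps)
    fix M assume M: "M \<in> Obj (Mod E S)"
    note id = id_in_Hom[OF category_Mod M]
    show "arr M M (Id (Mod E S) M) = Id C (L M)"
    proof (rule L_eqI[OF M Lo[OF M] arr_in[OF M M id] id_in_Hom[OF CC Lo[OF M]]])
      show "Comp C (FO G A) (L M) (L M) (arr M M (Id (Mod E S) M)) (\<kappa> M A x) =
        Comp C (FO G A) (L M) (L M) (Id C (L M)) (\<kappa> M A x)" if "A \<in> Obj E" "x \<in> FO M A" for A x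
        unfolding arr_\<kappa>[OF M M id that] Id_Mod_apply[OF that]
        using that M by (simp add: comp_id_left[OF CC] del: Mod_simps)
    qed
  next
    fix M N Q m n
    assume h: "M \<in> Obj (Mod E S)" "N \<in> Obj (Mod E S)" "Q \<in> Obj (Mod E S)"
      "m \<in> Hom (Mod E S) M N" "n \<in> Hom (Mod E S) N Q"
    note nm = comp_in_Hom[OF category_Mod h]
    show "arr M Q (Comp (Mod E S) M N Q n m) = Comp C (L M) (L N) (L Q) (arr N Q n) (arr M N m)"
    proof (rule L_eqI[OF h(1) Lo[OF h(3)] arr_in[OF h(1,3) nm]])
      show "Comp C (L M) (L N) (L Q) (arr N Q n) (arr M N m) \<in> Hom C (L M) (L Q)"
        using h by (intro comp_in_Hom[OF CC]) (simp_all del: Mod_simps)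
      fix A x assume A: "A \<in> Obj E" "x \<in> FO M A"
      show "Comp C (FO G A) (L M) (L Q) (arr M Q (Comp (Mod E S) M N Q n m)) (\<kappa> M A x) =
          Comp C (FO G A) (L M) (L Q) (Comp C (L M) (L N) (L Q) (arr N Q n) (arr M N m)) (\<kappa> M A x)"
        unfolding arr_\<kappa>[OF h(1,3) nm A] Comp_Mod_apply[OF A]
        using h A app[OF h(4) A] by (simp add: comp_assoc[OF CC, symmetric] arr_\<kappa> del: Mod_simps)
    qed
  qed (simp_all del: Mod_simps)
  have "is_colimit C (map_cocone F c)" if c: "is_colimit (Mod E S) c"
    for c :: "('u, ('e, 'u, 'u set, 'u \<Rightarrow> 'u) fctr, 'e \<Rightarrow> 'u \<Rightarrow> 'u) cone"
  proof (rule is_colimitI)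
    note k = colimit_cocone[OF c]
    note D = functor_obj[OF cocone_diagram[OF k]] and Dh = functor_hom[OF cocone_diagram[OF k]]
      and leg = cocone_leg[OF k] and M = cocone_apex[OF k]
    show "is_cocone C (map_cocone F c)" by (rule is_cocone_map_cocone[OF k Ff])
    fix X \<mu> assume X: "X \<in> Obj C"
      and \<mu>1: "\<And>i. i \<in> Obj (index (map_cocone F c)) \<Longrightarrow> \<mu> i \<in> Hom C (FO (diagram (map_cocone F c)) i) X"
      and \<mu>2: "\<And>i j f. \<lbrakk>i \<in> Obj (index (map_cocone F c)); j \<in> Obj (index (map_cocone F c));
        f \<in> Hom (index (map_cocone F c)) i j\<rbrakk> \<Longrightarrow>
        Comp C (FO (diagram (map_cocone F c)) i) (FO (diagram (map_cocone F c)) j) X (\<mu> j)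
          (FM (diagram (map_cocone F c)) i j f) = \<mu> i"
    have \<mu>_in [simp]: "\<mu> i \<in> Hom C (L (FO (diagram c) i)) X" if "i \<in> Obj (index c)" for i
      using \<mu>1[of i] that D[OF that] by (simp del: Mod_simps)
    have \<mu>: "Comp C (L (FO (diagram c) i)) (L (FO (diagram c) j)) X (\<mu> j)
        (arr (FO (diagram c) i) (FO (diagram c) j) (FM (diagram c) i j f)) = \<mu> i"
      if "i \<in> Obj (index c)" "j \<in> Obj (index c)" "f \<in> Hom (index c) i j" for i j f
      using \<mu>2[of i j f] that D[OF that(1)] D[OF that(2)] Dh[OF that] by (simp del: Mod_simps)
    have "\<exists>\<psi>. is_wcocone E C G (apex c) X \<psi> \<and>
        (\<forall>i\<in>Obj (index c). \<forall>A\<in>Obj E. \<forall>x\<in>FO (FO (diagram c) i) A. \<psi> A (leg c i A x) =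
          Comp C (FO G A) (L (FO (diagram c) i)) X (\<mu> i) (\<kappa> (FO (diagram c) i) A x))"
    proof (rule glue_wcocones[OF sketch C(1) G X c])
      show "is_wcocone E C G (FO (diagram c) i) X
          (\<lambda>A x. Comp C (FO G A) (L (FO (diagram c) i)) X (\<mu> i) (\<kappa> (FO (diagram c) i) A x))"
        if i: "i \<in> Obj (index c)" for i
        by (rule wcocone_postcomp[OF Gf Mf[OF D[OF i]] \<kappa>[OF D[OF i]] \<mu>_in[OF i] Lo[OF D[OF i]] X])
      fix i j f A x
      assume h: "i \<in> Obj (index c)" "j \<in> Obj (index c)" "f \<in> Hom (index c) i j"
        and A: "A \<in> Obj E" "x \<in> FO (FO (diagram c) i) A"
      show "Comp C (FO G A) (L (FO (diagram c) j)) X (\<mu> j) (\<kappa> (FO (diagram c) j) A (FM (diagram c) i j f A x)) =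
          Comp C (FO G A) (L (FO (diagram c) i)) X (\<mu> i) (\<kappa> (FO (diagram c) i) A x)"
        unfolding arr_\<kappa>[OF D[OF h(1)] D[OF h(2)] Dh[OF h] A, symmetric] \<mu>[OF h, symmetric]
        using h A D Dh[OF h] X by (intro comp_assoc[OF CC]) (simp_all del: Mod_simps)
    qed
    then obtain \<psi> where \<psi>: "is_wcocone E C G (apex c) X \<psi>"
      and \<psi>_leg: "\<And>i A x. \<lbrakk>i \<in> Obj (index c); A \<in> Obj E; x \<in> FO (FO (diagram c) i) A\<rbrakk> \<Longrightarrow>
        \<psi> A (leg c i A x) = Comp C (FO G A) (L (FO (diagram c) i)) X (\<mu> i) (\<kappa> (FO (diagram c) i) A x)"
      by blast
    have arr_leg: "Comp C (FO G A) (L (FO (diagram c) i)) X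
          (Comp C (L (FO (diagram c) i)) (L (apex c)) X u (arr (FO (diagram c) i) (apex c) (leg c i)))
          (\<kappa> (FO (diagram c) i) A x) =
        Comp C (FO G A) (L (apex c)) X u (\<kappa> (apex c) A (leg c i A x))"
      if "u \<in> Hom C (L (apex c)) X" "i \<in> Obj (index c)" "A \<in> Obj E" "x \<in> FO (FO (diagram c) i) A"
      for u i A x
      unfolding arr_\<kappa>[OF D[OF that(2)] M leg[OF that(2)] that(3,4), symmetric]
      using that D[OF that(2)] M leg[OF that(2)] X
      by (intro comp_assoc[OF CC, symmetric]) (simp_all del: Mod_simps)
    \<comment> \<open>\<open>u\<close> restricts to the given cocone exactly if it corresponds to the glued weighted cocone\<close>
    have iff: "(\<forall>A\<in>Obj E. \<forall>x\<in>FO (apex c) A. Comp C (FO G A) (L (apex c)) X u (\<kappa> (apex c) A x) = \<psi> A x)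
        \<longleftrightarrow> (\<forall>i\<in>Obj (index c). Comp C (L (FO (diagram c) i)) (L (apex c)) X u
          (arr (FO (diagram c) i) (apex c) (leg c i)) = \<mu> i)" (is "?l \<longleftrightarrow> ?r")
      if u: "u \<in> Hom C (L (apex c)) X" for u
    proof
      assume l: ?l
      show ?r
      proof
        fix i assume i: "i \<in> Obj (index c)"
        show "Comp C (L (FO (diagram c) i)) (L (apex c)) X u (arr (FO (diagram c) i) (apex c) (leg c i)) = \<mu> i"
        proof (rule L_eqI[OF D[OF i] X _ \<mu>_in[OF i]])
          show "Comp C (L (FO (diagram c) i)) (L (apex c)) X u (arr (FO (diagram c) i) (apex c) (leg c i))
              \<in> Hom C (L (FO (diagram c) i)) X"
            using u D[OF i] M leg[OF i] X by (intro comp_in_Hom[OF CC]) (simp_all del: Mod_simps)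
          show "Comp C (FO G A) (L (FO (diagram c) i)) X
              (Comp C (L (FO (diagram c) i)) (L (apex c)) X u (arr (FO (diagram c) i) (apex c) (leg c i)))
              (\<kappa> (FO (diagram c) i) A x) =
            Comp C (FO G A) (L (FO (diagram c) i)) X (\<mu> i) (\<kappa> (FO (diagram c) i) A x)"
            if A: "A \<in> Obj E" "x \<in> FO (FO (diagram c) i) A" for A x
            using l app[OF leg[OF i] A] A by (simp add: arr_leg[OF u i A] \<psi>_leg[OF i A])
        qed
      qed
    next
      assume r: ?r
      show ?l
      proof (intro ballI)
        fix A x assume A: "A \<in> Obj E" "x \<in> FO (apex c) A"
        show "Comp C (FO G A) (L (apex c)) X u (\<kappa> (apex c) A x) = \<psi> A x"
        proof (rule wcocone_eqI[OF sketch C(1) G X c _ \<psi> _ A])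
          show "is_wcocone E C G (apex c) X (\<lambda>A x. Comp C (FO G A) (L (apex c)) X u (\<kappa> (apex c) A x))"
            by (rule wcocone_postcomp[OF Gf Mf[OF M] \<kappa>[OF M] u Lo[OF M] X])
        qed (use r in \<open>simp add: arr_leg[OF u, symmetric] \<psi>_leg\<close>)
      qed
    qed
    have "\<exists>!u. u \<in> Hom C (L (apex c)) X \<and>
        (\<forall>i\<in>Obj (index c). Comp C (L (FO (diagram c) i)) (L (apex c)) X u
          (arr (FO (diagram c) i) (apex c) (leg c i)) = \<mu> i)"
      using wcolim_ex1[OF L[OF M] X \<psi>] iff by (simp cong: conj_cong)
    then show "\<exists>!u. u \<in> Hom C (apex (map_cocone F c)) X \<and>
        (\<forall>i\<in>Obj (index (map_cocone F c)). Comp C (FO (diagram (map_cocone F c)) i)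
          (apex (map_cocone F c)) X u (leg (map_cocone F c) i) = \<mu> i)"
      using D M leg by (simp del: Mod_simps cong: ball_cong)
  qed
  then have F: "cocontinuous TYPE('u) (Mod E S) C F"
    using Ff unfolding cocontinuous_def by blast
  have "isomorphic (fctr_cat (op_cat E) C) G (comp_fctr (op_cat E) F (yoneda E))"
  proof -
    \<comment> \<open>the leg at the universal element of the representable at \<open>A\<close>; its inverse is the arrow given
      by the action of \<open>G\<close>, which is a weighted cocone on this representable with vertex \<open>G A\<close>\<close>
    define \<sigma> where "\<sigma> A = \<kappa> (hom_fctr E A) A (Id E A)" for A
    have YA: "hom_fctr E A \<in> Obj (Mod E S)" and id: "Id E A \<in> FO (hom_fctr E A) A" if "A \<in> Obj E" for A
      using that hom_fctr_model by (simp_all add: id_in_Hom[OF category_E])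
    have \<sigma>_in: "\<sigma> A \<in> Hom C (FO G A) (L (hom_fctr E A))" if "A \<in> Obj E" for A
      unfolding \<sigma>_def by (rule \<kappa>_in[OF YA[OF that] that id[OF that]])
    have \<sigma>: "Comp C (FO G B) (FO G A) (L (hom_fctr E A)) (\<sigma> A) (FM G B A h) = \<kappa> (hom_fctr E A) B h"
      if "A \<in> Obj E" "B \<in> Obj E" "h \<in> Hom E A B" for A B h
      using wcocone_natural[OF \<kappa>[OF YA[OF that(1)]] that(1) that(2,3) id[OF that(1)]] that
      by (simp add: \<sigma>_def id_in_Hom[OF category_E] comp_id_right[OF category_E])
    have "\<exists>u. u \<in> Hom C (L (hom_fctr E A)) (FO G A) \<and> (\<forall>B\<in>Obj E. \<forall>h\<in>Hom E A B.
        Comp C (FO G B) (L (hom_fctr E A)) (FO G A) u (\<kappa> (hom_fctr E A) B h) = FM G B A h)"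
      if A: "A \<in> Obj E" for A
    proof -
      have "is_wcocone E C G (hom_fctr E A) (FO G A)
          (\<lambda>B h. Comp C (FO G B) (FO G A) (FO G A) (Id C (FO G A)) (FM G B A h))"
        using A by (intro wcocone_hom_fctr[OF locally_small_E Gf A]) (simp_all add: id_in_Hom[OF CC])
      from wcolim_ex1[OF L[OF YA[OF A]] Go[OF A] this]
      obtain u where "u \<in> Hom C (L (hom_fctr E A)) (FO G A)"
        "\<forall>B\<in>Obj E. \<forall>h\<in>FO (hom_fctr E A) B. Comp C (FO G B) (L (hom_fctr E A)) (FO G A) u (\<kappa> (hom_fctr E A) B h) =
          Comp C (FO G B) (FO G A) (FO G A) (Id C (FO G A)) (FM G B A h)"
        by blast
      then show ?thesis
        using A by (intro exI[of _ u]) (simp add: comp_id_left[OF CC] Gh)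
    qed
    then obtain \<theta> where \<theta>_in: "\<And>A. A \<in> Obj E \<Longrightarrow> \<theta> A \<in> Hom C (L (hom_fctr E A)) (FO G A)"
      and \<theta>: "\<And>A B h. \<lbrakk>A \<in> Obj E; B \<in> Obj E; h \<in> Hom E A B\<rbrakk> \<Longrightarrow>
        Comp C (FO G B) (L (hom_fctr E A)) (FO G A) (\<theta> A) (\<kappa> (hom_fctr E A) B h) = FM G B A h"
      by metis
    have el: "element_arrow E (hom_fctr E A) B f \<in> Hom (Mod E S) (hom_fctr E B) (hom_fctr E A)"
      if "A \<in> Obj E" "B \<in> Obj E" "f \<in> Hom E A B" for A B f
      using that by (intro element_arrow_Hom YA) simp_all
    show ?thesis
    proof (rule isomorphic_fctrI[OF Gf is_functor_comp_fctr[OF is_functor_yoneda Ff], where \<theta> = \<theta>])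
      show "is_nat_trans (op_cat E) C G (comp_fctr (op_cat E) F (yoneda E)) (\<lambda>A\<in>Obj (op_cat E). \<sigma> A)"
      proof (rule is_nat_trans_restrictI)
        show "\<sigma> A \<in> Hom C (FO G A) (FO (comp_fctr (op_cat E) F (yoneda E)) A)" if "A \<in> Obj (op_cat E)" for A
          using that \<sigma>_in YA by (simp del: Mod_simps)
        fix B A f assume "B \<in> Obj (op_cat E)" "A \<in> Obj (op_cat E)" "f \<in> Hom (op_cat E) B A"
        then have h: "A \<in> Obj E" "B \<in> Obj E" "f \<in> Hom E A B" by simp_all
        have "Comp C (FO G B) (L (hom_fctr E B)) (L (hom_fctr E A))
            (arr (hom_fctr E B) (hom_fctr E A) (element_arrow E (hom_fctr E A) B f)) (\<sigma> B) =
          \<kappa> (hom_fctr E A) B (element_arrow E (hom_fctr E A) B f B (Id E B))"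
          unfolding \<sigma>_def by (rule arr_\<kappa>[OF YA[OF h(2)] YA[OF h(1)] el[OF h] h(2) id[OF h(2)]])
        also have "\<dots> = Comp C (FO G B) (FO G A) (L (hom_fctr E A)) (\<sigma> A) (FM G B A f)"
          using h by (simp add: \<sigma> id_in_Hom[OF category_E] comp_id_left[OF category_E])
        finally show "Comp C (FO G B) (FO G A) (FO (comp_fctr (op_cat E) F (yoneda E)) A) (\<sigma> A) (FM G B A f) =
            Comp C (FO G B) (FO (comp_fctr (op_cat E) F (yoneda E)) B) (FO (comp_fctr (op_cat E) F (yoneda E)) A)
              (FM (comp_fctr (op_cat E) F (yoneda E)) B A f) (\<sigma> B)"
          using h YA el[OF h] by (simp del: Mod_simps)
      qed
      fix A assume "A \<in> Obj (op_cat E)"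
      then have A: "A \<in> Obj E" by simp
      show "\<theta> A \<in> Hom C (FO (comp_fctr (op_cat E) F (yoneda E)) A) (FO G A)"
        using A \<theta>_in YA by (simp del: Mod_simps)
      have \<theta>\<sigma>: "Comp C (FO G A) (L (hom_fctr E A)) (FO G A) (\<theta> A) (\<sigma> A) = Id C (FO G A)"
        using \<theta>[OF A A id_in_Hom[OF category_E A]] functor_id[OF Gf, of A] A by (simp add: \<sigma>_def)
      then show "Comp C (FO G A) (FO (comp_fctr (op_cat E) F (yoneda E)) A) (FO G A) (\<theta> A)
          ((\<lambda>A\<in>Obj (op_cat E). \<sigma> A) A) = Id C (FO G A)"
        using A YA by (simp del: Mod_simps)
      have "Comp C (L (hom_fctr E A)) (FO G A) (L (hom_fctr E A)) (\<sigma> A) (\<theta> A) = Id C (L (hom_fctr E A))"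
      proof (rule L_eqI[OF YA[OF A] Lo[OF YA[OF A]]])
        show "Comp C (L (hom_fctr E A)) (FO G A) (L (hom_fctr E A)) (\<sigma> A) (\<theta> A)
            \<in> Hom C (L (hom_fctr E A)) (L (hom_fctr E A))"
          using A YA \<sigma>_in \<theta>_in by (intro comp_in_Hom[OF CC]) (simp_all del: Mod_simps)
        show "Id C (L (hom_fctr E A)) \<in> Hom C (L (hom_fctr E A)) (L (hom_fctr E A))"
          by (rule id_in_Hom[OF CC Lo[OF YA[OF A]]])
        fix B h assume B: "B \<in> Obj E" "h \<in> FO (hom_fctr E A) B"
        note \<kappa>h = \<kappa>_in[OF YA[OF A] B]
        have "Comp C (FO G B) (L (hom_fctr E A)) (L (hom_fctr E A))
            (Comp C (L (hom_fctr E A)) (FO G A) (L (hom_fctr E A)) (\<sigma> A) (\<theta> A)) (\<kappa> (hom_fctr E A) B h) =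
          Comp C (FO G B) (FO G A) (L (hom_fctr E A)) (\<sigma> A)
            (Comp C (FO G B) (L (hom_fctr E A)) (FO G A) (\<theta> A) (\<kappa> (hom_fctr E A) B h))"
          using A B YA \<sigma>_in \<theta>_in \<kappa>h by (intro comp_assoc[OF CC, symmetric]) (simp_all del: Mod_simps)
        also have "\<dots> = \<kappa> (hom_fctr E A) B h"
          using A B by (simp add: \<theta> \<sigma>)
        finally show "Comp C (FO G B) (L (hom_fctr E A)) (L (hom_fctr E A))
            (Comp C (L (hom_fctr E A)) (FO G A) (L (hom_fctr E A)) (\<sigma> A) (\<theta> A)) (\<kappa> (hom_fctr E A) B h) =
          Comp C (FO G B) (L (hom_fctr E A)) (L (hom_fctr E A)) (Id C (L (hom_fctr E A))) (\<kappa> (hom_fctr E A) B h)"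
          using comp_id_left[OF CC Go[OF B(1)] Lo[OF YA[OF A]] \<kappa>h] by simp
      qed
      then show "Comp C (FO (comp_fctr (op_cat E) F (yoneda E)) A) (FO G A)
          (FO (comp_fctr (op_cat E) F (yoneda E)) A) ((\<lambda>A\<in>Obj (op_cat E). \<sigma> A) A) (\<theta> A) =
        Id C (FO (comp_fctr (op_cat E) F (yoneda E)) A)"
        using A YA by (simp del: Mod_simps)
    qed
  qed
  then have "isomorphic (colimit_models (op_cat E) (op_cone ` S) C) (comp_fctr (op_cat E) F (yoneda E)) G"
    using isomorphic_sym G yoneda_comp_model[OF F]
    by (simp add: colimit_models_def isomorphic_full_subcat)
  with F show ?thesis by blast
qed

lemma is_equivalence_precomp_yoneda:
  fixes C :: "('c, 'p) cat"
  assumes C: "locally_small TYPE('u) C" "cocomplete TYPE('u) C"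
  shows "is_equivalence (Hom_c TYPE('u) (Mod E S) C) (colimit_models (op_cat E) (op_cone ` S) C)
    (precomp (Hom_c TYPE('u) (Mod E S) C) (op_cat E) (yoneda E))"
    (is "is_equivalence ?K ?L ?R")
proof (rule is_equivalenceI)
  show "is_functor ?K ?L ?R"
    by (rule is_functor_precomp[OF op_sketch_small_cocones yoneda_model])
  show "\<exists>F\<in>Obj ?K. isomorphic ?L (FO ?R F) G" if "G \<in> Obj ?L" for G
    using model_extends_to_cocontinuous_functor[OF C that] by auto
  show "\<exists>!\<eta>. \<eta> \<in> Hom ?K F F' \<and> FM ?R F F' \<eta> = \<alpha>"
    if "F \<in> Obj ?K" "F' \<in> Obj ?K" "\<alpha> \<in> Hom ?L (FO ?R F) (FO ?R F')" for F F' \<alpha>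
    using nat_trans_extends_uniquely[OF C(1), of F F' \<alpha>] that by (simp cong: conj_cong)
qed

end

theorem theorem1p1:
  fixes E :: "('e, 'u) cat" and S :: "('u, 'e, 'u) cone set"
  assumes "small_universe TYPE('u)"
    and "limit_sketch E S"
    and "realized E S"
    and "\<forall>M\<in>Obj (Mod E S). small_model E S M"
  shows
    "(\<forall>C :: ('c, 'p) cat. locally_small TYPE('u) C \<and> cocomplete TYPE('u) C \<longrightarrow>
        is_equivalence
          (Hom_c TYPE('u) (Mod E S) C)
          (colimit_models (op_cat E) (op_cone ` S) C)
          (precomp (Hom_c TYPE('u) (Mod E S) C) (op_cat E) (yoneda E)))
     \<and>
     (\<forall>(C :: ('c, 'p) cat) (C' :: ('d, 'q) cat) H.
        locally_small TYPE('u) C \<and> cocomplete TYPE('u) C \<and>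
        locally_small TYPE('u) C' \<and> cocomplete TYPE('u) C' \<and>
        cocontinuous TYPE('u) C C' H \<longrightarrow>
        comp_fctr (Hom_c TYPE('u) (Mod E S) C)
          (precomp (Hom_c TYPE('u) (Mod E S) C') (op_cat E) (yoneda E))
          (postcomp (Hom_c TYPE('u) (Mod E S) C) (Mod E S) H)
        =
        comp_fctr (Hom_c TYPE('u) (Mod E S) C)
          (postcomp (colimit_models (op_cat E) (op_cone ` S) C) (op_cat E) H)
          (precomp (Hom_c TYPE('u) (Mod E S) C) (op_cat E) (yoneda E)))
     \<and>
     (cocomplete TYPE('u) (Mod E S) \<longrightarrow>
        universal_example TYPE('u) TYPE('c) TYPE('p)
          (op_cat E) (op_cone ` S) (Mod E S) (yoneda E))"
proof -
  interpret small_model_sketch E S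
    using assms by unfold_locales
  note eq = is_equivalence_precomp_yoneda
  show ?thesis
    unfolding universal_example_def
    using eq precomp_postcomp[OF op_sketch_small_cocones yoneda_model]
      locally_small_Mod yoneda_model by blast
qed

end
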